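(* Let $G=(A\cup B,E)$ be a bipartite graph with $|A|=|B|=n$ and $|E|=m$, where every agent $a\in A$ has a strict partial order over her neighbors. For any $k\in\mathbb{Z}_{\ge 0}$, the $k$-unpopularity margin problem in $G$ (decide whether $G$ admits an assignment $M$ with $\mu(M)\le k$) can be solved in $O(m^{k+1}\cdot n^{5/2})$ time.
   Context: Agents are the nodes of $A$, objects the nodes of $B$; objects have no preferences. For matchings $M,N$, an agent $a$ prefers $M$ to $N$ if $a$ is matched in $M$ and either unmatched in $N$ or $M(a)\succ_a N(a)$. Let $\phi(M,N)$ be the number of agents preferring $M$ to $N$ and $\Delta(M,N)=\phi(M,N)-\phi(N,M)$. An assignment is a perfect matching of $G$. The unpopularity margin of an assignment $M$ is $\mu(M)=\max_N \Delta(N,M)$, the maximum over all perfect matchings $N$ of $G$. *)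

theory Defs
  imports Complex_Main
begin

section \<open>Assignments and the unpopularity margin\<close>

text \<open>
  An edge is a pair of an agent and an object, so agents and objects are kept apart by their
  position in the pair. \<open>(b, c) \<in> P a\<close> means that agent \<open>a\<close> strictly prefers \<open>b\<close> to \<open>c\<close>.
\<close>

type_synonym ('a, 'b) prefs = "'a \<Rightarrow> ('b \<times> 'b) set"

definition bipartite_graph :: "'a set \<Rightarrow> 'b set \<Rightarrow> ('a \<times> 'b) set \<Rightarrow> bool" where
  "bipartite_graph A B E \<longleftrightarrow> finite A \<and> finite B \<and> E \<subseteq> A \<times> B"

definition neighbours :: "('a \<times> 'b) set \<Rightarrow> 'a \<Rightarrow> 'b set" where
  "neighbours E a = {b. (a, b) \<in> E}"

definition strict_partial_order_on :: "'b set \<Rightarrow> ('b \<times> 'b) set \<Rightarrow> bool" where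
  "strict_partial_order_on S R \<longleftrightarrow> R \<subseteq> S \<times> S \<and> irrefl R \<and> trans R"

definition preference_system :: "'a set \<Rightarrow> ('a \<times> 'b) set \<Rightarrow> ('a, 'b) prefs \<Rightarrow> bool" where
  "preference_system A E P \<longleftrightarrow> (\<forall>a\<in>A. strict_partial_order_on (neighbours E a) (P a))"

definition matching :: "('a \<times> 'b) set \<Rightarrow> ('a \<times> 'b) set \<Rightarrow> bool" where
  "matching E M \<longleftrightarrow> M \<subseteq> E \<and>
     (\<forall>a b a' b'. (a, b) \<in> M \<longrightarrow> (a', b') \<in> M \<longrightarrow> (a = a' \<longleftrightarrow> b = b'))"

definition matched :: "('a \<times> 'b) set \<Rightarrow> 'a \<Rightarrow> bool" where
  "matched M a \<longleftrightarrow> (\<exists>b. (a, b) \<in> M)"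

definition partner :: "('a \<times> 'b) set \<Rightarrow> 'a \<Rightarrow> 'b" where
  "partner M a = (THE b. (a, b) \<in> M)"

definition assignment :: "'a set \<Rightarrow> 'b set \<Rightarrow> ('a \<times> 'b) set \<Rightarrow> ('a \<times> 'b) set \<Rightarrow> bool" where
  "assignment A B E M \<longleftrightarrow> matching E M \<and> Domain M = A \<and> Range M = B"

definition prefers ::
  "('a, 'b) prefs \<Rightarrow> 'a \<Rightarrow> ('a \<times> 'b) set \<Rightarrow> ('a \<times> 'b) set \<Rightarrow> bool" where
  "prefers P a M N \<longleftrightarrow>
     matched M a \<and> (\<not> matched N a \<or> (partner M a, partner N a) \<in> P a)"

definition phi ::
  "'a set \<Rightarrow> ('a, 'b) prefs \<Rightarrow> ('a \<times> 'b) set \<Rightarrow> ('a \<times> 'b) set \<Rightarrow> nat" where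
  "phi A P M N = card {a \<in> A. prefers P a M N}"

definition Delta ::
  "'a set \<Rightarrow> ('a, 'b) prefs \<Rightarrow> ('a \<times> 'b) set \<Rightarrow> ('a \<times> 'b) set \<Rightarrow> int" where
  "Delta A P M N = int (phi A P M N) - int (phi A P N M)"

definition unpopularity_margin ::
  "'a set \<Rightarrow> 'b set \<Rightarrow> ('a \<times> 'b) set \<Rightarrow> ('a, 'b) prefs \<Rightarrow> ('a \<times> 'b) set \<Rightarrow> int" where
  "unpopularity_margin A B E P M = Max {Delta A P N M | N. assignment A B E N}"

definition k_unpopularity_margin_problem ::
  "nat \<Rightarrow> 'a set \<Rightarrow> 'b set \<Rightarrow> ('a \<times> 'b) set \<Rightarrow> ('a, 'b) prefs \<Rightarrow> bool" where
  "k_unpopularity_margin_problem k A B E P \<longleftrightarrow>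
     (\<exists>M. assignment A B E M \<and> unpopularity_margin A B E P M \<le> int k)"


section \<open>Random access machines\<close>

text \<open>
  The unit-cost random access machine of Cook and Reckhow, with structured control flow in place
  of jumps, which changes running times only by a constant factor depending on the program.
  Registers are addressed by constants in the program, memory cells indirectly through registers.
  Every instruction and every test costs one step. The only arithmetic is addition and
  (truncated) subtraction: with unit-cost multiplication the model would be unreasonably powerful.
\<close>

datatype com =
    Skip
  | Set nat nat
  | Add nat nat nat
  | Sub nat nat nat
  | Load nat nat
  | Store nat nat
  | Seq com com
  | Cond nat com com
  | Loop nat com

type_synonym state = "(nat \<Rightarrow> nat) \<times> (nat \<Rightarrow> nat)"

text \<open>\<open>exec c s t s'\<close>: started in \<open>s\<close>, \<open>c\<close> halts in \<open>s'\<close> after exactly \<open>t\<close> steps.\<close>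

inductive exec :: "com \<Rightarrow> state \<Rightarrow> nat \<Rightarrow> state \<Rightarrow> bool" where
  Skip: "exec Skip s 1 s"
| Set: "exec (Set i c) (r, h) 1 (r(i := c), h)"
| Add: "exec (Add i j l) (r, h) 1 (r(i := r j + r l), h)"
| Sub: "exec (Sub i j l) (r, h) 1 (r(i := r j - r l), h)"
| Load: "exec (Load i j) (r, h) 1 (r(i := h (r j)), h)"
| Store: "exec (Store i j) (r, h) 1 (r, h(r i := r j))"
| Seq: "exec c1 s t1 s' \<Longrightarrow> exec c2 s' t2 s'' \<Longrightarrow> exec (Seq c1 c2) s (t1 + t2) s''"
| CondTrue: "fst s i > 0 \<Longrightarrow> exec c1 s t s' \<Longrightarrow> exec (Cond i c1 c2) s (Suc t) s'"
| CondFalse: "fst s i = 0 \<Longrightarrow> exec c2 s t s' \<Longrightarrow> exec (Cond i c1 c2) s (Suc t) s'"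
| LoopTrue: "fst s i > 0 \<Longrightarrow> exec c s t1 s' \<Longrightarrow> exec (Loop i c) s' t2 s'' \<Longrightarrow>
    exec (Loop i c) s (Suc (t1 + t2)) s''"
| LoopFalse: "fst s i = 0 \<Longrightarrow> exec (Loop i c) s 1 s"

definition initial_state :: "nat list \<Rightarrow> state" where
  "initial_state xs = ((\<lambda>_. 0), (\<lambda>i. if i < length xs then xs ! i else 0))"

definition decides_within :: "com \<Rightarrow> nat list \<Rightarrow> bool \<Rightarrow> real \<Rightarrow> bool" where
  "decides_within c xs answer T \<longleftrightarrow>
     (\<exists>t r h. exec c (initial_state xs) t (r, h) \<and> real t \<le> T \<and>
        r 0 = (if answer then 1 else 0))"

text \<open>
  \<open>encodes I xs\<close> relates the legal instances \<open>I\<close> to their (possibly many) encodings \<open>xs\<close>. One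
  program and one constant serve all encodings of all instances. The maximum with 1 only matters
  for instances on which \<open>f\<close> is below 1 (here, where it vanishes): no program halts in 0 steps.
\<close>

definition solvable_in_time_O ::
  "('i \<Rightarrow> nat list \<Rightarrow> bool) \<Rightarrow> ('i \<Rightarrow> bool) \<Rightarrow> ('i \<Rightarrow> real) \<Rightarrow> bool" where
  "solvable_in_time_O encodes Q f \<longleftrightarrow>
     (\<exists>c C. \<forall>I xs. encodes I xs \<longrightarrow> decides_within c xs (Q I) (C * max 1 (f I)))"


section \<open>Instances as machine input\<close>

text \<open>
  Agents and objects are each numbered \<open>0, \<dots>, n - 1\<close>. The edges and the comparisons
  (agent, better object, worse object) are listed explicitly, in arbitrary order but without
  repetitions, each list preceded by its length.
\<close>

type_synonym margin_instance = "nat \<times> (nat \<times> nat) set \<times> (nat, nat) prefs"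

fun encodes_margin_instance :: "margin_instance \<Rightarrow> nat list \<Rightarrow> bool" where
  "encodes_margin_instance (n, E, P) xs \<longleftrightarrow>
     bipartite_graph {..<n} {..<n} E \<and> preference_system {..<n} E P \<and>
     (\<exists>es ps. distinct es \<and> set es = E \<and>
        distinct ps \<and> set ps = {(a, b, c). a < n \<and> (b, c) \<in> P a} \<and>
        xs = [n, length es] @ concat (map (\<lambda>(a, b). [a, b]) es) @
             [length ps] @ concat (map (\<lambda>(a, b, c). [a, b, c]) ps))"

end

theory Submission
  imports Defs "HOL-Combinatorics.Cycles"
begin

text \<open>
  By linear programming duality, an assignment has unpopularity margin at most \<open>k\<close> iff there are integer
  levels of the objects (negated dual values) for which its edges have total slack at most \<open>k\<close>. The
  program tries all \<open>m ^ k\<close> ways of distributing this slack over the edges. A guess determines, for given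
  levels, which edges are valid, i.e. can belong to an assignment certified by the levels.

  For a fixed guess the least suitable levels are approached from below. All levels start at 0. If
  no augmenting path of valid edges starts in an unmatched object, then its level is too low in any
  solution, and it is raised by one. Since the levels of some solution are below \<open>n\<close>, there are fewer than
  \<open>n * n + 1\<close> rounds. In each round, the numbers of constraints that make edges invalid are
  updated in time \<open>O(m)\<close>, and an auction with prices up to \<open>sqrt n\<close> takes time \<open>O(m * sqrt n)\<close> and leaves at
  most \<open>sqrt n\<close> augmentations, each in time \<open>O(m)\<close>.
\<close>

section \<open>A structured language over the random access machine\<close>

text \<open>Dual values alone give no monotone search, because whether an edge can be used also
  depends on the dual value of its agent. Prescribing the slack of the matching edge eliminates that
  value and leaves a condition on levels only. Slacks are integers, since dual values arise as
  weights of walks; so \<open>k\<close> units placed on edges describe all of them. A unit on one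
  edge of an agent discards the agent's other edges. Hence two surviving edges of one agent both
  have slack 0, their mutual votes cancel, and an object whose level already agrees with that of a
  solution forces agreement on every object with a valid edge to its partner in the solution. This
  closure property turns a failed search into a Hall-type count: were the root's level already
  right, its tight objects would have too few partners. The conclusion holds for every solution
  above the current levels at once, so raising never overshoots any of them. The machine has no
  multiplication, so products needed as addresses are tabulated by repeated addition. Instances for
  which the time bound vanishes must be settled before any table is built.\<close>

type_synonym env = "nat \<Rightarrow> nat"
type_synonym arrs = "nat \<Rightarrow> nat \<Rightarrow> nat"

datatype ex = Cn nat | Vr nat | Pl ex ex | Mi ex ex | Rd nat ex | In ex

datatype hc = Asg nat ex | Sto nat ex ex | Sq hc hc  (infixr \<open>;;\<close> 60) | Br ex hc hc | Wh ex hc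

text \<open>
  Above the input \<open>xs\<close>, memory is split into 32 interleaved lanes, each an unbounded array that is
  initially zero; so no array needs a length and arrays never overlap.
\<close>

definition mem :: "nat list \<Rightarrow> arrs \<Rightarrow> nat \<Rightarrow> nat" where
  "mem xs A i = (if i < length xs then xs ! i
     else A ((i - length xs) mod 32) ((i - length xs) div 32))"

fun ev :: "nat list \<Rightarrow> ex \<Rightarrow> env \<Rightarrow> arrs \<Rightarrow> nat" where
  "ev xs (Cn c) v A = c"
| "ev xs (Vr x) v A = v x"
| "ev xs (Pl e f) v A = ev xs e v A + ev xs f v A"
| "ev xs (Mi e f) v A = ev xs e v A - ev xs f v A"
| "ev xs (Rd j e) v A = A j (ev xs e v A)"
| "ev xs (In e) v A = mem xs A (ev xs e v A)"

inductive hx :: "nat list \<Rightarrow> hc \<Rightarrow> env \<Rightarrow> arrs \<Rightarrow> nat \<Rightarrow> env \<Rightarrow> arrs \<Rightarrow> bool" for xs where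
  hx_Asg: "hx xs (Asg x e) v A 1 (v(x := ev xs e v A)) A"
| hx_Sto: "hx xs (Sto j e f) v A 1 v (A(j := (A j)(ev xs e v A := ev xs f v A)))"
| hx_Sq: "hx xs c v A t v' A' \<Longrightarrow> hx xs d v' A' u v'' A'' \<Longrightarrow> hx xs (Sq c d) v A (t + u) v'' A''"
| hx_BrT: "ev xs e v A > 0 \<Longrightarrow> hx xs c v A t v' A' \<Longrightarrow> hx xs (Br e c d) v A (Suc t) v' A'"
| hx_BrF: "ev xs e v A = 0 \<Longrightarrow> hx xs d v A t v' A' \<Longrightarrow> hx xs (Br e c d) v A (Suc t) v' A'"
| hx_WhT: "ev xs e v A > 0 \<Longrightarrow> hx xs c v A t v' A' \<Longrightarrow> hx xs (Wh e c) v' A' u v'' A'' \<Longrightarrow>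
    hx xs (Wh e c) v A (Suc (t + u)) v'' A''"
| hx_WhF: "ev xs e v A = 0 \<Longrightarrow> hx xs (Wh e c) v A 1 v A"

primrec mv :: "hc \<Rightarrow> nat set" where
  "mv (Asg x e) = {x}"
| "mv (Sto j e f) = {}"
| "mv (Sq c d) = mv c \<union> mv d"
| "mv (Br e c d) = mv c \<union> mv d"
| "mv (Wh e c) = mv c"

primrec ma :: "hc \<Rightarrow> nat set" where
  "ma (Asg x e) = {}"
| "ma (Sto j e f) = {j}"
| "ma (Sq c d) = ma c \<union> ma d"
| "ma (Br e c d) = ma c \<union> ma d"
| "ma (Wh e c) = ma c"

definition same_off :: "nat set \<Rightarrow> (nat \<Rightarrow> 'c) \<Rightarrow> (nat \<Rightarrow> 'c) \<Rightarrow> bool" where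
  "same_off S f g \<longleftrightarrow> (\<forall>x. x \<notin> S \<longrightarrow> f x = g x)"

lemma same_offD: "same_off S f g \<Longrightarrow> x \<notin> S \<Longrightarrow> f x = g x"
  by (simp add: same_off_def)

lemma hx_same_off:
  "hx xs c v A t v' A' \<Longrightarrow> same_off (mv c) v' v \<and> same_off (ma c) A' A"
  by (induction rule: hx.induct) (auto simp: same_off_def)

text \<open>The clock is an argument of the postcondition, so time bounds travel in the same
  invariants as correctness. Existence of a halting run is total correctness, because a program has
  at most one run from a given state.\<close>

definition wp :: "nat list \<Rightarrow> hc \<Rightarrow> (env \<Rightarrow> arrs \<Rightarrow> nat \<Rightarrow> bool) \<Rightarrow> env \<Rightarrow> arrs \<Rightarrow> nat \<Rightarrow> bool" where
  "wp xs c Q v A t \<longleftrightarrow> (\<exists>v' A' u. hx xs c v A u v' A' \<and> Q v' A' (t + u))"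

lemma wp_Asg [simp]: "wp xs (Asg x e) Q v A t \<longleftrightarrow> Q (v(x := ev xs e v A)) A (Suc t)"
proof -
  have "hx xs (Asg x e) v A u v' A' \<longleftrightarrow> u = 1 \<and> v' = v(x := ev xs e v A) \<and> A' = A" for u v' A'
    by (auto elim: hx.cases intro: hx.intros[unfolded One_nat_def])
  then show ?thesis by (simp add: wp_def)
qed

lemma wp_Sto [simp]: "wp xs (Sto j e f) Q v A t \<longleftrightarrow>
    Q v (A(j := (A j)(ev xs e v A := ev xs f v A))) (Suc t)"
proof -
  have "hx xs (Sto j e f) v A u v' A' \<longleftrightarrow>
      u = 1 \<and> v' = v \<and> A' = A(j := (A j)(ev xs e v A := ev xs f v A))" for u v' A'
    by (auto elim: hx.cases intro: hx.intros[unfolded One_nat_def])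
  then show ?thesis by (simp add: wp_def)
qed

lemma wp_Sq [simp]: "wp xs (c ;; d) Q = wp xs c (wp xs d Q)"
proof (intro ext iffI)
  fix v A t
  assume "wp xs (c ;; d) Q v A t"
  then obtain v' A' u where "hx xs (c ;; d) v A u v' A'" "Q v' A' (t + u)" by (auto simp: wp_def)
  then obtain v1 A1 u1 u2 where "hx xs c v A u1 v1 A1" "hx xs d v1 A1 u2 v' A'" "u = u1 + u2"
    by (auto elim: hx.cases)
  then show "wp xs c (wp xs d Q) v A t" using \<open>Q v' A' (t + u)\<close> unfolding wp_def by (metis add.assoc)
next
  fix v A t
  assume "wp xs c (wp xs d Q) v A t"
  then show "wp xs (c ;; d) Q v A t" unfolding wp_def by (metis hx_Sq add.assoc)
qed

lemma wp_Br [simp]: "wp xs (Br e c d) Q v A t \<longleftrightarrow>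
    (if ev xs e v A = 0 then wp xs d Q v A (Suc t) else wp xs c Q v A (Suc t))"
proof -
  have "hx xs (Br e c d) v A u v' A' \<longleftrightarrow>
      (\<exists>w. u = Suc w \<and> (if ev xs e v A = 0 then hx xs d v A w v' A' else hx xs c v A w v' A'))" for u v' A'
    by (cases "ev xs e v A = 0") (auto elim: hx.cases intro: hx_BrT hx_BrF)
  then show ?thesis unfolding wp_def
    by (cases "ev xs e v A = 0") (simp, metis add_Suc add_Suc_right)+
qed

text \<open>A contract \<open>R\<close> need not mention what the program leaves alone: the
  syntactic write sets supply the frame conditions.\<close>

lemma wp_call:
  assumes "wp xs c R v A t"
    and "\<And>v' A' t'. R v' A' t' \<Longrightarrow> same_off (mv c) v' v \<Longrightarrow> same_off (ma c) A' A \<Longrightarrow> Q v' A' t'"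
  shows "wp xs c Q v A t"
  using assms hx_same_off unfolding wp_def by meson

text \<open>Every iteration takes time, so a time bound in the invariant also gives termination.\<close>

lemma wp_Wh:
  assumes inv: "I v A t"
    and step: "\<And>v' A' t'. I v' A' t' \<Longrightarrow> same_off (mv c) v' v \<Longrightarrow> same_off (ma c) A' A \<Longrightarrow>
        ev xs e v' A' > 0 \<Longrightarrow> wp xs c I v' A' (Suc t')"
    and exit: "\<And>v' A' t'. I v' A' t' \<Longrightarrow> same_off (mv c) v' v \<Longrightarrow> same_off (ma c) A' A \<Longrightarrow>
        ev xs e v' A' = 0 \<Longrightarrow> Q v' A' (Suc t')"
    and bound: "\<And>v' A' t'. I v' A' t' \<Longrightarrow> t' \<le> T"
  shows "wp xs (Wh e c) Q v A t"
proof -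
  have "wp xs (Wh e c) Q v' A' t'"
    if "I v' A' t'" "same_off (mv c) v' v" "same_off (ma c) A' A" for v' A' t'
    using that
  proof (induction "T - t'" arbitrary: v' A' t' rule: less_induct)
    case less
    show ?case
    proof (cases "ev xs e v' A' = 0")
      case True
      then show ?thesis using exit[OF less.prems] hx_WhF[OF True] unfolding wp_def by fastforce
    next
      case False
      obtain v1 A1 u where 1: "hx xs c v' A' u v1 A1" "I v1 A1 (Suc t' + u)"
        using step[OF less.prems] False unfolding wp_def by auto
      have "same_off (mv c) v1 v" "same_off (ma c) A1 A"
        using hx_same_off[OF 1(1)] less.prems(2,3) by (auto simp: same_off_def)
      moreover have "T - (Suc t' + u) < T - t'" using bound[OF less.prems(1)] bound[OF 1(2)] by simp
      ultimately have "wp xs (Wh e c) Q v1 A1 (Suc t' + u)" using less.hyps 1(2) by blast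
      then obtain v2 A2 w where 2: "hx xs (Wh e c) v1 A1 w v2 A2" "Q v2 A2 (Suc t' + u + w)"
        by (auto simp: wp_def)
      have "hx xs (Wh e c) v' A' (Suc (u + w)) v2 A2" using hx_WhT False 1(1) 2(1) by blast
      then show ?thesis using 2(2) unfolding wp_def by (metis add_Suc add_Suc_right add.assoc)
    qed
  qed
  then show ?thesis using inv by (simp add: same_off_def)
qed

subsection \<open>Compilation\<close>

text \<open>
  Program variables live in registers below 60; register 61 stays zero, register 62 holds the input
  length, and registers from 64 on form an evaluation stack.
\<close>

fun cpe :: "ex \<Rightarrow> nat \<Rightarrow> com" where
  "cpe (Cn c) d = Set d c"
| "cpe (Vr x) d = Add d x 61"
| "cpe (Pl e f) d = Seq (cpe e d) (Seq (cpe f (Suc d)) (Add d d (Suc d)))"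
| "cpe (Mi e f) d = Seq (cpe e d) (Seq (cpe f (Suc d)) (Sub d d (Suc d)))"
| "cpe (Rd j e) d = Seq (cpe e d) (Seq (Add d d d) (Seq (Add d d d) (Seq (Add d d d)
     (Seq (Add d d d) (Seq (Add d d d) (Seq (Set (Suc d) j) (Seq (Add d d (Suc d))
     (Seq (Add d d 62) (Load d d)))))))))"
| "cpe (In e) d = Seq (cpe e d) (Load d d)"

fun cost :: "ex \<Rightarrow> nat" where
  "cost (Cn c) = 1"
| "cost (Vr x) = 1"
| "cost (Pl e f) = cost e + cost f + 1"
| "cost (Mi e f) = cost e + cost f + 1"
| "cost (Rd j e) = cost e + 9"
| "cost (In e) = cost e + 1"

fun wfe :: "ex \<Rightarrow> bool" where
  "wfe (Cn c) = True"
| "wfe (Vr x) = (x < 60)"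
| "wfe (Pl e f) = (wfe e \<and> wfe f)"
| "wfe (Mi e f) = (wfe e \<and> wfe f)"
| "wfe (Rd j e) = (j < 32 \<and> wfe e)"
| "wfe (In e) = wfe e"

fun cp :: "hc \<Rightarrow> com" where
  "cp (Asg x e) = Seq (cpe e 64) (Add x 64 61)"
| "cp (Sto j e f) = Seq (cpe f 64) (Seq (cpe e 65) (Seq (Add 65 65 65) (Seq (Add 65 65 65)
     (Seq (Add 65 65 65) (Seq (Add 65 65 65) (Seq (Add 65 65 65) (Seq (Set 66 j) (Seq (Add 65 65 66)
     (Seq (Add 65 65 62) (Store 65 64))))))))))"
| "cp (Sq c d) = Seq (cp c) (cp d)"
| "cp (Br e c d) = Seq (cpe e 64) (Cond 64 (cp c) (cp d))"
| "cp (Wh e c) = Seq (cpe e 64) (Loop 64 (Seq (cp c) (cpe e 64)))"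

text \<open>Any constant bound on the cost of expressions would do. With 190, plus the few further
  instructions of a statement, every source step stays within 400 machine steps.\<close>

fun wfc :: "hc \<Rightarrow> bool" where
  "wfc (Asg x e) = (x < 60 \<and> wfe e \<and> cost e \<le> 190)"
| "wfc (Sto j e f) = (j < 32 \<and> wfe e \<and> wfe f \<and> cost e + cost f \<le> 190)"
| "wfc (Sq c d) = (wfc c \<and> wfc d)"
| "wfc (Br e c d) = (wfe e \<and> cost e \<le> 190 \<and> wfc c \<and> wfc d)"
| "wfc (Wh e c) = (wfe e \<and> cost e \<le> 190 \<and> wfc c)"

definition repr :: "nat list \<Rightarrow> env \<Rightarrow> env \<Rightarrow> bool" where
  "repr xs v r \<longleftrightarrow> (\<forall>x<60. r x = v x) \<and> r 61 = 0 \<and> r 62 = length xs"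

lemma exec_Seq_Add: "exec c (r(i := r j + r l), h) t s \<Longrightarrow> exec (Seq (Add i j l) c) (r, h) (Suc t) s"
  using exec.Seq[OF exec.Add] by fastforce

lemma exec_Seq_Set: "exec c (r(i := x), h) t s \<Longrightarrow> exec (Seq (Set i x) c) (r, h) (Suc t) s"
  using exec.Seq[OF exec.Set] by fastforce

lemma exec_Seq_Load: "exec c (r(i := h (r j)), h) t s \<Longrightarrow> exec (Seq (Load i j) c) (r, h) (Suc t) s"
  using exec.Seq[OF exec.Load] by fastforce

text \<open>Address computation: five doublings multiply the index by 32; then the lane number and
  the input length are added.\<close>

lemma exec_lane:
  assumes "exec c (r(d := 32 * r d + j + r 62, Suc d := j), h) t s" "64 \<le> d"
  shows "exec (Seq (Add d d d) (Seq (Add d d d) (Seq (Add d d d) (Seq (Add d d d) (Seq (Add d d d)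
     (Seq (Set (Suc d) j) (Seq (Add d d (Suc d)) (Seq (Add d d 62) c)))))))) (r, h) (8 + t) s"
proof -
  have "exec (Seq (Add d d d) (Seq (Add d d d) (Seq (Add d d d) (Seq (Add d d d) (Seq (Add d d d)
     (Seq (Set (Suc d) j) (Seq (Add d d (Suc d)) (Seq (Add d d 62) c)))))))) (r, h)
     (Suc (Suc (Suc (Suc (Suc (Suc (Suc (Suc t)))))))) s"
    by (rule exec_Seq_Add exec_Seq_Set)+
      (rule back_subst[where P = "\<lambda>r. exec c (r, h) t s", OF assms(1)],
        use assms(2) in \<open>auto simp: fun_eq_iff\<close>)
  then show ?thesis by (simp add: numeral_eq_Suc)
qed

lemma mem_lane: "j < 32 \<Longrightarrow> mem xs A (32 * i + j + length xs) = A j i"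
  by (simp add: mem_def)

lemma mem_upd:
  assumes "j < 32"
  shows "(mem xs A)(32 * i + j + length xs := c) = mem xs (A(j := (A j)(i := c)))"
proof
  fix x
  show "((mem xs A)(32 * i + j + length xs := c)) x = mem xs (A(j := (A j)(i := c))) x"
  proof (cases "x < length xs")
    case False
    define y where "y = x - length xs"
    have x: "x = y + length xs" using False by (simp add: y_def)
    have "y = 32 * i + j \<longleftrightarrow> y mod 32 = j \<and> y div 32 = i"
      using assms by (metis add.commute div_mod_decomp div_mult_self4 mod_less mod_mult_self4
          mult.commute div_less add_0 numeral_neq_zero)
    then show ?thesis unfolding x by (auto simp: mem_def)
  qed (auto simp: mem_def)
qed

lemma cpe_correct:
  assumes "wfe e" "64 \<le> d" "repr xs v r"
  shows "\<exists>r'. exec (cpe e d) (r, mem xs A) (cost e) (r', mem xs A) \<and> repr xs v r' \<and>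
           r' d = ev xs e v A \<and> (\<forall>x<d. r' x = r x)"
  using assms
proof (induction e arbitrary: d r)
  case (Cn c)
  have "repr xs v (r(d := c))" using Cn.prems by (auto simp: repr_def)
  moreover have "exec (cpe (Cn c) d) (r, mem xs A) (cost (Cn c)) (r(d := c), mem xs A)"
    using exec.Set by simp
  moreover have "(r(d := c)) d = ev xs (Cn c) v A" "\<forall>x<d. (r(d := c)) x = r x" by simp_all
  ultimately show ?case by blast
next
  case (Vr x)
  have "exec (cpe (Vr x) d) (r, mem xs A) (cost (Vr x)) (r(d := r x + r 61), mem xs A)"
    using exec.Add by simp
  moreover have "repr xs v (r(d := r x + r 61))" "(r(d := r x + r 61)) d = ev xs (Vr x) v A"
    "\<forall>y<d. (r(d := r x + r 61)) y = r y" using Vr.prems by (auto simp: repr_def)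
  ultimately show ?case by blast
next
  case (Pl e f)
  obtain r1 where 1: "exec (cpe e d) (r, mem xs A) (cost e) (r1, mem xs A)" "repr xs v r1"
    "r1 d = ev xs e v A" "\<forall>x<d. r1 x = r x" using Pl.IH(1)[of d r] Pl.prems by auto
  obtain r2 where 2: "exec (cpe f (Suc d)) (r1, mem xs A) (cost f) (r2, mem xs A)" "repr xs v r2"
    "r2 (Suc d) = ev xs f v A" "\<forall>x<Suc d. r2 x = r1 x"
    using Pl.IH(2)[of "Suc d" r1] Pl.prems 1 by auto
  let ?r = "r2(d := r2 d + r2 (Suc d))"
  have "exec (cpe (Pl e f) d) (r, mem xs A) (cost (Pl e f)) (?r, mem xs A)"
    using exec.Seq[OF 1(1) exec.Seq[OF 2(1) exec.Add]] by (simp add: add.assoc)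
  moreover have "repr xs v ?r" using 2(2) Pl.prems(2) by (auto simp: repr_def)
  moreover have "?r d = ev xs (Pl e f) v A" using 1(3) 2(3,4) by simp
  moreover have "\<forall>x<d. ?r x = r x" using 1(4) 2(4) by simp
  ultimately show ?case by blast
next
  case (Mi e f)
  obtain r1 where 1: "exec (cpe e d) (r, mem xs A) (cost e) (r1, mem xs A)" "repr xs v r1"
    "r1 d = ev xs e v A" "\<forall>x<d. r1 x = r x" using Mi.IH(1)[of d r] Mi.prems by auto
  obtain r2 where 2: "exec (cpe f (Suc d)) (r1, mem xs A) (cost f) (r2, mem xs A)" "repr xs v r2"
    "r2 (Suc d) = ev xs f v A" "\<forall>x<Suc d. r2 x = r1 x"
    using Mi.IH(2)[of "Suc d" r1] Mi.prems 1 by auto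
  let ?r = "r2(d := r2 d - r2 (Suc d))"
  have "exec (cpe (Mi e f) d) (r, mem xs A) (cost (Mi e f)) (?r, mem xs A)"
    using exec.Seq[OF 1(1) exec.Seq[OF 2(1) exec.Sub]] by (simp add: add.assoc)
  moreover have "repr xs v ?r" using 2(2) Mi.prems(2) by (auto simp: repr_def)
  moreover have "?r d = ev xs (Mi e f) v A" using 1(3) 2(3,4) by simp
  moreover have "\<forall>x<d. ?r x = r x" using 1(4) 2(4) by simp
  ultimately show ?case by blast
next
  case (Rd j e)
  obtain r1 where 1: "exec (cpe e d) (r, mem xs A) (cost e) (r1, mem xs A)" "repr xs v r1"
    "r1 d = ev xs e v A" "\<forall>x<d. r1 x = r x" using Rd.IH[of d r] Rd.prems by auto
  let ?r = "r1(d := 32 * r1 d + j + r1 62, Suc d := j)"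
  let ?r' = "?r(d := mem xs A (?r d))"
  have "exec (cpe (Rd j e) d) (r, mem xs A) (cost e + (8 + 1)) (?r', mem xs A)"
    unfolding cpe.simps by (rule exec.Seq[OF 1(1) exec_lane[OF exec.Load Rd.prems(2)]])
  moreover have "repr xs v ?r'" using 1(2) Rd.prems(2) by (auto simp: repr_def)
  moreover have "?r' d = ev xs (Rd j e) v A"
    using 1(2,3) Rd.prems(1) by (auto simp: repr_def mem_lane)
  moreover have "\<forall>x<d. ?r' x = r x" using 1(4) by auto
  moreover have "cost (Rd j e) = cost e + (8 + 1)" by simp
  ultimately show ?case unfolding \<open>cost (Rd j e) = cost e + (8 + 1)\<close> by blast
next
  case (In e)
  obtain r1 where 1: "exec (cpe e d) (r, mem xs A) (cost e) (r1, mem xs A)" "repr xs v r1"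
    "r1 d = ev xs e v A" "\<forall>x<d. r1 x = r x" using In.IH[of d r] In.prems by auto
  let ?r = "r1(d := mem xs A (r1 d))"
  have "exec (cpe (In e) d) (r, mem xs A) (cost (In e)) (?r, mem xs A)"
    using exec.Seq[OF 1(1) exec.Load] by simp
  moreover have "repr xs v ?r" "?r d = ev xs (In e) v A" "\<forall>x<d. ?r x = r x"
    using 1 In.prems by (auto simp: repr_def)
  ultimately show ?case by blast
qed

lemma cp_correct:
  assumes "hx xs c v A t v' A'" "wfc c" "repr xs v r"
  shows "\<exists>r' u. exec (cp c) (r, mem xs A) u (r', mem xs A') \<and> repr xs v' r' \<and> u \<le> 400 * t"
  using assms
proof (induction arbitrary: r rule: hx.induct)
  case (hx_Asg x e v A)
  obtain r1 where 1: "exec (cpe e 64) (r, mem xs A) (cost e) (r1, mem xs A)" "repr xs v r1"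
    "r1 64 = ev xs e v A" using cpe_correct[of e 64 xs v r A] hx_Asg by auto
  have "exec (cp (Asg x e)) (r, mem xs A) (cost e + 1) (r1(x := r1 64 + r1 61), mem xs A)"
    using exec.Seq[OF 1(1) exec.Add] by simp
  moreover have "repr xs (v(x := ev xs e v A)) (r1(x := r1 64 + r1 61))"
    using 1 hx_Asg by (auto simp: repr_def)
  moreover have "cost e + 1 \<le> 400 * 1" using hx_Asg by simp
  ultimately show ?case by blast
next
  case (hx_Sto j e f v A)
  obtain r1 where 1: "exec (cpe f 64) (r, mem xs A) (cost f) (r1, mem xs A)" "repr xs v r1"
    "r1 64 = ev xs f v A" using cpe_correct[of f 64 xs v r A] hx_Sto by auto
  obtain r2 where 2: "exec (cpe e 65) (r1, mem xs A) (cost e) (r2, mem xs A)" "repr xs v r2"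
    "r2 65 = ev xs e v A" "\<forall>x<65. r2 x = r1 x" using cpe_correct[of e 65 xs v r1 A] hx_Sto 1 by auto
  let ?a = "32 * ev xs e v A + j + length xs"
  let ?r = "r2(65 := 32 * r2 65 + j + r2 62, Suc 65 := j)"
  have j: "j < 32" "cost e + cost f \<le> 190" using hx_Sto by auto
  have "exec (cp (Sto j e f)) (r, mem xs A) (cost f + (cost e + (8 + 1)))
     (?r, (mem xs A)(?r 65 := ?r 64))"
    using exec.Seq[OF 1(1) exec.Seq[OF 2(1) exec_lane[OF exec.Store[where i = 65 and j = 64], where d = 65 and r = r2 and j = j]]] by simp
  moreover have a: "?r 65 = ?a" "?r 64 = ev xs f v A" using 2 1(3) by (auto simp: repr_def)
  ultimately have "exec (cp (Sto j e f)) (r, mem xs A) (cost f + (cost e + (8 + 1)))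
     (?r, (mem xs A)(?a := ev xs f v A))" unfolding a by blast
  moreover have "repr xs v ?r" using 2(2) by (auto simp: repr_def)
  moreover have "cost f + (cost e + (8 + 1)) \<le> 400 * 1" using j(2) by simp
  ultimately show ?case unfolding mem_upd[OF j(1)] by blast
next
  case (hx_Sq c v A t v' A' d u v'' A'')
  obtain r1 u1 where 1: "exec (cp c) (r, mem xs A) u1 (r1, mem xs A')" "repr xs v' r1" "u1 \<le> 400 * t"
    using hx_Sq.IH(1)[of r] hx_Sq.prems by auto
  obtain r2 u2 where 2: "exec (cp d) (r1, mem xs A') u2 (r2, mem xs A'')" "repr xs v'' r2" "u2 \<le> 400 * u"
    using hx_Sq.IH(2)[of r1] hx_Sq.prems 1 by auto
  have "exec (cp (Sq c d)) (r, mem xs A) (u1 + u2) (r2, mem xs A'')"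
    using exec.Seq[OF 1(1) 2(1)] by simp
  moreover have "u1 + u2 \<le> 400 * (t + u)" using 1(3) 2(3) by simp
  ultimately show ?case using 2(2) by blast
next
  case (hx_BrT e v A c t v' A' d)
  obtain r1 where 1: "exec (cpe e 64) (r, mem xs A) (cost e) (r1, mem xs A)" "repr xs v r1"
    "r1 64 = ev xs e v A" using cpe_correct[of e 64 xs v r A] hx_BrT by auto
  obtain r2 u2 where 2: "exec (cp c) (r1, mem xs A) u2 (r2, mem xs A')" "repr xs v' r2" "u2 \<le> 400 * t"
    using hx_BrT.IH[of r1] hx_BrT.prems 1 by auto
  have "exec (cp (Br e c d)) (r, mem xs A) (cost e + Suc u2) (r2, mem xs A')"
    unfolding cp.simps using exec.Seq[OF 1(1) CondTrue[OF _ 2(1)]] 1(3) hx_BrT.hyps by simp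
  moreover have "cost e + Suc u2 \<le> 400 * Suc t" using 2(3) hx_BrT.prems by simp
  ultimately show ?case using 2(2) by blast
next
  case (hx_BrF e v A d t v' A' c)
  obtain r1 where 1: "exec (cpe e 64) (r, mem xs A) (cost e) (r1, mem xs A)" "repr xs v r1"
    "r1 64 = ev xs e v A" using cpe_correct[of e 64 xs v r A] hx_BrF by auto
  obtain r2 u2 where 2: "exec (cp d) (r1, mem xs A) u2 (r2, mem xs A')" "repr xs v' r2" "u2 \<le> 400 * t"
    using hx_BrF.IH[of r1] hx_BrF.prems 1 by auto
  have "exec (cp (Br e c d)) (r, mem xs A) (cost e + Suc u2) (r2, mem xs A')"
    unfolding cp.simps using exec.Seq[OF 1(1) CondFalse[OF _ 2(1)]] 1(3) hx_BrF.hyps by simp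
  moreover have "cost e + Suc u2 \<le> 400 * Suc t" using 2(3) hx_BrF.prems by simp
  ultimately show ?case using 2(2) by blast
next
  case (hx_WhT e v A c t v' A' u v'' A'')
  obtain r1 where 1: "exec (cpe e 64) (r, mem xs A) (cost e) (r1, mem xs A)" "repr xs v r1"
    "r1 64 = ev xs e v A" using cpe_correct[of e 64 xs v r A] hx_WhT by auto
  obtain r2 u2 where 2: "exec (cp c) (r1, mem xs A) u2 (r2, mem xs A')" "repr xs v' r2" "u2 \<le> 400 * t"
    using hx_WhT.IH(1)[of r1] hx_WhT.prems 1 by auto
  obtain r3 u3 where 3: "exec (cp (Wh e c)) (r2, mem xs A') u3 (r3, mem xs A'')" "repr xs v'' r3"
    "u3 \<le> 400 * u" using hx_WhT.IH(2)[of r2] hx_WhT.prems 2 by auto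
  \<comment> \<open>The machine loop tests a register, so the test expression is evaluated once in
    front and again at the end of each body. The run of the remaining loop is split accordingly, and
    its leading evaluation becomes the end of the current body.\<close>
  obtain s t4 t5 where 4: "exec (cpe e 64) (r2, mem xs A') t4 s"
    "exec (Loop 64 (Seq (cp c) (cpe e 64))) s t5 (r3, mem xs A'')" "u3 = t4 + t5"
    using 3(1) by (auto elim: exec.cases)
  have "exec (Loop 64 (Seq (cp c) (cpe e 64))) (r1, mem xs A) (Suc ((u2 + t4) + t5)) (r3, mem xs A'')"
    by (rule LoopTrue[OF _ exec.Seq[OF 2(1) 4(1)] 4(2)]) (use 1 hx_WhT.hyps in simp)
  then have "exec (cp (Wh e c)) (r, mem xs A) (cost e + Suc ((u2 + t4) + t5)) (r3, mem xs A'')"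
    unfolding cp.simps by (rule exec.Seq[OF 1(1)])
  moreover have "cost e + Suc ((u2 + t4) + t5) \<le> 400 * Suc (t + u)"
    using 2(3) 3(3) 4(3) hx_WhT.prems by simp
  ultimately show ?case using 3(2) by blast
next
  case (hx_WhF e v A c)
  obtain r1 where 1: "exec (cpe e 64) (r, mem xs A) (cost e) (r1, mem xs A)" "repr xs v r1"
    "r1 64 = ev xs e v A" using cpe_correct[of e 64 xs v r A] hx_WhF by auto
  have "exec (cp (Wh e c)) (r, mem xs A) (cost e + 1) (r1, mem xs A)"
    unfolding cp.simps using exec.Seq[OF 1(1) LoopFalse] 1(3) hx_WhF.hyps by simp
  moreover have "cost e + 1 \<le> 400 * 1" using hx_WhF.prems by simp
  ultimately show ?case using 1(2) by blast
qed

text \<open>Reads the input length \<open>3 + 2 m + 3 p\<close> off an encoded instance.\<close>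

definition prologue :: com where
  "prologue = Seq (Set 64 1) (Seq (Load 65 64) (Seq (Add 65 65 65) (Seq (Set 64 2)
     (Seq (Add 64 64 65) (Seq (Load 66 64) (Seq (Add 62 64 66) (Seq (Add 62 62 66)
     (Seq (Add 62 62 66) (Seq (Set 64 1) (Add 62 62 64))))))))))"

text \<open>Memory beyond the input is initially zero, so the source program starts with all
  variables and all lanes zero. The 11 counts the instructions of \<open>prologue\<close>.\<close>

lemma decides_within_compile:
  assumes len: "length xs = 3 + 2 * m + 3 * p" and m: "xs ! 1 = m" and p: "xs ! (2 + 2 * m) = p"
    and wf: "wfc c"
    and run: "wp xs c (\<lambda>v A t. v 0 = (if answer then 1 else 0) \<and> t \<le> T) (\<lambda>_. 0) (\<lambda>_ _. 0) 0"
    and T: "real (11 + 400 * T) \<le> B"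
  shows "decides_within (Seq prologue (cp c)) xs answer B"
proof -
  have init: "initial_state xs = ((\<lambda>_. 0), mem xs (\<lambda>_ _. 0))"
    by (auto simp: initial_state_def mem_def)
  have "2 + (m + m) < length xs" "Suc 0 < length xs" using len by auto
  then have l: "mem xs A (Suc 0) = m" "mem xs A (Suc (Suc (m + m))) = p" for A
    using m p by (auto simp: mem_def mult_2)
  let ?r = "(\<lambda>_. 0)(62 := length xs, 64 := 1, 65 := m + m, 66 := p) :: env"
  have "exec prologue ((\<lambda>_. 0), mem xs (\<lambda>_ _. 0)) (Suc (Suc (Suc (Suc (Suc (Suc (Suc (Suc (Suc (Suc 1))))))))))
      (?r, mem xs (\<lambda>_ _. 0))"
    unfolding prologue_def
    by (rule exec_Seq_Add exec_Seq_Set exec_Seq_Load)+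
      (rule back_subst[where P = "\<lambda>s. exec _ _ _ (s, _)", OF exec.Add],
        auto simp: l len fun_eq_iff)
  then have "exec prologue ((\<lambda>_. 0), mem xs (\<lambda>_ _. 0)) 11 (?r, mem xs (\<lambda>_ _. 0))"
    by (simp add: numeral_eq_Suc)
  moreover have "repr xs (\<lambda>_. 0) ?r" by (simp add: repr_def)
  moreover obtain v A t where 1: "hx xs c (\<lambda>_. 0) (\<lambda>_ _. 0) t v A"
    "v 0 = (if answer then 1 else 0)" "t \<le> T" using run by (auto simp: wp_def)
  ultimately obtain r u where 2: "exec (Seq prologue (cp c)) (initial_state xs) (11 + u) (r, mem xs A)"
    "repr xs v r" "u \<le> 400 * t"
    using cp_correct[OF 1(1) wf] exec.Seq unfolding init by metis
  have "r 0 = v 0" using 2(2) by (simp add: repr_def)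
  moreover have "real (11 + u) \<le> B"
    using 2(3) 1(3) T by linarith
  ultimately show ?thesis unfolding decides_within_def using 2(1) 1(2) by metis
qed

section \<open>Linear programming duality for perfect matchings\<close>

fun walk_weight :: "('v \<Rightarrow> 'v \<Rightarrow> int) \<Rightarrow> 'v list \<Rightarrow> int" where
  "walk_weight c (x # y # xs) = c x y + walk_weight c (y # xs)"
| "walk_weight c _ = 0"

lemma walk_weight_append:
  "walk_weight c (xs @ y # ys) = walk_weight c (xs @ [y]) + walk_weight c (y # ys)"
  by (induction c xs rule: walk_weight.induct) auto

lemma walk_weight_closed:
  "(\<Sum>(a, b) \<leftarrow> zip (x # xs) (xs @ [z]). c a b) = walk_weight c (x # xs) + c (last (x # xs)) z"
  by (induction xs arbitrary: x) auto

lemma successively_closed: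
  "successively R (x # xs) \<Longrightarrow> R (last (x # xs)) z \<Longrightarrow>
   (a, b) \<in> set (zip (x # xs) (xs @ [z])) \<Longrightarrow> R a b"
  by (induction xs arbitrary: x) auto

lemma sum_cycle_of_list:
  assumes "distinct (x # xs)"
  shows "(\<Sum>a\<in>set (x # xs). c a (cycle_of_list (x # xs) a)) =
         walk_weight c (x # xs) + c (last (x # xs)) x"
proof -
  let ?p = "x # xs"
  have map: "map (cycle_of_list ?p) ?p = xs @ [x]"
    using cyclic_rotation[OF assms, of 1] by simp
  have "(\<Sum>a\<in>set ?p. c a (cycle_of_list ?p a)) = (\<Sum>a\<leftarrow>?p. c a (cycle_of_list ?p a))"
    using assms by (simp only: sum_list_distinct_conv_sum_set)
  also have "\<dots> = (\<Sum>(a, b) \<leftarrow> zip ?p (map (cycle_of_list ?p) ?p). c a b)"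
    by (rule arg_cong[where f = sum_list], rule nth_equalityI) (auto simp del: cycle_of_list.simps list.map)
  finally show ?thesis unfolding map walk_weight_closed .
qed

lemma cycle_of_list_step:
  assumes "distinct (x # xs)" "successively R (x # xs)" "R (last (x # xs)) x" "a \<in> set (x # xs)"
  shows "R a (cycle_of_list (x # xs) a)"
proof -
  let ?p = "x # xs"
  have map: "map (cycle_of_list ?p) ?p = xs @ [x]"
    using cyclic_rotation[OF assms(1), of 1] by simp
  have "(a, cycle_of_list ?p a) \<in> set (zip ?p (map (cycle_of_list ?p) ?p))"
    using assms(4) unfolding set_zip in_set_conv_nth[of a] by (metis (mono_tags, lifting) length_map
        mem_Collect_eq min.idem nth_map)
  then show ?thesis using successively_closed[OF assms(2,3)] unfolding map by blast
qed

text \<open>The potential of \<open>v\<close> is the largest weight of a walk without repeated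
  vertices that ends in \<open>v\<close>. The absence of positive cycles is expressed by
  permutations, since these will come from exchanging partners.\<close>

lemma potential_exists:
  fixes c :: "'v \<Rightarrow> 'v \<Rightarrow> int"
  assumes fin: "finite V" and refl: "\<And>a. a \<in> V \<Longrightarrow> R a a" "\<And>a. c a a = 0"
    and cyc: "\<And>\<pi>. \<pi> permutes V \<Longrightarrow> (\<And>a. a \<in> V \<Longrightarrow> R a (\<pi> a)) \<Longrightarrow> (\<Sum>a\<in>V. c a (\<pi> a)) \<le> 0"
  shows "\<exists>y. \<forall>a\<in>V. \<forall>b\<in>V. R a b \<longrightarrow> y a + c a b \<le> y b"
proof -
  define W where "W v = {p. distinct p \<and> set p \<subseteq> V \<and> successively R p \<and> p \<noteq> [] \<and> last p = v}" for v
  define y where "y v = Max (walk_weight c ` W v)" for v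
  have "finite {p. distinct p \<and> set p \<subseteq> V}"
    using finite_subset[OF _ finite_lists_length_le[OF fin, of "card V"]]
    by (smt (verit) Collect_mono card_mono distinct_card fin)
  then have finW: "finite (W v)" for v by (rule finite_subset[rotated]) (auto simp: W_def)
  have up: "walk_weight c p \<le> y v" if "p \<in> W v" for p v
    unfolding y_def using that finW by (intro Max_ge) auto
  have closed: "walk_weight c p + c (last p) (hd p) \<le> 0"
    if "distinct p" "set p \<subseteq> V" "successively R p" "p \<noteq> []" "R (last p) (hd p)" for p
  proof -
    obtain x xs where p: "p = x # xs" using \<open>p \<noteq> []\<close> by (cases p) auto
    let ?\<pi> = "cycle_of_list p"
    \<comment> \<open>Off the cycle the permutation is the identity, which is admissible and has
      weight 0.\<close>
    have id: "?\<pi> a = a" if "a \<notin> set p" for a using id_outside_supp[OF that] .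
    have "?\<pi> permutes V" using cycle_permutes[of p] that(2) by (rule permutes_subset)
    moreover have "R a (?\<pi> a)" if "a \<in> V" for a
    proof (cases "a \<in> set p")
      case True
      then show ?thesis using cycle_of_list_step[of x xs R a] that \<open>distinct p\<close> \<open>successively R p\<close>
          \<open>R (last p) (hd p)\<close> unfolding p by simp
    qed (use id refl that in simp)
    ultimately have "(\<Sum>a\<in>V. c a (?\<pi> a)) \<le> 0" by (rule cyc)
    moreover have "(\<Sum>a\<in>V. c a (?\<pi> a)) = (\<Sum>a\<in>set p. c a (?\<pi> a))"
      using fin that(2) id refl(2) by (intro sum.mono_neutral_right) auto
    ultimately show ?thesis using sum_cycle_of_list[of x xs c] that(1) unfolding p by simp
  qed
  have "y a + c a b \<le> y b" if ab: "a \<in> V" "b \<in> V" "R a b" for a b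
  proof -
    have "[a] \<in> W a" using ab by (simp add: W_def)
    then have "y a \<in> walk_weight c ` W a" unfolding y_def using finW by (intro Max_in) auto
    then obtain p where p: "p \<in> W a" "y a = walk_weight c p" by blast
    show ?thesis
    proof (cases "b \<in> set p")
      case False
      have "butlast p @ [last p] = p" "last p = a" using p(1) by (auto simp: W_def)
      then obtain ps where ps: "p = ps @ [a]" by metis
      have "p @ [b] \<in> W b" using p(1) ab False by (auto simp: W_def successively_append_iff)
      moreover have "walk_weight c (p @ [b]) = walk_weight c p + c a b"
        using walk_weight_append[of c ps a "[b]"] unfolding ps by simp
      ultimately show ?thesis using up p(2) by fastforce
    next
      case True
      \<comment> \<open>The best walk to \<open>a\<close> already meets \<open>b\<close>. Its tail
        from \<open>b\<close> to \<open>a\<close> and the step from \<open>a\<close> to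
        \<open>b\<close> form a cycle of weight at most 0, so cutting the tail off loses
        nothing.\<close>
      then obtain ps qs where pq: "p = ps @ b # qs" by (meson split_list)
      have "ps @ [b] \<in> W b" using p(1) unfolding pq by (auto simp: W_def successively_append_iff)
      then have "walk_weight c (ps @ [b]) \<le> y b" by (rule up)
      moreover have "walk_weight c (b # qs) + c (last (b # qs)) (hd (b # qs)) \<le> 0"
        using p(1) ab unfolding pq by (intro closed) (auto simp: W_def successively_append_iff)
      moreover have "last (b # qs) = a" using p(1) unfolding pq by (auto simp: W_def)
      moreover have "y a = walk_weight c (ps @ [b]) + walk_weight c (b # qs)"
        unfolding p(2) pq by (rule walk_weight_append)
      ultimately show ?thesis by simp
    qed
  qed
  then show ?thesis by blast
qed

text \<open>Exchange graph on the agents: an arrow from \<open>a\<close> to \<open>b\<close> means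
  that \<open>a\<close> can take over the object of \<open>b\<close>, weighted by the gain. A
  permutation along arrows is another perfect matching, so optimality of \<open>h\<close> excludes
  positive cycles, and a potential yields integral dual values that are tight on
  \<open>h\<close>.\<close>

lemma matching_duality:
  fixes w :: "nat \<Rightarrow> nat \<Rightarrow> int"
  assumes h: "bij_betw h {..<n} {..<n}" "\<And>a. a < n \<Longrightarrow> (a, h a) \<in> E"
    and max: "\<And>h'. bij_betw h' {..<n} {..<n} \<Longrightarrow> (\<And>a. a < n \<Longrightarrow> (a, h' a) \<in> E) \<Longrightarrow>
        (\<Sum>a<n. w a (h' a)) \<le> (\<Sum>a<n. w a (h a))"
  obtains y z where "\<And>a b. a < n \<Longrightarrow> b < n \<Longrightarrow> (a, b) \<in> E \<Longrightarrow> w a b \<le> y a + z b"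
    "\<And>a. a < n \<Longrightarrow> y a + z (h a) = w a (h a)"
proof -
  let ?c = "\<lambda>a b. w a (h b) - w a (h a)"
  have "\<exists>y. \<forall>a\<in>{..<n}. \<forall>b\<in>{..<n}. (a, h b) \<in> E \<longrightarrow> y a + ?c a b \<le> y b"
  proof (rule potential_exists)
    fix \<pi> assume \<pi>: "\<pi> permutes {..<n}" "\<And>a. a \<in> {..<n} \<Longrightarrow> (a, h (\<pi> a)) \<in> E"
    have "bij_betw (h \<circ> \<pi>) {..<n} {..<n}"
      using permutes_imp_bij[OF \<pi>(1)] h(1) by (rule bij_betw_trans)
    then show "(\<Sum>a\<in>{..<n}. ?c a (\<pi> a)) \<le> 0"
      using max[of "h \<circ> \<pi>"] \<pi>(2) by (simp add: sum_subtractf)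
  qed (use h in auto)
  then obtain y where y: "\<And>a b. a < n \<Longrightarrow> b < n \<Longrightarrow> (a, h b) \<in> E \<Longrightarrow> y a + ?c a b \<le> y b" by auto
  let ?i = "inv_into {..<n} h"
  have i: "?i b < n" "h (?i b) = b" if "b < n" for b
    using that h(1) by (metis bij_betw_imp_surj_on inv_into_into lessThan_iff f_inv_into_f)+
  have i': "?i (h a) = a" if "a < n" for a
    using that h(1) by (meson bij_betw_inv_into_left lessThan_iff)
  show thesis
  proof (rule that[of "\<lambda>a. w a (h a) - y a" "\<lambda>b. y (?i b)"])
    fix a b assume "a < n" "b < n" "(a, b) \<in> E"
    then show "w a b \<le> w a (h a) - y a + y (?i b)" using y[of a "?i b"] i[of b] by simp
  qed (simp add: i')
qed

section \<open>Levels\<close>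

text \<open>
  Edge \<open>e\<close> joins agent \<open>ag e\<close> and object \<open>ob e\<close>; \<open>vt a b c\<close> is 1 if agent \<open>a\<close> prefers \<open>b\<close> to \<open>c\<close>, and
  0 otherwise.
\<close>

locale market =
  fixes n m :: nat and ag ob :: "nat \<Rightarrow> nat" and vt :: "nat \<Rightarrow> nat \<Rightarrow> nat \<Rightarrow> nat"
  assumes ag: "e < m \<Longrightarrow> ag e < n" and ob: "e < m \<Longrightarrow> ob e < n"
    and edge_inj: "e < m \<Longrightarrow> e' < m \<Longrightarrow> ag e = ag e' \<Longrightarrow> ob e = ob e' \<Longrightarrow> e = e'"
    and vt: "vt a b c \<le> 1"

text \<open>
  A dual solution assigns level \<open>q b\<close> to object \<open>b\<close> (minus its dual value). A guess prescribes the slack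
  \<open>lam e\<close> of each matching edge \<open>e\<close> in the dual constraints; edges that contradict the guess have
  \<open>cf e > 0\<close>. An edge is valid if it could be in a matching certified by the levels.
\<close>

locale guess = market +
  fixes lam cf :: "nat \<Rightarrow> nat"
  assumes guess: "e < m \<Longrightarrow> e' < m \<Longrightarrow> ag e = ag e' \<Longrightarrow> e \<noteq> e' \<Longrightarrow> cf e = 0 \<Longrightarrow> lam e' = 0"
begin

text \<open>The negated dual constraint of edge \<open>x\<close> when \<open>y\<close> is the
  matching edge of their common agent: the agent's dual value is \<open>q (ob y) + lam y\<close>,
  and the weight of \<open>x\<close> is the agent's vote between the two objects.\<close>

definition blk :: "(nat \<Rightarrow> nat) \<Rightarrow> nat \<Rightarrow> nat \<Rightarrow> bool" where
  "blk q x y \<longleftrightarrow> q (ob y) + lam y + vt (ag y) (ob y) (ob x) < q (ob x) + vt (ag y) (ob x) (ob y)"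

definition valid :: "(nat \<Rightarrow> nat) \<Rightarrow> nat \<Rightarrow> bool" where
  "valid q e \<longleftrightarrow> e < m \<and> cf e = 0 \<and> (\<forall>x<m. ag x = ag e \<longrightarrow> \<not> blk q x e)"

definition perfect :: "(nat \<Rightarrow> nat) \<Rightarrow> (nat \<Rightarrow> nat) \<Rightarrow> bool" where
  "perfect q g \<longleftrightarrow> (\<forall>b<n. valid q (g b) \<and> ob (g b) = b) \<and> inj_on (ag \<circ> g) {..<n}"

text \<open>Going down from \<open>q'\<close> to \<open>q\<close> while keeping the level of
  \<open>b\<close> can only remove blockers of \<open>g b\<close>. For the second claim,
  \<open>g b\<close> does not block \<open>e\<close> at \<open>q\<close>, and \<open>e\<close> does
  not block \<open>g b\<close> at \<open>q'\<close>. Adding these two inequalities cancels the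
  votes.\<close>

lemma tight_closed:
  assumes le: "\<And>b. b < n \<Longrightarrow> q b \<le> q' b" and g: "perfect q' g" and b: "b < n" "q b = q' b"
  shows "valid q (g b)" and "valid q e \<Longrightarrow> ag e = ag (g b) \<Longrightarrow> q (ob e) = q' (ob e)"
proof -
  have gb: "valid q' (g b)" "ob (g b) = b" using g b by (auto simp: perfect_def)
  have "\<not> blk q x (g b)" if "x < m" "ag x = ag (g b)" for x
    using that gb le[of "ob x"] ob b(2) by (fastforce simp: valid_def blk_def)
  then show v: "valid q (g b)" using gb by (auto simp: valid_def)
  assume e: "valid q e" "ag e = ag (g b)"
  show "q (ob e) = q' (ob e)"
  proof (cases "e = g b")
    case True
    then show ?thesis using gb b by simp
  next
    case False
    have m: "e < m" "g b < m" "cf e = 0" "cf (g b) = 0" using e v by (auto simp: valid_def)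
    \<comment> \<open>Two different edges of one agent without conflicts: each one forces the slack
      of the other to 0.\<close>
    then have l: "lam e = 0" "lam (g b) = 0" using guess[of e "g b"] guess[of "g b" e] e(2) False by auto
    have "\<not> blk q (g b) e" "\<not> blk q' e (g b)" using e gb m by (auto simp: valid_def)
    then have "q' (ob e) \<le> q (ob e)" using l gb(2) e(2) b(2) by (simp add: blk_def)
    then show ?thesis using le ob m(1) by (meson le_antisym)
  qed
qed

text \<open>
  The tight objects \<open>q b = q' b\<close> in \<open>R\<close> inject via \<open>q'\<close>'s matching into \<open>V\<close>, and from there via \<open>mate\<close> back
  into the tight objects in \<open>R\<close>, but missing \<open>b0\<close>.
\<close>

lemma unreachable_below:
  assumes le: "\<And>b. b < n \<Longrightarrow> q b \<le> q' b" and g: "perfect q' g"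
    and R: "R \<subseteq> {..<n}" "b0 \<in> R" and V: "\<And>e. valid q e \<Longrightarrow> ob e \<in> R \<Longrightarrow> ag e \<in> V"
    and mate: "inj_on mate V" "\<And>a. a \<in> V \<Longrightarrow> mate a \<in> R - {b0}"
      "\<And>a. a \<in> V \<Longrightarrow> \<exists>e. valid q e \<and> ag e = a \<and> ob e = mate a"
  shows "q b0 < q' b0"
proof (rule ccontr)
  assume "\<not> q b0 < q' b0"
  then have b0: "q b0 = q' b0" using le[of b0] R by force
  define S where "S = {b \<in> R. q b = q' b}"
  have fin: "finite S" using R finite_subset unfolding S_def by fastforce
  let ?W = "(ag \<circ> g) ` S"
  have SN: "S \<subseteq> {..<n}" using R(1) by (auto simp: S_def)
  have gS: "valid q (g b)" "ob (g b) = b" if "b \<in> S" for b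
    using tight_closed(1)[OF le g] that SN g by (auto simp: S_def perfect_def)
  have WV: "?W \<subseteq> V" using V gS by (auto simp: S_def)
  have "mate a \<in> S - {b0}" if a: "a \<in> ?W" for a
  proof -
    obtain b where b: "b \<in> S" "a = ag (g b)" using a by auto
    obtain e where e: "valid q e" "ag e = a" "ob e = mate a" using mate(3) WV a by blast
    have "q (mate a) = q' (mate a)"
      using tight_closed(2)[OF le g _ _ e(1)] b e SN by (auto simp: S_def)
    then show ?thesis using mate(2) WV a by (auto simp: S_def)
  qed
  then have "card (mate ` ?W) \<le> card (S - {b0})" using fin by (intro card_mono) auto
  moreover have "card (mate ` ?W) = card ?W" using inj_on_subset[OF mate(1) WV] by (rule card_image)
  moreover have "card ?W = card S"
    using g SN inj_on_subset unfolding perfect_def by (intro card_image) blast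
  moreover have "b0 \<in> S" using b0 R by (simp add: S_def)
  ultimately show False using fin by (metis card_Diff1_less not_less)
qed

text \<open>
  Weak duality with prices: for each \<open>j\<close>, the objects of label at least \<open>j\<close> only see the agents of price
  at least \<open>j\<close>. Some \<open>j\<close> loses at most \<open>K\<close>, because the losses add up to at most \<open>n < (K + 1)\<^sup>2\<close>.
\<close>

lemma auction_bound:
  assumes price: "\<And>e. valid q e \<Longrightarrow> D (ob e) \<le> P (ag e)"
    and M: "\<And>b. b < n \<Longrightarrow> M b \<noteq> 0 \<Longrightarrow> P (M b - 1) = Suc (D b)"
    and sold: "\<And>a. a < n \<Longrightarrow> P a > 0 \<Longrightarrow> \<exists>b<n. M b = Suc a"
    and left: "\<And>b. b < n \<Longrightarrow> M b = 0 \<Longrightarrow> D b = Suc K"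
    and K: "n < Suc K * Suc K"
    and M': "\<And>b. b < n \<Longrightarrow> M' b \<noteq> 0 \<Longrightarrow> \<exists>e. valid q e \<and> ob e = b \<and> Suc (ag e) = M' b"
      "inj_on M' {b. b < n \<and> M' b \<noteq> (0::nat)}"
  shows "card {b. b < n \<and> M' b \<noteq> 0} \<le> card {b. b < n \<and> M b \<noteq> 0} + K"
proof -
  define C where "C j = {b. b < n \<and> M b \<noteq> 0 \<and> D b = j}" for j
  have "\<exists>j\<le>K. card (C j) \<le> K"
  proof (rule ccontr)
    assume "\<not> ?thesis"
    then have "Suc K \<le> card (C j)" if "j \<in> {..K}" for j
      using that by (meson Suc_leI atMost_iff not_le)
    then have "Suc K * Suc K \<le> (\<Sum>j\<le>K. card (C j))" using sum_bounded_below[of "{..K}" "Suc K"] by simp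
    also have "\<dots> = card (\<Union>j\<le>K. C j)" by (rule card_UN_disjoint[symmetric]) (auto simp: C_def)
    also have "\<dots> \<le> card {..<n}" by (intro card_mono) (auto simp: C_def)
    finally show False using K by simp
  qed
  then obtain j where j: "j \<le> K" "card (C j) \<le> K" by blast
  define X where "X = {b. b < n \<and> M b \<noteq> 0 \<and> j < D b}"
  define U where "U = {b. b < n \<and> M b = 0}"
  define B where "B = {b. b < n \<and> j < D b}"
  define A where "A = {a. a < n \<and> j < P a}"
  define L where "L = {b. b < n \<and> M' b \<noteq> 0}"
  have fin: "finite X" "finite U" "finite B" "finite A" "finite L" "finite (C j)"
    by (auto simp: X_def U_def B_def A_def L_def C_def)
  \<comment> \<open>Unmatched objects lie above the threshold, as their label \<open>Suc K\<close>
    exceeds \<open>j\<close>.\<close>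
  have "B = X \<union> U" using j left by (auto simp: B_def X_def U_def)
  then have cB: "card B = card X + card U"
    using fin by (simp add: card_Un_disjoint X_def U_def disjoint_iff)
  have "\<exists>b. b < n \<and> M b = Suc a" if "a \<in> A" for a using sold that by (force simp: A_def)
  then obtain s where s: "\<And>a. a \<in> A \<Longrightarrow> s a < n \<and> M (s a) = Suc a" by metis
  \<comment> \<open>An agent of price above \<open>j\<close> is held by an object of label at least
    \<open>j\<close>. Label exactly \<open>j\<close> is the loss \<open>C j\<close>; the others are
    in \<open>X\<close>.\<close>
  have "s ` A \<subseteq> X \<union> C j"
  proof
    fix b assume "b \<in> s ` A"
    then obtain a where a: "a \<in> A" "b = s a" by blast
    then have "j < Suc (D b)" using s[of a] M[of b] by (simp add: A_def)
    then show "b \<in> X \<union> C j" using s[of a] a(2) a(1) by (auto simp: X_def C_def)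
  qed
  then have "card (s ` A) \<le> card (X \<union> C j)" using fin by (intro card_mono) auto
  moreover have "inj_on s A" using s by (metis inj_onI nat.inject)
  ultimately have "card A \<le> card (X \<union> C j)" by (simp add: card_image)
  then have cA: "card A \<le> card X + card (C j)" using card_Un_le[of X "C j"] by linarith
  have "(\<lambda>b. M' b - 1) ` (L \<inter> B) \<subseteq> A"
  proof
    fix a assume "a \<in> (\<lambda>b. M' b - 1) ` (L \<inter> B)"
    then obtain b where b: "b \<in> L" "b \<in> B" "a = M' b - 1" by blast
    then obtain e where e: "valid q e" "ob e = b" "Suc (ag e) = M' b" using M'(1)[of b] by (auto simp: L_def)
    have "a = ag e" using b(3) e(3) by simp
    then show "a \<in> A" using price[OF e(1)] b ag[of e] e by (auto simp: A_def B_def valid_def)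
  qed
  moreover have "inj_on (\<lambda>b. M' b - 1) (L \<inter> B)"
  proof (rule inj_onI)
    fix x y assume "x \<in> L \<inter> B" "y \<in> L \<inter> B" "M' x - 1 = M' y - 1"
    then show "x = y" using M'(2) unfolding L_def inj_on_def by auto
  qed
  ultimately have cL: "card (L \<inter> B) \<le> card A" using fin card_inj_on_le by blast
  have "L \<subseteq> ({..<n} - B) \<union> (L \<inter> B)" by (auto simp: L_def)
  then have "card L \<le> card (({..<n} - B) \<union> (L \<inter> B))" using fin by (intro card_mono) auto
  also have "\<dots> \<le> card ({..<n} - B) + card (L \<inter> B)" by (rule card_Un_le)
  also have "card ({..<n} - B) = n - card B" using fin by (subst card_Diff_subset) (auto simp: B_def)
  finally have "card L \<le> n - card B + card (L \<inter> B)" .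
  moreover have "n = card {b. b < n \<and> M b \<noteq> 0} + card U"
  proof -
    have "card ({b. b < n \<and> M b \<noteq> 0} \<union> U) = card {b. b < n \<and> M b \<noteq> 0} + card U"
      by (rule card_Un_disjoint) (auto simp: U_def)
    moreover have "{b. b < n \<and> M b \<noteq> 0} \<union> U = {..<n}" by (auto simp: U_def)
    ultimately show ?thesis by (metis card_lessThan)
  qed
  moreover have "card B \<le> n" using card_mono[of "{..<n}" B] by (auto simp: B_def)
  ultimately show ?thesis using cA cB cL j(2) unfolding L_def by linarith
qed

end

context guess
begin

text \<open>A level that no object has, below an occupied one, can be removed.\<close>

lemma perfect_compress:
  assumes "perfect q g"
  shows "\<exists>q'. perfect q' g \<and> (\<forall>b<n. q' b < n)"
  using assms
proof (induction "\<Sum>b<n. q b" arbitrary: q rule: less_induct)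
  case less
  show ?case
  proof (cases "\<forall>b<n. q b < n")
    case False
    then obtain b1 where b1: "b1 < n" "n \<le> q b1" by (meson not_le)
    \<comment> \<open>Pigeonhole: there are more than \<open>n\<close> levels up to
      \<open>q b1\<close>, but only \<open>n\<close> objects.\<close>
    have "\<not> {..q b1} \<subseteq> q ` {..<n}"
    proof
      assume "{..q b1} \<subseteq> q ` {..<n}"
      then have "card {..q b1} \<le> card (q ` {..<n})" by (intro card_mono) auto
      also have "\<dots> \<le> n" using card_image_le[of "{..<n}" q] by simp
      finally show False using b1 by simp
    qed
    then obtain v where v: "v \<le> q b1" "v \<notin> q ` {..<n}" by blast
    then have v1: "v < q b1" using b1 by (metis image_eqI le_neq_implies_less lessThan_iff)
    let ?q = "\<lambda>b. if v < q b then q b - 1 else q b"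
    have "valid ?q e" if "valid q e" for e
    proof -
      have "\<not> blk ?q x e" if x: "x < m" "ag x = ag e" for x
      proof -
        \<comment> \<open>The critical case is \<open>ob x\<close> below the gap and
          \<open>ob e\<close> above it. Their levels differ by at least 2 before and so by at least
          1 after the removal, which makes up for a vote of at most 1.\<close>
        have "\<not> blk q x e" "q (ob x) \<noteq> v" "q (ob e) \<noteq> v"
          using x v(2) \<open>valid q e\<close> ob by (auto simp: valid_def)
        moreover have "vt (ag e) (ob x) (ob e) \<le> 1" by (rule vt)
        ultimately show ?thesis unfolding blk_def by (simp split: if_splits) linarith
      qed
      then show ?thesis using that by (auto simp: valid_def)
    qed
    then have "perfect ?q g" using less.prems by (auto simp: perfect_def)
    moreover have "(\<Sum>b<n. ?q b) < (\<Sum>b<n. q b)"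
      using b1 v1 by (intro sum_strict_mono_ex1) auto
    ultimately show ?thesis using less.hyps by blast
  qed (use less.prems in blast)
qed

end

section \<open>Correctness of guessing\<close>

lemma assignmentE:
  assumes "assignment {..<n} {..<n} E M"
  obtains h where "bij_betw h {..<n} {..<n}" "\<And>a. a < n \<Longrightarrow> (a, h a) \<in> E"
    "M = {(a, h a) | a. a < (n::nat)}"
proof -
  have M: "M \<subseteq> E" "Domain M = {..<n}" "Range M = {..<n}"
    and u: "\<And>a b a' b'. (a, b) \<in> M \<Longrightarrow> (a', b') \<in> M \<Longrightarrow> (a = a' \<longleftrightarrow> b = b')"
    using assms by (auto simp: assignment_def matching_def)
  have "\<forall>a. \<exists>b. a < n \<longrightarrow> (a, b) \<in> M" using M(2) by blast
  then obtain h where h: "\<And>a. a < n \<Longrightarrow> (a, h a) \<in> M" by metis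
  have eq: "M = {(a, h a) | a. a < n}"
  proof (intro equalityI subsetI)
    fix x assume "x \<in> M"
    moreover obtain a b where x: "x = (a, b)" by fastforce
    ultimately have "a < n" "b = h a" using M(2) u[of a b a "h a"] h by auto
    then show "x \<in> {(a, h a) | a. a < n}" using x by blast
  qed (use h in auto)
  have "inj_on h {..<n}"
  proof (rule inj_onI)
    fix a a' assume "a \<in> {..<n}" "a' \<in> {..<n}" "h a = h a'"
    then show "a = a'" using u[OF h h, of a a'] by simp
  qed
  moreover have "h ` {..<n} = {..<n}" using M(3) unfolding eq by auto
  ultimately have "bij_betw h {..<n} {..<n}" by (simp add: bij_betw_def)
  then show thesis using that h M(1) eq by blast
qed

lemma assignmentI:
  assumes "bij_betw h {..<n} {..<n}" "\<And>a. a < n \<Longrightarrow> (a, h a) \<in> E"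
  shows "assignment {..<n} {..<n} E {(a, h a) | a. a < (n::nat)}"
proof -
  have "Range {(a, h a) | a. a < n} = h ` {..<n}" by auto
  moreover have "Domain {(a, h a) | a. a < n} = {..<n}" by auto
  moreover have "matching E {(a, h a) | a. a < n}"
    using assms unfolding matching_def bij_betw_def inj_on_def by auto
  ultimately show ?thesis using assms(1) by (simp add: assignment_def bij_betw_def)
qed

definition load :: "nat \<Rightarrow> (nat \<Rightarrow> nat) \<Rightarrow> nat \<Rightarrow> nat" where
  "load k G e = card {j. j < k \<and> G j = e}"

definition conflict :: "(nat \<Rightarrow> nat) \<Rightarrow> nat \<Rightarrow> (nat \<Rightarrow> nat) \<Rightarrow> nat \<Rightarrow> nat" where
  "conflict ag k G e = card {j. j < k \<and> ag (G j) = ag e \<and> G j \<noteq> e}"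

text \<open>Each \<open>G j\<close> is one unit of slack on one edge. No conflict at
  \<open>e\<close> means that all units of its agent sit on \<open>e\<close> itself.\<close>

lemma (in market) guess_load: "guess n m ag ob vt (load k G) (conflict ag k G)"
proof unfold_locales
  fix e e' assume "e < m" "e' < m" "ag e = ag e'" "e \<noteq> e'" "conflict ag k G e = 0"
  then have "{j. j < k \<and> G j = e'} = {}" by (fastforce simp: conflict_def)
  then show "load k G e' = 0" by (simp add: load_def)
qed

text \<open>Unit \<open>j\<close> is handed to an agent by numbering the units that are needed.
  Surplus units go to agent 0, hence the inequality: more slack than necessary does no harm.\<close>

lemma multiplicities_exist:
  assumes "(\<Sum>a<n. s a) \<le> k" "0 < (n::nat)"
  obtains c where "\<And>j. c j < n" "\<And>a. a < n \<Longrightarrow> s a \<le> card {j. j < k \<and> c j = a}"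
proof -
  define S where "S = (SIGMA a:{..<n}. {..<s a})"
  have fin: "finite S" and card: "card S \<le> k" using assms by (auto simp: S_def)
  obtain f where f: "bij_betw f S {0..<card S}" using ex_bij_betw_finite_nat[OF fin] by blast
  let ?c = "\<lambda>j. if j < card S then fst (inv_into S f j) else 0"
  show thesis
  proof (rule that[of ?c])
    fix j
    show "?c j < n"
    proof (cases "j < card S")
      case True
      then have "inv_into S f j \<in> S" using f by (simp add: bij_betw_def inv_into_into)
      then show ?thesis using True by (auto simp: S_def)
    qed (use assms in simp)
  next
    fix a assume a: "a < n"
    have "f ` ({a} \<times> {..<s a}) \<subseteq> {j. j < k \<and> ?c j = a}"
    proof
      fix j assume "j \<in> f ` ({a} \<times> {..<s a})"
      then obtain i where i: "i < s a" "j = f (a, i)" by auto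
      have S: "(a, i) \<in> S" using a i by (simp add: S_def)
      then have "j < card S" "inv_into S f j = (a, i)"
        using f i(2) by (auto simp: bij_betw_def)
      then show "j \<in> {j. j < k \<and> ?c j = a}" using card by simp
    qed
    then have "card (f ` ({a} \<times> {..<s a})) \<le> card {j. j < k \<and> ?c j = a}" by (intro card_mono) auto
    moreover have "inj_on f ({a} \<times> {..<s a})"
      using f a by (auto simp: bij_betw_def S_def intro: inj_on_subset)
    ultimately show "s a \<le> card {j. j < k \<and> ?c j = a}" by (simp add: card_image)
  qed
qed

locale margin_market = market +
  fixes E :: "(nat \<times> nat) set" and P :: "(nat, nat) prefs"
  assumes E: "E = {(ag e, ob e) | e. e < m}"
    and P: "a < n \<Longrightarrow> vt a b c = of_bool ((b, c) \<in> P a)"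
    and n: "0 < n"
begin

lemma Delta_eq:
  "Delta {..<n} P {(a, h' a) | a. a < n} {(a, h a) | a. a < n} =
   (\<Sum>a<n. int (vt a (h' a) (h a)) - int (vt a (h a) (h' a)))"
proof -
  have phi: "int (phi {..<n} P {(a, f a) | a. a < n} {(a, f' a) | a. a < n}) =
      (\<Sum>a<n. int (vt a (f a) (f' a)))" for f f'
  proof -
    have "{a \<in> {..<n}. prefers P a {(a, f a) | a. a < n} {(a, f' a) | a. a < n}} =
        {..<n} \<inter> {a. (f a, f' a) \<in> P a}"
      by (auto simp: prefers_def matched_def partner_def)
    moreover have "(\<Sum>a<n. int (vt a (f a) (f' a))) = (\<Sum>a<n. of_bool ((f a, f' a) \<in> P a))"
      using P by (intro sum.cong) auto
    ultimately show ?thesis by (simp add: phi_def sum_of_bool_eq)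
  qed
  show ?thesis unfolding Delta_def phi by (simp add: sum_subtractf)
qed

lemma finite_assignments: "finite {N. assignment {..<n} {..<n} E N}"
proof (rule finite_subset)
  show "{N. assignment {..<n} {..<n} E N} \<subseteq> Pow E" by (auto simp: assignment_def matching_def)
  show "finite (Pow E)" unfolding E by simp
qed

lemma margin_le_iff:
  assumes "assignment {..<n} {..<n} E M"
  shows "unpopularity_margin {..<n} {..<n} E P M \<le> c \<longleftrightarrow>
    (\<forall>N. assignment {..<n} {..<n} E N \<longrightarrow> Delta {..<n} P N M \<le> c)"
proof -
  have "{Delta {..<n} P N M | N. assignment {..<n} {..<n} E N} =
      (\<lambda>N. Delta {..<n} P N M) ` {N. assignment {..<n} {..<n} E N}" by auto
  then show ?thesis unfolding unpopularity_margin_def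
    using assms finite_assignments by (subst Max_le_iff) auto
qed

text \<open>Weak duality: for every agent, the vote for a rival assignment is bounded by a
  difference of levels plus the slack of the matching edge.\<close>

lemma margin_le_if_perfect:
  assumes "guess.perfect n m ag ob vt (load k G) (conflict ag k G) q g"
  shows "k_unpopularity_margin_problem k {..<n} {..<n} E P"
proof -
  interpret guess n m ag ob vt "load k G" "conflict ag k G" by (rule guess_load)
  let ?f = "ag \<circ> g"
  have g: "valid q (g b)" "ob (g b) = b" "g b < m" if "b < n" for b
    using assms that by (auto simp: perfect_def valid_def)
  have inj: "inj_on ?f {..<n}" using assms by (simp add: perfect_def)
  moreover have "?f ` {..<n} \<subseteq> {..<n}" using g(3) ag by auto
  then have "?f ` {..<n} = {..<n}" using inj by (intro endo_inj_surj) auto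
  ultimately have f: "bij_betw ?f {..<n} {..<n}" by (simp add: bij_betw_def)
  define h where "h = inv_into {..<n} ?f"
  have h: "bij_betw h {..<n} {..<n}" unfolding h_def using f by (rule bij_betw_inv_into)
  have hn: "h a < n" "ag (g (h a)) = a" if "a < n" for a
    using that bij_betw_apply[OF h, of a] bij_betw_inv_into_right[OF f, of a] by (simp_all add: h_def)
  let ?M = "{(a, h a) | a. a < n}"
  have M: "assignment {..<n} {..<n} E ?M"
  proof (rule assignmentI[OF h])
    fix a assume "a < n"
    then have "(a, h a) = (ag (g (h a)), ob (g (h a)))" "g (h a) < m" using hn g by auto
    then show "(a, h a) \<in> E" unfolding E by blast
  qed
  have "Delta {..<n} P N ?M \<le> int k" if "assignment {..<n} {..<n} E N" for N
  proof -
    obtain h' where h': "bij_betw h' {..<n} {..<n}" "\<And>a. a < n \<Longrightarrow> (a, h' a) \<in> E"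
      "N = {(a, h' a) | a. a < n}" using assignmentE[OF \<open>assignment {..<n} {..<n} E N\<close>] by blast
    have le: "int (vt a (h' a) (h a)) - int (vt a (h a) (h' a)) \<le>
        int (q (h a)) - int (q (h' a)) + int (load k G (g (h a)))" if a: "a < n" for a
    proof -
      obtain x where x: "x < m" "ag x = a" "ob x = h' a" using h'(2)[OF a] unfolding E by auto
      have "\<not> blk q x (g (h a))" using g(1)[OF hn(1)[OF a]] x hn(2)[OF a] by (auto simp: valid_def)
      then show ?thesis using x hn[OF a] g(2) by (simp add: blk_def)
    qed
    have "Delta {..<n} P N ?M \<le>
        (\<Sum>a<n. int (q (h a)) - int (q (h' a)) + int (load k G (g (h a))))"
      unfolding h'(3) Delta_eq by (intro sum_mono) (use le in simp)
    also have "\<dots> = (\<Sum>a<n. int (q (h a))) - (\<Sum>a<n. int (q (h' a))) + (\<Sum>a<n. int (load k G (g (h a))))"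
      by (simp add: sum.distrib sum_subtractf)
    \<comment> \<open>Both assignments use every object exactly once, so the levels cancel and only
      the slack remains.\<close>
    also have "(\<Sum>a<n. int (q (h a))) = (\<Sum>b<n. int (q b))" using h by (rule sum.reindex_bij_betw)
    also have "(\<Sum>a<n. int (q (h' a))) = (\<Sum>b<n. int (q b))" using h'(1) by (rule sum.reindex_bij_betw)
    also have "(\<Sum>a<n. int (load k G (g (h a)))) = (\<Sum>b<n. int (load k G (g b)))"
      using sum.reindex_bij_betw[OF h, of "\<lambda>b. int (load k G (g b))"] .
    \<comment> \<open>Distinct matching edges collect disjoint sets of units, so together they have
      at most \<open>k\<close>.\<close>
    also have "(\<Sum>b<n. int (load k G (g b))) = int (card (\<Union>b<n. {j. j < k \<and> G j = g b}))"
    proof -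
      have "(\<Sum>b<n. load k G (g b)) = card (\<Union>b<n. {j. j < k \<and> G j = g b})"
        unfolding load_def using g(2) by (intro card_UN_disjoint[symmetric]) (auto, metis)
      then show ?thesis by (metis of_nat_sum)
    qed
    also have "card (\<Union>b<n. {j. j < k \<and> G j = g b}) \<le> card {..<k}" by (intro card_mono) auto
    finally show ?thesis by simp
  qed
  then show ?thesis unfolding k_unpopularity_margin_problem_def using M margin_le_iff by blast
qed

text \<open>Strong duality is applied not to \<open>M\<close> but to an assignment \<open>N\<close>
  that beats \<open>M\<close> by most votes. Its weight is the margin of \<open>M\<close>, so the
  slacks of the edges of \<open>M\<close> in the dual constraints add up to at most
  \<open>k\<close>.\<close>

lemma perfect_if_margin_le:
  assumes "k_unpopularity_margin_problem k {..<n} {..<n} E P"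
  obtains G q g where "\<And>j. G j < m" "\<And>b. b < n \<Longrightarrow> q b < n"
    "guess.perfect n m ag ob vt (load k G) (conflict ag k G) q g"
proof -
  obtain M where M: "assignment {..<n} {..<n} E M"
    "\<And>N. assignment {..<n} {..<n} E N \<Longrightarrow> Delta {..<n} P N M \<le> int k"
    using assms margin_le_iff unfolding k_unpopularity_margin_problem_def by blast
  obtain h where h: "bij_betw h {..<n} {..<n}" "\<And>a. a < n \<Longrightarrow> (a, h a) \<in> E"
    "M = {(a, h a) | a. a < n}" using assignmentE[OF M(1)] by blast
  have hn: "h a < n" if "a < n" for a using h(1) that by (auto dest: bij_betw_apply)
  define w where "w a b = int (vt a b (h a)) - int (vt a (h a) b)" for a b
  have D: "Delta {..<n} P {(a, h' a) | a. a < n} M = (\<Sum>a<n. w a (h' a))" for h'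
    unfolding h(3) Delta_eq w_def ..
  let ?D = "\<lambda>N. Delta {..<n} P N M"
  let ?As = "{N. assignment {..<n} {..<n} E N}"
  have "Max (?D ` ?As) \<in> ?D ` ?As" using finite_assignments M(1) by (intro Max_in) auto
  then obtain N where N: "N \<in> ?As" "?D N = Max (?D ` ?As)" by force
  have Nmax: "?D N' \<le> ?D N" if "assignment {..<n} {..<n} E N'" for N'
    unfolding N(2) using finite_assignments that by (intro Max_ge) auto
  obtain h0 where h0: "bij_betw h0 {..<n} {..<n}" "\<And>a. a < n \<Longrightarrow> (a, h0 a) \<in> E"
    "N = {(a, h0 a) | a. a < n}" using assignmentE N(1) by blast
  obtain y z where yz: "\<And>a b. a < n \<Longrightarrow> b < n \<Longrightarrow> (a, b) \<in> E \<Longrightarrow> w a b \<le> y a + z b"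
    "\<And>a. a < n \<Longrightarrow> y a + z (h0 a) = w a (h0 a)"
  proof (rule matching_duality[OF h0(1,2), of w])
    fix h' assume "bij_betw h' {..<n} {..<n}" "\<And>a. a < n \<Longrightarrow> (a, h' a) \<in> E"
    then show "(\<Sum>a<n. w a (h' a)) \<le> (\<Sum>a<n. w a (h0 a))"
      using Nmax[OF assignmentI] unfolding h0(3) D by blast
  qed blast+
  \<comment> \<open>An edge of \<open>M\<close> has weight 0 against itself, so its slack is
    nonnegative and \<open>nat\<close> loses nothing.\<close>
  define s where "s a = nat (y a + z (h a))" for a
  have s: "int (s a) = y a + z (h a)" if "a < n" for a
    using yz(1)[OF that hn h(2)] that by (simp add: s_def w_def)
  have "(\<Sum>a<n. int (s a)) = (\<Sum>a<n. y a) + (\<Sum>a<n. z (h a))"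
    using s by (simp add: sum.distrib[symmetric])
  also have "(\<Sum>a<n. z (h a)) = (\<Sum>a<n. z (h0 a))"
    using sum.reindex_bij_betw[OF h(1), of z] sum.reindex_bij_betw[OF h0(1), of z] by simp
  also have "(\<Sum>a<n. y a) + (\<Sum>a<n. z (h0 a)) = (\<Sum>a<n. w a (h0 a))"
    using yz(2) by (simp add: sum.distrib[symmetric])
  also have "\<dots> \<le> int k" using M(2)[of N] N(1) unfolding h0(3) D by simp
  finally have "(\<Sum>a<n. s a) \<le> k" by (metis of_nat_sum of_nat_le_iff)
  then obtain c where c: "\<And>j. c j < n" "\<And>a. a < n \<Longrightarrow> s a \<le> card {j. j < k \<and> c j = a}"
    using multiplicities_exist n by blast
  have "\<forall>a. \<exists>e. a < n \<longrightarrow> e < m \<and> ag e = a \<and> ob e = h a" using h(2) unfolding E by fastforce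
  then obtain e where e: "\<And>a. a < n \<Longrightarrow> e a < m \<and> ag (e a) = a \<and> ob (e a) = h a" by metis
  define G where "G = e \<circ> c"
  have G: "G j < m" for j using c(1) e by (simp add: G_def)
  interpret guess n m ag ob vt "load k G" "conflict ag k G" by (rule guess_load)
  have load: "s a \<le> load k G (e a)" if "a < n" for a
  proof -
    have "card {j. j < k \<and> c j = a} \<le> load k G (e a)"
      unfolding load_def G_def by (intro card_mono) auto
    then show ?thesis using c(2)[OF that] by simp
  qed
  have conf: "conflict ag k G (e a) = 0" if "a < n" for a
    using that c(1) e by (auto simp: conflict_def G_def)
  \<comment> \<open>Shifting all dual values of objects by a constant makes the levels natural
    numbers; only differences matter.\<close>
  define Z where "Z = Max (z ` {..<n})"
  have Z: "z b \<le> Z" if "b < n" for b unfolding Z_def using that by simp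
  define q where "q b = nat (Z - z b)" for b
  define i where "i = inv_into {..<n} h"
  have i: "i b < n" "h (i b) = b" if "b < n" for b
    unfolding i_def using that h(1)
    by (metis bij_betw_imp_surj_on inv_into_into lessThan_iff f_inv_into_f)+
  have valid: "valid q (e a)" if a: "a < n" for a
  proof -
    have "\<not> blk q x (e a)" if x: "x < m" "ag x = a" for x
    proof -
      have "(a, ob x) \<in> E" using x unfolding E by auto
      then have "w a (ob x) \<le> int (s a) - z (h a) + z (ob x)"
        using yz(1)[of a "ob x"] a ob[OF x(1)] s[OF a] by simp
      moreover have "int (q (h a)) = Z - z (h a)" "int (q (ob x)) = Z - z (ob x)"
        using Z hn[OF a] ob[OF x(1)] by (auto simp: q_def)
      ultimately have "int (q (ob x)) + int (vt a (ob x) (h a)) \<le>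
          int (q (h a)) + int (s a) + int (vt a (h a) (ob x))" by (simp add: w_def)
      then show ?thesis using load[OF a] e[OF a] by (simp add: blk_def)
    qed
    then show ?thesis using conf[OF a] e[OF a] by (auto simp: valid_def)
  qed
  have "perfect q (e \<circ> i)" unfolding perfect_def
  proof (intro conjI allI impI)
    show "inj_on (ag \<circ> (e \<circ> i)) {..<n}"
      using i e by (intro inj_onI) (metis comp_apply lessThan_iff)
  qed (use valid i e in auto)
  then obtain q' where "perfect q' (e \<circ> i)" "\<forall>b<n. q' b < n" using perfect_compress by blast
  then show thesis using that[of G q' "e \<circ> i"] G by blast
qed

end

section \<open>One guess: auction, augmentation, raising a level\<close>

text \<open>
  Pointers into edge lists are edge numbers plus 1, with 0 for the end of the list. The list of an object
  has its edges in descending order, so the edges from pointer \<open>c\<close> on are those with number below \<open>c\<close>.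
\<close>

definition rest :: "(nat \<Rightarrow> nat) \<Rightarrow> nat \<Rightarrow> nat \<Rightarrow> nat set" where
  "rest ob b c = {e. e < c \<and> ob e = b}"

lemma finite_rest [simp]: "finite (rest ob b c)"
  by (simp add: rest_def)

lemma rest_0 [simp]: "rest ob b 0 = {}"
  by (simp add: rest_def)

lemma sum_card_rest:
  assumes "\<And>e. e < m \<Longrightarrow> ob e < n"
  shows "(\<Sum>b<n. card (rest ob b m)) = m"
proof -
  have "(\<Sum>b<n. card (rest ob b m)) = card (\<Union>b<n. rest ob b m)"
    by (rule card_UN_disjoint[symmetric]) (auto simp: rest_def)
  also have "(\<Union>b<n. rest ob b m) = {..<m}" using assms by (auto simp: rest_def)
  finally show ?thesis by simp
qed

text \<open>\<open>hb\<close> and \<open>nb\<close> are heads and links of the edge lists.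
  \<open>mn\<close> and \<open>mn2\<close> are to hold the multiples of \<open>n\<close> and of
  \<open>n * n\<close>, so \<open>vtab\<close> and \<open>eix\<close> are matrices stored row by
  row; \<open>eix\<close> is the incidence matrix with edge numbers plus 1. \<open>K\<close> is the
  integer square root of \<open>n\<close>.\<close>

locale tables = market +
  fixes hb nb mn mn2 vtab eix :: "nat \<Rightarrow> nat" and K :: nat
  assumes hb: "b < n \<Longrightarrow> rest ob b (hb b) = rest ob b m" "b < n \<Longrightarrow> hb b = Suc e \<Longrightarrow> e < m \<and> ob e = b"
    and nb: "e < m \<Longrightarrow> rest ob (ob e) (nb e) = rest ob (ob e) e"
      "e < m \<Longrightarrow> nb e = Suc e' \<Longrightarrow> e' < m \<and> ob e' = ob e"
    and vtab: "a < n \<Longrightarrow> b < n \<Longrightarrow> c < n \<Longrightarrow> vtab (mn2 a + mn b + c) = vt a b c"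
    and eix: "e < m \<Longrightarrow> eix (mn (ag e) + ob e) = Suc e"
      "a < n \<Longrightarrow> b < n \<Longrightarrow> eix (mn a + b) = Suc e \<Longrightarrow> e < m \<and> ag e = a \<and> ob e = b"
    and K: "n < Suc K * Suc K" "K * K \<le> n" and n: "0 < n" "n \<le> m"

locale search = guess + tables
begin

abbreviation rem :: "nat \<Rightarrow> nat \<Rightarrow> nat set" where "rem \<equiv> rest ob"

definition linked :: "nat \<Rightarrow> nat \<Rightarrow> bool" where
  "linked b c \<longleftrightarrow> (\<forall>e. c = Suc e \<longrightarrow> e < m \<and> ob e = b)"

lemma linked_hb: "b < n \<Longrightarrow> linked b (hb b)" using hb(2) by (simp add: linked_def)
lemma linked_nb: "e < m \<Longrightarrow> ob e = b \<Longrightarrow> linked b (nb e)" using nb(2) by (auto simp: linked_def)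

lemma below_hb: "e < m \<Longrightarrow> e < hb (ob e)"
  using hb(1)[of "ob e"] ob[of e] by (auto simp: rest_def set_eq_iff)

lemma below_nb: "e < m \<Longrightarrow> ob e' = ob e \<Longrightarrow> e' < nb e \<longleftrightarrow> e' < e"
  using nb(1)[of e] by (auto simp: rest_def set_eq_iff)

lemma card_rem_nb:
  assumes "e < m" "ob e = b"
  shows "card (rem b (Suc e)) = Suc (card (rem b (nb e)))"
proof -
  have "rem b (Suc e) = insert e (rem b e)" using assms by (auto simp: rest_def less_Suc_eq)
  moreover have "e \<notin> rem b e" by (simp add: rest_def)
  moreover have "rem b (nb e) = rem b e" using nb(1) assms by auto
  ultimately show ?thesis by simp
qed

subsection \<open>Matchings\<close>

text \<open>Partners, too, are stored plus 1, with 0 for an unmatched node.\<close>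

definition vedge :: "(nat \<Rightarrow> nat) \<Rightarrow> nat \<Rightarrow> nat \<Rightarrow> bool" where
  "vedge q a b \<longleftrightarrow> (\<exists>e. valid q e \<and> ag e = a \<and> ob e = b)"

lemma vedge_less: "vedge q a b \<Longrightarrow> a < n \<and> b < n"
  using ag ob by (auto simp: vedge_def valid_def)

definition mtch :: "(nat \<Rightarrow> nat) \<Rightarrow> (nat \<Rightarrow> nat) \<Rightarrow> (nat \<Rightarrow> nat) \<Rightarrow> bool" where
  "mtch q MA MB \<longleftrightarrow> (\<forall>b<n. \<forall>a. MB b = Suc a \<longrightarrow> vedge q a b \<and> MA a = Suc b) \<and>
     (\<forall>a<n. \<forall>b. MA a = Suc b \<longrightarrow> b < n \<and> MB b = Suc a)"

lemma mtchD1: "mtch q MA MB \<Longrightarrow> b < n \<Longrightarrow> MB b = Suc a \<Longrightarrow> vedge q a b \<and> MA a = Suc b"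
  and mtchD2: "mtch q MA MB \<Longrightarrow> a < n \<Longrightarrow> MA a = Suc b \<Longrightarrow> b < n \<and> MB b = Suc a"
  unfolding mtch_def by blast+

definition cardm :: "(nat \<Rightarrow> nat) \<Rightarrow> nat" where
  "cardm MB = card {b. b < n \<and> MB b \<noteq> 0}"

lemma perfect_if_all_matched:
  assumes "mtch q MA MB" "\<And>b. b < n \<Longrightarrow> MB b \<noteq> 0"
  shows "\<exists>g. perfect q g"
proof -
  have "\<forall>b. \<exists>e. b < n \<longrightarrow> valid q e \<and> ob e = b \<and> MB b = Suc (ag e) \<and> MA (ag e) = Suc b"
    using assms unfolding mtch_def vedge_def by (metis not0_implies_Suc)
  then obtain g where g: "\<And>b. b < n \<Longrightarrow> valid q (g b) \<and> ob (g b) = b \<and> MA (ag (g b)) = Suc b"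
    by metis
  have "inj_on (ag \<circ> g) {..<n}"
    by (rule inj_onI) (metis g comp_apply lessThan_iff nat.inject)
  then show ?thesis using g by (auto simp: perfect_def)
qed

subsection \<open>The auction\<close>

text \<open>
  Object \<open>cur\<close> bids, objects beyond \<open>i\<close> have not started. An object with label \<open>D b\<close> bids only for agents
  of price \<open>D b\<close>; the edges that \<open>b\<close> has passed since the last change of its label lead to higher prices.
\<close>

definition auc :: "(nat \<Rightarrow> nat) \<Rightarrow> nat \<Rightarrow> nat \<Rightarrow> (nat \<Rightarrow> nat) \<Rightarrow> (nat \<Rightarrow> nat) \<Rightarrow> (nat \<Rightarrow> nat) \<Rightarrow>
    (nat \<Rightarrow> nat) \<Rightarrow> (nat \<Rightarrow> nat) \<Rightarrow> bool" where
  "auc q i cur P D PT MA MB \<longleftrightarrow>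
     i \<le> n \<and> (i < n \<longrightarrow> cur \<le> i \<and> MB cur = 0 \<and> D cur \<le> K) \<and> (i = n \<longrightarrow> cur = n) \<and>
     (\<forall>b. i < b \<and> b < n \<longrightarrow> MB b = 0 \<and> D b = 0 \<and> PT b = hb b) \<and>
     (\<forall>b. b \<le> i \<and> b < n \<and> b \<noteq> cur \<longrightarrow> MB b \<noteq> 0 \<or> D b = Suc K) \<and>
     (\<forall>b<n. D b \<le> Suc K \<and> linked b (PT b)) \<and>
     (\<forall>e. valid q e \<longrightarrow> D (ob e) + (if PT (ob e) \<le> e then 1 else 0) \<le> P (ag e)) \<and>
     (\<forall>b<n. \<forall>a. MB b = Suc a \<longrightarrow> P a = Suc (D b)) \<and>
     (\<forall>a<n. MA a = 0 \<longrightarrow> P a = 0) \<and> mtch q MA MB"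

text \<open>Bounds the remaining steps of the auction: every relabelling that is still possible pays
  for itself and for one further scan of the whole edge list.\<close>

definition pot :: "(nat \<Rightarrow> nat) \<Rightarrow> (nat \<Rightarrow> nat) \<Rightarrow> nat" where
  "pot D PT = (\<Sum>b<n. (Suc K - D b) * Suc (card (rem b m)) + card (rem b (PT b)))"

lemma pot_upd:
  assumes "b < n"
    "(Suc K - d) * Suc (card (rem b m)) + card (rem b p) <
     (Suc K - D b) * Suc (card (rem b m)) + card (rem b (PT b))"
  shows "pot (D(b := d)) (PT(b := p)) < pot D PT"
  unfolding pot_def using assms by (intro sum_strict_mono_ex1) auto

lemma pot_scan:
  assumes "b < n" "PT b = Suc e" "linked b (PT b)"
  shows "pot D (PT(b := nb e)) < pot D PT"
proof -
  have "card (rem b (Suc e)) = Suc (card (rem b (nb e)))"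
    using assms(2,3) by (intro card_rem_nb) (auto simp: linked_def)
  then show ?thesis using pot_upd[of b "D b" "nb e" D PT] assms(1,2) by simp
qed

lemma pot_relabel:
  assumes "b < n" "PT b = 0" "D b \<le> K"
  shows "pot (D(b := Suc (D b))) (PT(b := hb b)) < pot D PT"
proof (rule pot_upd)
  have "Suc K - D b = Suc (K - D b)" using assms by simp
  then show "(Suc K - Suc (D b)) * Suc (card (rem b m)) + card (rem b (hb b)) <
      (Suc K - D b) * Suc (card (rem b m)) + card (rem b (PT b))" using assms hb(1) by simp
qed (use assms in simp)

lemma pot_init: "pot (\<lambda>_. 0) hb \<le> (K + 2) * (m + n)"
proof -
  have "pot (\<lambda>_. 0) hb = (\<Sum>b<n. Suc K * Suc (card (rem b m)) + card (rem b m))"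
    unfolding pot_def using hb(1) by (intro sum.cong) auto
  also have "\<dots> \<le> (\<Sum>b<n. (K + 2) * Suc (card (rem b m)))" by (intro sum_mono) simp
  also have "\<dots> = (K + 2) * (m + n)"
    using sum_card_rest[of m ob n] ob by (simp add: sum_distrib_left[symmetric] sum.distrib sum_Suc algebra_simps)
  finally show ?thesis .
qed

lemma pot_cong: "(\<And>b. b < n \<Longrightarrow> D b = D' b \<and> PT b = PT' b) \<Longrightarrow> pot D PT = pot D' PT'"
  unfolding pot_def by (intro sum.cong) auto

lemma auc_init:
  assumes "\<And>b. b < n \<Longrightarrow> P b = 0 \<and> D b = 0 \<and> PT b = hb b \<and> MA b = 0 \<and> MB b = 0"
  shows "auc q 0 0 P D PT MA MB"
proof -
  have "D (ob e) + (if PT (ob e) \<le> e then 1 else 0) \<le> P (ag e)" if "valid q e" for e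
    using that assms[of "ob e"] ob[of e] below_hb[of e] by (auto simp: valid_def)
  then show ?thesis using assms n linked_hb unfolding auc_def mtch_def by auto
qed

text \<open>With pointer 0, all edges of \<open>cur\<close> have been passed, so its valid edges
  lead to prices above its label, which may therefore grow. Beyond \<open>K\<close> the object gives
  up and the next one starts.\<close>

lemma auc_relabel:
  assumes auc: "auc q i cur P D PT MA MB" and i: "i < n" "PT cur = 0"
  shows "D cur < K \<Longrightarrow> auc q i cur P (D(cur := Suc (D cur))) (PT(cur := hb cur)) MA MB"
    and "D cur = K \<Longrightarrow> auc q (Suc i) (Suc i) P (D(cur := Suc (D cur))) (PT(cur := hb cur)) MA MB"
proof -
  let ?D = "D(cur := Suc (D cur))" and ?PT = "PT(cur := hb cur)"
  have cur: "cur \<le> i" "cur < n" "MB cur = 0" "D cur \<le> K" using auc i by (auto simp: auc_def)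
  have "?D (ob e) + (if ?PT (ob e) \<le> e then 1 else 0) \<le> P (ag e)" if v: "valid q e" for e
  proof -
    have "D (ob e) + (if PT (ob e) \<le> e then 1 else 0) \<le> P (ag e)" using auc v by (simp add: auc_def)
    then show ?thesis using i(2) below_hb[of e] v by (auto simp: valid_def)
  qed
  moreover have "\<forall>b<n. \<forall>a. MB b = Suc a \<longrightarrow> P a = Suc (?D b)"
    using auc cur(3) by (auto simp: auc_def)
  moreover have "\<forall>b<n. linked b (?PT b)" using auc linked_hb by (auto simp: auc_def)
  ultimately have *: "(\<forall>b<n. linked b (?PT b)) \<and>
     (\<forall>e. valid q e \<longrightarrow> ?D (ob e) + (if ?PT (ob e) \<le> e then 1 else 0) \<le> P (ag e)) \<and>
     (\<forall>b<n. \<forall>a. MB b = Suc a \<longrightarrow> P a = Suc (?D b))" by blast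
  show "auc q i cur P ?D ?PT MA MB" if "D cur < K"
    using auc cur i that * unfolding auc_def by simp
  show "auc q (Suc i) (Suc i) P ?D ?PT MA MB" if "D cur = K"
    using auc cur i that * unfolding auc_def by (auto simp: less_Suc_eq_le le_Suc_eq)
qed

lemma auc_cur:
  assumes "auc q i cur P D PT MA MB" "i < n"
  shows "cur \<le> i" "cur < n" "MB cur = 0" "D cur \<le> K" "linked cur (PT cur)"
proof -
  show c: "cur \<le> i" "MB cur = 0" "D cur \<le> K" using assms by (simp_all add: auc_def)
  then show "cur < n" using assms(2) by simp
  then show "linked cur (PT cur)" using assms(1) by (simp add: auc_def)
qed

text \<open>Passing \<open>e\<close> is justified if its agent is, or has just become, more
  expensive than the label. Allowing raised prices \<open>P'\<close> covers both skipping and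
  taking.\<close>

lemma auc_scan_price:
  assumes auc: "auc q i cur P D PT MA MB" and i: "i < n" "PT cur = Suc e"
    and P': "\<And>a. P a \<le> P' a" "valid q e \<Longrightarrow> D cur < P' (ag e)" and v: "valid q e'"
  shows "D (ob e') + (if (PT(cur := nb e)) (ob e') \<le> e' then 1 else 0) \<le> P' (ag e')"
proof -
  have e: "e < m" "ob e = cur" using auc_cur(5)[OF auc i(1)] i(2) by (auto simp: linked_def)
  have "D (ob e') + (if PT (ob e') \<le> e' then 1 else 0) \<le> P (ag e')"
    using auc v unfolding auc_def by blast
  then have old: "D (ob e') + (if PT (ob e') \<le> e' then 1 else 0) \<le> P' (ag e')"
    using P'(1)[of "ag e'"] by linarith
  show ?thesis
  proof (cases "ob e' = cur \<and> e' \<noteq> e")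
    case True
    then show ?thesis using old i(2) e below_nb[of e e'] by (auto split: if_splits)
  next
    case False
    then show ?thesis using old P'(2) v e by (auto split: if_splits)
  qed
qed

lemma auc_skip:
  assumes auc: "auc q i cur P D PT MA MB" and i: "i < n" "PT cur = Suc e"
    and skip: "\<not> (valid q e \<and> P (ag e) \<le> D cur)"
  shows "auc q i cur P D (PT(cur := nb e)) MA MB"
proof -
  have "cur < n" "e < m" "ob e = cur"
    using auc_cur(2,5)[OF auc i(1)] i(2) by (auto simp: linked_def)
  then have "linked b ((PT(cur := nb e)) b)" if "b < n" for b
    using that auc linked_nb by (auto simp: auc_def)
  moreover have "D (ob e') + (if (PT(cur := nb e)) (ob e') \<le> e' then 1 else 0) \<le> P (ag e')"
    if "valid q e'" for e'
    using auc_scan_price[OF auc i _ _ that, of P] skip by auto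
  moreover have "\<forall>b. i < b \<and> b < n \<longrightarrow> (PT(cur := nb e)) b = hb b"
    using auc i by (auto simp: auc_def)
  ultimately show ?thesis using auc i unfolding auc_def by blast
qed

text \<open>The invariant bounds the price from below by the label, so an affordable agent costs
  exactly \<open>D cur\<close> and costs one more afterwards. An evicted object resumes with its own
  label and pointer.\<close>

lemma auc_take:
  assumes auc: "auc q i cur P D PT MA MB" and i: "i < n" "PT cur = Suc e"
    and take: "valid q e" "P (ag e) \<le> D cur"
  defines "MA' \<equiv> MA(ag e := Suc cur)" and "P' \<equiv> P(ag e := Suc (P (ag e)))" and "PT' \<equiv> PT(cur := nb e)"
  shows "MA (ag e) = 0 \<Longrightarrow> auc q (Suc i) (Suc i) P' D PT' MA' (MB(cur := Suc (ag e)))"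
    and "MA (ag e) = Suc b' \<Longrightarrow> auc q i b' P' D PT' MA' (MB(cur := Suc (ag e), b' := 0))"
proof -
  note cur = auc_cur[OF auc i(1)]
  have e: "e < m" "ob e = cur" using cur(5) i(2) by (auto simp: linked_def)
  have m: "mtch q MA MB" using auc by (simp add: auc_def)
  have a: "ag e < n" using ag e by simp
  have "D (ob e) + (if PT (ob e) \<le> e then 1 else 0) \<le> P (ag e)" using auc take(1) unfolding auc_def by blast
  then have P: "P (ag e) = D cur" using take e by simp
  have "\<forall>b<n. linked b (PT' b)" using auc linked_nb cur(2) e by (auto simp: auc_def PT'_def)
  moreover have "\<forall>e'. valid q e' \<longrightarrow> D (ob e') + (if PT' (ob e') \<le> e' then 1 else 0) \<le> P' (ag e')"
    using auc_scan_price[OF auc i, of P'] P unfolding PT'_def by (auto simp: P'_def)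
  moreover have "\<forall>a<n. MA' a = 0 \<longrightarrow> P' a = 0" using auc by (auto simp: auc_def MA'_def P'_def)
  moreover have "\<forall>b. i < b \<and> b < n \<longrightarrow> MB b = 0 \<and> D b = 0 \<and> PT' b = hb b"
    using auc cur(1) by (auto simp: auc_def PT'_def)
  ultimately have *: "(\<forall>b<n. D b \<le> Suc K \<and> linked b (PT' b)) \<and>
     (\<forall>e'. valid q e' \<longrightarrow> D (ob e') + (if PT' (ob e') \<le> e' then 1 else 0) \<le> P' (ag e')) \<and>
     (\<forall>a<n. MA' a = 0 \<longrightarrow> P' a = 0) \<and> (\<forall>b. i < b \<and> b < n \<longrightarrow> MB b = 0 \<and> D b = 0 \<and> PT' b = hb b)"
    using auc by (auto simp: auc_def)
  have edge: "vedge q (ag e) cur" using take e by (auto simp: vedge_def)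
  have PD: "P b = Suc (D c)" if "c < n" "MB c = Suc b" for b c using auc that by (auto simp: auc_def)
  show "auc q (Suc i) (Suc i) P' D PT' MA' (MB(cur := Suc (ag e)))" (is "auc _ _ _ _ _ _ _ ?MB")
    if free: "MA (ag e) = 0"
  proof -
    have nobody: "MB b \<noteq> Suc (ag e)" if "b < n" for b using mtchD1[OF m that] free by auto
    have "mtch q MA' ?MB" unfolding mtch_def
    proof (intro conjI allI impI)
      fix b a assume "b < n" "?MB b = Suc a"
      then show "vedge q a b" "MA' a = Suc b"
        using edge mtchD1[OF m] nobody[of b] by (auto simp: MA'_def split: if_splits)
    next
      fix a b assume "a < n" "MA' a = Suc b"
      then show "b < n" "?MB b = Suc a"
        using mtchD2[OF m, of a b] cur by (auto simp: MA'_def split: if_splits)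
    qed
    moreover have "\<forall>b<n. \<forall>a. ?MB b = Suc a \<longrightarrow> P' a = Suc (D b)"
      using PD nobody P by (auto simp: P'_def)
    moreover have "\<forall>b. b \<le> Suc i \<and> b < n \<and> b \<noteq> Suc i \<longrightarrow> ?MB b \<noteq> 0 \<or> D b = Suc K"
      using auc by (auto simp: auc_def)
    moreover have "\<forall>b. Suc i < b \<and> b < n \<longrightarrow> ?MB b = 0 \<and> D b = 0 \<and> PT' b = hb b" using * cur(1) by auto
    moreover have "Suc i < n \<longrightarrow> ?MB (Suc i) = 0 \<and> D (Suc i) \<le> K" using * cur(1) by auto
    ultimately show ?thesis using * i unfolding auc_def by simp
  qed
  show "auc q i b' P' D PT' MA' (MB(cur := Suc (ag e), b' := 0))" (is "auc _ _ _ _ _ _ _ ?MB")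
    if old: "MA (ag e) = Suc b'"
  proof -
    have b': "b' < n" "MB b' = Suc (ag e)" using mtchD2[OF m a old] by auto
    then have ne: "b' \<noteq> cur" using cur(3) by auto
    have only: "MB b = Suc (ag e) \<longleftrightarrow> b = b'" if "b < n" for b
      using mtchD1[OF m that, of "ag e"] old b' by auto
    have le: "b' \<le> i" using auc b' unfolding auc_def by (metis not_le Zero_not_Suc)
    \<comment> \<open>The old price was \<open>Suc (D b')\<close> and equals \<open>D cur\<close>,
      so the evicted object has a smaller label and has not given up.\<close>
    have "D b' \<le> K" using PD[OF b'] P cur(4) by simp
    have "mtch q MA' ?MB" unfolding mtch_def
    proof (intro conjI allI impI)
      fix b a assume "b < n" "?MB b = Suc a"
      then show "vedge q a b" "MA' a = Suc b"
        using edge mtchD1[OF m] only[of b] by (auto simp: MA'_def split: if_splits)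
    next
      fix a b assume ab: "a < n" "MA' a = Suc b"
      show "b < n" using ab cur mtchD2[OF m, of a b] by (auto simp: MA'_def split: if_splits)
      show "?MB b = Suc a"
        using ab cur ne mtchD2[OF m, of a b] b' by (auto simp: MA'_def split: if_splits)
    qed
    moreover have "\<forall>b<n. \<forall>a. ?MB b = Suc a \<longrightarrow> P' a = Suc (D b)"
      using PD only P by (auto simp: P'_def)
    moreover have "\<forall>b. b \<le> i \<and> b < n \<and> b \<noteq> b' \<longrightarrow> ?MB b \<noteq> 0 \<or> D b = Suc K"
      using auc by (auto simp: auc_def)
    moreover have "\<forall>b. i < b \<and> b < n \<longrightarrow> ?MB b = 0" using * cur(1) by auto
    ultimately show ?thesis using * i le \<open>D b' \<le> K\<close> unfolding auc_def by simp
  qed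
qed

text \<open>With \<open>i = n\<close> nobody is bidding, so every unmatched object has label
  \<open>Suc K\<close>. This is the premise that lets \<open>auction_bound\<close> compare with an
  arbitrary matching.\<close>

lemma auc_final:
  assumes auc: "auc q n n P D PT MA MB" and m: "mtch q MA' MB'"
  shows "cardm MB' \<le> cardm MB + K"
  unfolding cardm_def
proof (rule auction_bound)
  fix e assume "valid q e"
  then have "D (ob e) + (if PT (ob e) \<le> e then 1 else 0) \<le> P (ag e)" using auc unfolding auc_def by blast
  then show "D (ob e) \<le> P (ag e)" by simp
next
  fix b assume "b < n" "MB b \<noteq> 0"
  then show "P (MB b - 1) = Suc (D b)" using auc unfolding auc_def by (metis Suc_pred' diff_Suc_1 neq0_conv)
next
  fix a assume "a < n" "0 < P a"
  then have "MA a \<noteq> 0" using auc by (auto simp: auc_def)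
  then obtain b where "MA a = Suc b" using not0_implies_Suc by blast
  moreover have "mtch q MA MB" using auc by (simp add: auc_def)
  ultimately show "\<exists>b<n. MB b = Suc a" using mtchD2 \<open>a < n\<close> by blast
next
  fix b assume b: "b < n" "MB b = 0"
  then have "b \<le> n" "b \<noteq> n" by simp_all
  then show "D b = Suc K" using auc b unfolding auc_def by blast
next
  fix b assume "b < n" "MB' b \<noteq> 0"
  then obtain a where "MB' b = Suc a" using not0_implies_Suc by blast
  then show "\<exists>e. valid q e \<and> ob e = b \<and> Suc (ag e) = MB' b"
    using mtchD1[OF m \<open>b < n\<close>] by (auto simp: vedge_def)
next
  show "inj_on MB' {b. b < n \<and> MB' b \<noteq> 0}"
  proof (rule inj_onI)
    fix b c assume *: "b \<in> {b. b < n \<and> MB' b \<noteq> 0}" "c \<in> {b. b < n \<and> MB' b \<noteq> 0}" "MB' b = MB' c"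
    then obtain a where "MB' b = Suc a" using not0_implies_Suc by blast
    then show "b = c" using mtchD1[OF m, of b a] mtchD1[OF m, of c a] * by auto
  qed
qed (use K in simp)

end

context search
begin

subsection \<open>Breadth-first search and augmentation\<close>

text \<open>
  The objects reached are the root \<open>i\<close> and the queue \<open>Q\<close>, the first \<open>qh\<close> entries of which have been
  taken out; \<open>pe\<close> points into the edge list of the last of them, \<open>b\<close>. Agents remember in \<open>vis\<close> the object
  from which they were reached.
\<close>

definition bfs :: "(nat \<Rightarrow> nat) \<Rightarrow> (nat \<Rightarrow> nat) \<Rightarrow> (nat \<Rightarrow> nat) \<Rightarrow> nat \<Rightarrow> nat \<Rightarrow> nat \<Rightarrow> (nat \<Rightarrow> nat) \<Rightarrow>
    (nat \<Rightarrow> nat) \<Rightarrow> nat \<Rightarrow> nat \<Rightarrow> nat \<Rightarrow> bool" where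
  "bfs q MA MB i b pe vis Q qh qt found \<longleftrightarrow>
     qh \<le> qt \<and> b \<in> insert i (Q ` {..<qh}) \<and> linked b pe \<and> inj_on Q {..<qt} \<and>
     (\<forall>y<qt. Q y < n \<and> (\<exists>a<n. MB (Q y) = Suc a \<and> vis a \<noteq> 0)) \<and>
     (\<forall>a<n. \<forall>c. vis a = Suc c \<longrightarrow> c \<in> insert i (Q ` {..<qh}) \<and> vedge q a c \<and>
        (\<forall>d. MA a = Suc d \<longrightarrow> (\<exists>y<qt. Q y = d \<and> (c = i \<or> (\<exists>x<y. Q x = c)))) \<and>
        (MA a = 0 \<longrightarrow> found \<noteq> 0)) \<and>
     (\<forall>e. valid q e \<and> ob e \<in> insert i (Q ` {..<qh}) \<and> \<not> (ob e = b \<and> e < pe) \<longrightarrow> vis (ag e) \<noteq> 0) \<and>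
     (\<forall>a. found = Suc a \<longrightarrow> a < n \<and> MA a = 0 \<and> vis a \<noteq> 0)"

lemma bfsD:
  assumes "bfs q MA MB i b pe vis Q qh qt found"
  shows "qh \<le> qt" "b \<in> insert i (Q ` {..<qh})" "linked b pe" "inj_on Q {..<qt}"
    and "\<And>y. y < qt \<Longrightarrow> Q y < n" "\<And>y. y < qt \<Longrightarrow> \<exists>a<n. MB (Q y) = Suc a \<and> vis a \<noteq> 0"
    and "\<And>a c. a < n \<Longrightarrow> vis a = Suc c \<Longrightarrow> c \<in> insert i (Q ` {..<qh})"
    and "\<And>a c. a < n \<Longrightarrow> vis a = Suc c \<Longrightarrow> vedge q a c"
    and "\<And>a c d. a < n \<Longrightarrow> vis a = Suc c \<Longrightarrow> MA a = Suc d \<Longrightarrow>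
          \<exists>y<qt. Q y = d \<and> (c = i \<or> (\<exists>x<y. Q x = c))"
    and "\<And>a c. a < n \<Longrightarrow> vis a = Suc c \<Longrightarrow> MA a = 0 \<Longrightarrow> found \<noteq> 0"
    and "\<And>e. valid q e \<Longrightarrow> ob e \<in> insert i (Q ` {..<qh}) \<Longrightarrow> \<not> (ob e = b \<and> e < pe) \<Longrightarrow> vis (ag e) \<noteq> 0"
    and "\<And>a. found = Suc a \<Longrightarrow> a < n \<and> MA a = 0 \<and> vis a \<noteq> 0"
proof -
  note c = assms[unfolded bfs_def]
  show "qh \<le> qt" "b \<in> insert i (Q ` {..<qh})" "linked b pe" "inj_on Q {..<qt}"
    by (intro c[THEN conjunct1] c[THEN conjunct2, THEN conjunct1] c[THEN conjunct2, THEN conjunct2, THEN conjunct1] c[THEN conjunct2, THEN conjunct2, THEN conjunct2, THEN conjunct1])+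
  note c5 = c[THEN conjunct2, THEN conjunct2, THEN conjunct2, THEN conjunct2, THEN conjunct1] and c6 = c[THEN conjunct2, THEN conjunct2, THEN conjunct2, THEN conjunct2, THEN conjunct2, THEN conjunct1]
    and c7 = c[THEN conjunct2, THEN conjunct2, THEN conjunct2, THEN conjunct2, THEN conjunct2, THEN conjunct2, THEN conjunct1] and c8 = c[THEN conjunct2, THEN conjunct2, THEN conjunct2, THEN conjunct2, THEN conjunct2, THEN conjunct2, THEN conjunct2]
  show "\<And>y. y < qt \<Longrightarrow> Q y < n" "\<And>y. y < qt \<Longrightarrow> \<exists>a<n. MB (Q y) = Suc a \<and> vis a \<noteq> 0"
    using c5 by blast+
  show "\<And>a c. a < n \<Longrightarrow> vis a = Suc c \<Longrightarrow> c \<in> insert i (Q ` {..<qh})"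
    "\<And>a c. a < n \<Longrightarrow> vis a = Suc c \<Longrightarrow> vedge q a c"
    "\<And>a c d. a < n \<Longrightarrow> vis a = Suc c \<Longrightarrow> MA a = Suc d \<Longrightarrow>
          \<exists>y<qt. Q y = d \<and> (c = i \<or> (\<exists>x<y. Q x = c))"
    "\<And>a c. a < n \<Longrightarrow> vis a = Suc c \<Longrightarrow> MA a = 0 \<Longrightarrow> found \<noteq> 0"
    using c6 by blast+
  show "\<And>e. valid q e \<Longrightarrow> ob e \<in> insert i (Q ` {..<qh}) \<Longrightarrow> \<not> (ob e = b \<and> e < pe) \<Longrightarrow> vis (ag e) \<noteq> 0"
    using c7 by blast
  show "\<And>a. found = Suc a \<Longrightarrow> a < n \<and> MA a = 0 \<and> vis a \<noteq> 0" using c8 by blast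
qed

lemma bfsI:
  assumes "qh \<le> qt" "b \<in> insert i (Q ` {..<qh})" "linked b pe" "inj_on Q {..<qt}"
    and "\<And>y. y < qt \<Longrightarrow> Q y < n" "\<And>y. y < qt \<Longrightarrow> \<exists>a<n. MB (Q y) = Suc a \<and> vis a \<noteq> 0"
    and "\<And>a c. a < n \<Longrightarrow> vis a = Suc c \<Longrightarrow> c \<in> insert i (Q ` {..<qh})"
    and "\<And>a c. a < n \<Longrightarrow> vis a = Suc c \<Longrightarrow> vedge q a c"
    and "\<And>a c d. a < n \<Longrightarrow> vis a = Suc c \<Longrightarrow> MA a = Suc d \<Longrightarrow>
          \<exists>y<qt. Q y = d \<and> (c = i \<or> (\<exists>x<y. Q x = c))"
    and "\<And>a c. a < n \<Longrightarrow> vis a = Suc c \<Longrightarrow> MA a = 0 \<Longrightarrow> found \<noteq> 0"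
    and "\<And>e. valid q e \<Longrightarrow> ob e \<in> insert i (Q ` {..<qh}) \<Longrightarrow> \<not> (ob e = b \<and> e < pe) \<Longrightarrow> vis (ag e) \<noteq> 0"
    and "\<And>a. found = Suc a \<Longrightarrow> a < n \<and> MA a = 0 \<and> vis a \<noteq> 0"
  shows "bfs q MA MB i b pe vis Q qh qt found"
  unfolding bfs_def
proof (intro conjI)
  show "\<forall>y<qt. Q y < n \<and> (\<exists>a<n. MB (Q y) = Suc a \<and> vis a \<noteq> 0)" using assms(5,6) by simp
  show "\<forall>a<n. \<forall>c. vis a = Suc c \<longrightarrow> c \<in> insert i (Q ` {..<qh}) \<and> vedge q a c \<and>
        (\<forall>d. MA a = Suc d \<longrightarrow> (\<exists>y<qt. Q y = d \<and> (c = i \<or> (\<exists>x<y. Q x = c)))) \<and>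
        (MA a = 0 \<longrightarrow> found \<noteq> 0)" using assms(7-10) by presburger
  show "\<forall>e. valid q e \<and> ob e \<in> insert i (Q ` {..<qh}) \<and> \<not> (ob e = b \<and> e < pe) \<longrightarrow> vis (ag e) \<noteq> 0"
    using assms(11) by blast
  show "\<forall>a. found = Suc a \<longrightarrow> a < n \<and> MA a = 0 \<and> vis a \<noteq> 0" using assms(12) by blast
qed (fact assms)+

text \<open>Bounds the remaining steps of the search: the rest of the current list and, for every
  object not yet taken out, its whole list plus one step for taking it out.\<close>

definition bpot :: "nat \<Rightarrow> nat \<Rightarrow> nat \<Rightarrow> (nat \<Rightarrow> nat) \<Rightarrow> nat \<Rightarrow> nat" where
  "bpot i b pe Q qh = card (rem b pe) + (\<Sum>c\<in>{..<n} - insert i (Q ` {..<qh}). Suc (card (rem c m)))"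

lemma bpot_init: "i < n \<Longrightarrow> bpot i i (hb i) Q 0 \<le> m + n"
proof -
  assume i: "i < n"
  have "bpot i i (hb i) Q 0 \<le> Suc (card (rem i m)) + (\<Sum>c\<in>{..<n} - {i}. Suc (card (rem c m)))"
    using hb(1)[OF i] by (simp add: bpot_def)
  also have "\<dots> = (\<Sum>c<n. Suc (card (rem c m)))" using i by (subst sum.remove[of _ i]) auto
  also have "\<dots> = m + n" using sum_card_rest[of m ob n] ob by (simp add: sum_Suc)
  finally show ?thesis .
qed

lemma bfs_init:
  assumes "\<And>a. a < n \<Longrightarrow> vis a = 0" "i < n"
  shows "bfs q MA MB i i (hb i) vis Q 0 0 0"
proof -
  have "ob e \<noteq> i" if "valid q e" "\<not> e < hb i" for e
    using that below_hb[of e] by (auto simp: valid_def)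
  then show ?thesis using assms linked_hb unfolding bfs_def by auto
qed

lemma bfs_root_notin:
  assumes "bfs q MA MB i b pe vis Q qh qt found" "MB i = 0" "y < qt"
  shows "Q y \<noteq> i" "Q y < n"
proof -
  show "Q y \<noteq> i" using bfsD(6)[OF assms(1,3)] assms(2) by auto
  show "Q y < n" using bfsD(5)[OF assms(1,3)] .
qed

lemma bfs_qt_le:
  assumes "bfs q MA MB i b pe vis Q qh qt found"
  shows "qt \<le> n"
proof -
  have "card (Q ` {..<qt}) \<le> card {..<n}" using bfsD(5)[OF assms] by (intro card_mono) auto
  then show ?thesis using bfsD(4)[OF assms] by (simp add: card_image)
qed

text \<open>Pointer 0 means that all valid edges of \<open>b\<close> lead to visited agents, so
  \<open>b\<close> no longer needs its exemption in the invariant, and the next object can take it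
  over.\<close>

lemma bfs_dequeue:
  assumes bfs: "bfs q MA MB i b 0 vis Q qh qt found" and i: "MB i = 0" and q: "qh < qt"
  shows "bfs q MA MB i (Q qh) (hb (Q qh)) vis Q (Suc qh) qt found"
    and "bpot i (Q qh) (hb (Q qh)) Q (Suc qh) < bpot i b 0 Q qh"
proof -
  have Qn: "Q qh < n" "Q qh \<noteq> i" using bfs_root_notin[OF bfs i q] by auto
  have dq: "insert i (Q ` {..<Suc qh}) = insert (Q qh) (insert i (Q ` {..<qh}))"
    by (auto simp: lessThan_Suc)
  show "bfs q MA MB i (Q qh) (hb (Q qh)) vis Q (Suc qh) qt found"
  proof (rule bfsI)
    show "Suc qh \<le> qt" using q by simp
    show "Q qh \<in> insert i (Q ` {..<Suc qh})" by simp
    show "linked (Q qh) (hb (Q qh))" using Qn linked_hb by simp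
  next
    fix a c assume "a < n" "vis a = Suc c"
    then show "c \<in> insert i (Q ` {..<Suc qh})" using bfsD(7)[OF bfs] unfolding dq by blast
  next
    fix e assume e: "valid q e" "ob e \<in> insert i (Q ` {..<Suc qh})" "\<not> (ob e = Q qh \<and> e < hb (Q qh))"
    then have "ob e \<noteq> Q qh" using below_hb[of e] by (auto simp: valid_def)
    then have "ob e \<in> insert i (Q ` {..<qh})" using e(2) unfolding dq by blast
    then show "vis (ag e) \<noteq> 0" using bfsD(11)[OF bfs e(1)] by simp
  qed (fact bfsD[OF bfs])+
  have notin: "Q qh \<in> {..<n} - insert i (Q ` {..<qh})"
  proof -
    have "Q qh \<notin> Q ` {..<qh}" using q bfsD(4)[OF bfs] by (fastforce dest: inj_onD)
    then show ?thesis using Qn by simp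
  qed
  have "(\<Sum>c\<in>{..<n} - insert i (Q ` {..<qh}). Suc (card (rem c m))) =
      Suc (card (rem (Q qh) m)) + (\<Sum>c\<in>{..<n} - insert i (Q ` {..<qh}) - {Q qh}. Suc (card (rem c m)))"
    using notin by (intro sum.remove) auto
  moreover have "{..<n} - insert i (Q ` {..<qh}) - {Q qh} = {..<n} - insert i (Q ` {..<Suc qh})"
    unfolding dq by blast
  ultimately show "bpot i (Q qh) (hb (Q qh)) Q (Suc qh) < bpot i b 0 Q qh"
    unfolding bpot_def using hb(1)[OF Qn(1)] by simp
qed

lemma bpot_scan:
  assumes "linked b (Suc e)"
  shows "bpot i b (nb e) Q qh < bpot i b (Suc e) Q qh"
  unfolding bpot_def using card_rem_nb[of e b] assms by (simp add: linked_def)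

lemma bpot_cong: "(\<And>y. y < qh \<Longrightarrow> Q y = Q' y) \<Longrightarrow> bpot i b pe Q qh = bpot i b pe Q' qh"
  unfolding bpot_def by (metis (no_types, lifting) image_cong lessThan_iff)

lemma bfs_skip:
  assumes bfs: "bfs q MA MB i b (Suc e) vis Q qh qt found"
    and skip: "\<not> valid q e \<or> vis (ag e) \<noteq> 0"
  shows "bfs q MA MB i b (nb e) vis Q qh qt found"
proof -
  have e: "e < m" "ob e = b" using bfsD(3)[OF bfs] by (auto simp: linked_def)
  show ?thesis
  proof (rule bfsI)
    show "linked b (nb e)" using linked_nb e by blast
  next
    fix e' assume e': "valid q e'" "ob e' \<in> insert i (Q ` {..<qh})" "\<not> (ob e' = b \<and> e' < nb e)"
    show "vis (ag e') \<noteq> 0"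
    proof (cases "e' = e")
      case True
      then show ?thesis using skip e'(1) by blast
    next
      case False
      then have "\<not> (ob e' = b \<and> e' < Suc e)" using e'(3) below_nb[of e e'] e by auto
      then show ?thesis using bfsD(11)[OF bfs e'(1,2)] by blast
    qed
  qed (fact bfsD[OF bfs])+
qed

text \<open>The search does not stop at a free agent; it only records the latest one and runs until
  the queue is exhausted.\<close>

lemma bfs_visit_free:
  assumes bfs: "bfs q MA MB i b (Suc e) vis Q qh qt found"
    and e: "valid q e" "vis (ag e) = 0" "MA (ag e) = 0"
  shows "bfs q MA MB i b (nb e) (vis(ag e := Suc b)) Q qh qt (Suc (ag e))"
proof -
  have em: "e < m" "ob e = b" using bfsD(3)[OF bfs] by (auto simp: linked_def)
  have a: "ag e < n" "vedge q (ag e) b" using ag em e(1) by (auto simp: vedge_def)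
  let ?vis = "vis(ag e := Suc b)"
  \<comment> \<open>Marking the agent preserves the invariant with the pointer still at
    \<open>e\<close>. Moving on is then an instance of skipping, as the agent is now visited. The
    next lemma proceeds likewise.\<close>
  have "bfs q MA MB i b (Suc e) ?vis Q qh qt (Suc (ag e))"
  proof (rule bfsI)
    fix y assume "y < qt"
    then obtain a' where "a' < n" "MB (Q y) = Suc a'" "vis a' \<noteq> 0" using bfsD(6)[OF bfs] by blast
    then show "\<exists>a<n. MB (Q y) = Suc a \<and> ?vis a \<noteq> 0" by (intro exI[of _ a']) simp
  next
    fix a' c assume *: "a' < n" "?vis a' = Suc c"
    show "c \<in> insert i (Q ` {..<qh})" using * bfsD(2)[OF bfs] bfsD(7)[OF bfs *(1)] by (cases "a' = ag e") auto
    show "vedge q a' c" using * a bfsD(8)[OF bfs *(1)] by (cases "a' = ag e") auto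
    show "\<exists>y<qt. Q y = d \<and> (c = i \<or> (\<exists>x<y. Q x = c))" if "MA a' = Suc d" for d
      using * that e(3) bfsD(9)[OF bfs *(1)] by (cases "a' = ag e") auto
  next
    fix e' assume "valid q e'" "ob e' \<in> insert i (Q ` {..<qh})" "\<not> (ob e' = b \<and> e' < Suc e)"
    then show "?vis (ag e') \<noteq> 0" using bfsD(11)[OF bfs] by simp
  qed (use a e(3) bfsD[OF bfs] in auto)
  then show ?thesis by (rule bfs_skip) simp
qed

text \<open>The partner \<open>d\<close> is new, since the partner of a queued object is visited. It
  is queued behind \<open>b\<close>, which keeps the order that makes augmentation terminate: an
  agent's predecessor stands before the agent's own partner.\<close>

lemma bfs_visit_matched:
  assumes bfs: "bfs q MA MB i b (Suc e) vis Q qh qt found" and m: "mtch q MA MB"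
    and e: "valid q e" "vis (ag e) = 0" "MA (ag e) = Suc d"
  shows "bfs q MA MB i b (nb e) (vis(ag e := Suc b)) (Q(qt := d)) qh (Suc qt) found"
proof -
  have em: "e < m" "ob e = b" using bfsD(3)[OF bfs] by (auto simp: linked_def)
  have a: "ag e < n" "vedge q (ag e) b" using ag em e(1) by (auto simp: vedge_def)
  have d: "d < n" "MB d = Suc (ag e)" using mtchD2[OF m a(1) e(3)] by auto
  let ?vis = "vis(ag e := Suc b)" and ?Q = "Q(qt := d)"
  note qh = bfsD(1)[OF bfs]
  have same: "?Q ` {..<qh} = Q ` {..<qh}" using qh by (intro image_cong) auto
  have dnew: "Q y \<noteq> d" if "y < qt" for y using bfsD(6)[OF bfs that] d e(2) by auto
  note b = bfsD(2)[OF bfs]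
  have "bfs q MA MB i b (Suc e) ?vis ?Q qh (Suc qt) found"
  proof (rule bfsI)
    show "qh \<le> Suc qt" using qh by simp
    show "inj_on ?Q {..<Suc qt}" using bfsD(4)[OF bfs] dnew by (auto simp: lessThan_Suc inj_on_def)
    show "b \<in> insert i (?Q ` {..<qh})" unfolding same by (rule b)
    show "linked b (Suc e)" by (rule bfsD(3)[OF bfs])
  next
    fix y assume "y < Suc qt"
    then consider "y = qt" | "y < qt" by linarith
    then have "?Q y < n \<and> (\<exists>a<n. MB (?Q y) = Suc a \<and> ?vis a \<noteq> 0)"
    proof cases
      case 1
      then show ?thesis using d a by auto
    next
      case 2
      then obtain a' where "a' < n" "MB (Q y) = Suc a'" "vis a' \<noteq> 0" using bfsD(6)[OF bfs] by blast
      then show ?thesis using bfsD(5)[OF bfs 2] 2 by (intro conjI exI[of _ a']) auto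
    qed
    then show "?Q y < n" "\<exists>a<n. MB (?Q y) = Suc a \<and> ?vis a \<noteq> 0" by blast+
  next
    fix a' c assume *: "a' < n" "?vis a' = Suc c"
    show "c \<in> insert i (?Q ` {..<qh})" unfolding same
      using * b bfsD(7)[OF bfs *(1)] by (cases "a' = ag e") auto
    show "vedge q a' c" using * a bfsD(8)[OF bfs *(1)] by (cases "a' = ag e") auto
    show "MA a' = 0 \<Longrightarrow> found \<noteq> 0" using * e(3) bfsD(10)[OF bfs *(1)] by (cases "a' = ag e") auto
    fix d' assume d': "MA a' = Suc d'"
    show "\<exists>y<Suc qt. ?Q y = d' \<and> (c = i \<or> (\<exists>x<y. ?Q x = c))"
    proof (cases "a' = ag e")
      case True
      then have "c = b" "d' = d" using * d' e(3) by auto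
      moreover have "b = i \<or> (\<exists>x<qt. ?Q x = b)" 
      proof -
        have "\<exists>x<qt. ?Q x = b" if x: "x < qh" "b = Q x" for x
          using x qh by (intro exI[of _ x]) auto
        then show ?thesis using b by blast
      qed
      ultimately show ?thesis by (intro exI[of _ qt]) simp
    next
      case False
      then have "vis a' = Suc c" using *(2) by simp
      then obtain y where y: "y < qt" "Q y = d'" "c = i \<or> (\<exists>x<y. Q x = c)"
        using bfsD(9)[OF bfs *(1) _ d'] by blast
      have "c = i \<or> (\<exists>x<y. ?Q x = c)" using y(1,3) by (metis fun_upd_other less_trans nat_neq_iff)
      then show ?thesis using y(1,2) by (intro exI[of _ y]) auto
    qed
  next
    fix e' assume "valid q e'" "ob e' \<in> insert i (?Q ` {..<qh})" "\<not> (ob e' = b \<and> e' < Suc e)"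
    then show "?vis (ag e') \<noteq> 0" unfolding same using bfsD(11)[OF bfs] by simp
  next
    fix a' assume "found = Suc a'"
    then show "a' < n \<and> MA a' = 0 \<and> ?vis a' \<noteq> 0" using bfsD(12)[OF bfs] by simp
  qed
  then show ?thesis by (rule bfs_skip) simp
qed

text \<open>Without a free agent, every visited agent has a partner, which is reached and differs
  from the root. So the reached objects and visited agents are a Hall violator of the kind required
  by \<open>unreachable_below\<close>.\<close>

lemma bfs_fail:
  assumes bfs: "bfs q MA MB i b 0 vis Q qt qt 0" and m: "mtch q MA MB" and i: "i < n" "MB i = 0"
    and le: "\<And>b. b < n \<Longrightarrow> q b \<le> q' b" and g: "perfect q' g"
  shows "q i < q' i"
proof (rule unreachable_below[OF le g, where R = "insert i (Q ` {..<qt})" and V = "{a. a < n \<and> vis a \<noteq> 0}"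
      and mate = "\<lambda>a. MA a - 1"])
  show "insert i (Q ` {..<qt}) \<subseteq> {..<n}" using bfs_root_notin(2)[OF bfs i(2)] i by auto
next
  fix e assume "valid q e" "ob e \<in> insert i (Q ` {..<qt})"
  then have "vis (ag e) \<noteq> 0" using bfsD(11)[OF bfs] by simp
  then show "ag e \<in> {a. a < n \<and> vis a \<noteq> 0}" using ag \<open>valid q e\<close> by (simp add: valid_def)
next
  have mate: "\<exists>y<qt. MA a = Suc (Q y)" if a: "a < n" "vis a \<noteq> 0" for a
  proof -
    obtain c where c: "vis a = Suc c" using a(2) not0_implies_Suc by blast
    have "MA a \<noteq> 0" using bfsD(10)[OF bfs a(1) c] by blast
    then obtain d where "MA a = Suc d" using not0_implies_Suc by blast
    then show ?thesis using bfsD(9)[OF bfs a(1) c] by blast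
  qed
  show "inj_on (\<lambda>a. MA a - 1) {a. a < n \<and> vis a \<noteq> 0}"
  proof (rule inj_onI)
    fix a a' assume *: "a \<in> {a. a < n \<and> vis a \<noteq> 0}" "a' \<in> {a. a < n \<and> vis a \<noteq> 0}" "MA a - 1 = MA a' - 1"
    obtain y y' where "MA a = Suc (Q y)" "MA a' = Suc (Q y')" using mate * by blast
    then show "a = a'" using mtchD2[OF m, of a "Q y"] mtchD2[OF m, of a' "Q y'"] * by simp
  qed
  fix a assume a: "a \<in> {a. a < n \<and> vis a \<noteq> 0}"
  then obtain y where y: "y < qt" "MA a = Suc (Q y)" using mate by blast
  then show "MA a - 1 \<in> insert i (Q ` {..<qt}) - {i}" using bfs_root_notin(1)[OF bfs i(2)] by auto
  have "vedge q a (Q y)" using mtchD1[OF m, of "Q y" a] mtchD2[OF m, of a "Q y"] a y by blast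
  then show "\<exists>e. valid q e \<and> ag e = a \<and> ob e = MA a - 1" using y(2) by (auto simp: vedge_def)
qed simp_all

text \<open>
  Agent \<open>a\<close> has just lost its object, or was free, and gets the object from which it was reached.
  Since \<open>y\<close> decreases, the matching \<open>MB0\<close> is still intact on the rest of the path.
\<close>

definition aug :: "(nat \<Rightarrow> nat) \<Rightarrow> (nat \<Rightarrow> nat) \<Rightarrow> nat \<Rightarrow> (nat \<Rightarrow> nat) \<Rightarrow> (nat \<Rightarrow> nat) \<Rightarrow> nat \<Rightarrow> nat \<Rightarrow>
    (nat \<Rightarrow> nat) \<Rightarrow> (nat \<Rightarrow> nat) \<Rightarrow> bool" where
  "aug q MB0 i vis Q a y MA MB \<longleftrightarrow>
     a < n \<and> (\<exists>c. vis a = Suc c \<and> vedge q a c \<and> (c = i \<or> (\<exists>z<y. Q z = c))) \<and>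
     (\<forall>z<y. MB (Q z) = MB0 (Q z)) \<and> MB i = 0 \<and> (\<forall>b<n. MB b \<noteq> 0 \<longleftrightarrow> MB0 b \<noteq> 0) \<and>
     (\<forall>b<n. MB b \<noteq> Suc a) \<and> (\<forall>b<n. \<forall>a'. MB b = Suc a' \<longrightarrow> vedge q a' b \<and> MA a' = Suc b) \<and>
     (\<forall>a'<n. a' \<noteq> a \<longrightarrow> (\<forall>b. MA a' = Suc b \<longrightarrow> b < n \<and> MB b = Suc a'))"

lemma aug_init:
  assumes bfs: "bfs q MA MB i b 0 vis Q qt qt (Suc a)" and m: "mtch q MA MB" and i: "MB i = 0"
  shows "aug q MB i vis Q a qt MA MB"
  unfolding aug_def
proof (intro conjI)
  have a: "a < n" "MA a = 0" "vis a \<noteq> 0" using bfsD(12)[OF bfs] by auto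
  then show "a < n" by simp
  obtain c where c: "vis a = Suc c" using a(3) not0_implies_Suc by blast
  have "c \<in> insert i (Q ` {..<qt})" "vedge q a c" using bfsD(7,8)[OF bfs a(1) c] by blast+
  then show "\<exists>c. vis a = Suc c \<and> vedge q a c \<and> (c = i \<or> (\<exists>z<qt. Q z = c))" using c by blast
  show "\<forall>b<n. MB b \<noteq> Suc a" using mtchD1[OF m] a(2) by fastforce
  show "\<forall>b<n. \<forall>a'. MB b = Suc a' \<longrightarrow> vedge q a' b \<and> MA a' = Suc b" using mtchD1[OF m] by blast
  show "\<forall>a'<n. a' \<noteq> a \<longrightarrow> (\<forall>b. MA a' = Suc b \<longrightarrow> b < n \<and> MB b = Suc a')" using mtchD2[OF m] by blast
qed (use i in auto)

text \<open>Only the root can be free, because queued objects were matched and those before position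
  \<open>y\<close> are untouched. Otherwise the old partner of \<open>c\<close> is next; its entry
  in \<open>MA\<close> is stale until then, which is why \<open>aug\<close> exempts the current
  agent.\<close>

lemma aug_step:
  assumes aug: "aug q MB0 i vis Q a y MA MB"
    and bfs: "bfs q MA0 MB0 i b 0 vis Q qt qt found" and m0: "mtch q MA0 MB0" and y: "y \<le> qt"
    and c: "vis a = Suc c"
  defines "MA' \<equiv> MA(a := Suc c)" and "MB' \<equiv> MB(c := Suc a)"
  shows "MB c = 0 \<Longrightarrow> mtch q MA' MB' \<and> (\<forall>b<n. MB' b \<noteq> 0 \<longleftrightarrow> MB0 b \<noteq> 0 \<or> b = i)"
    and "MB c = Suc a' \<Longrightarrow> \<exists>z<y. aug q MB0 i vis Q a' z MA' MB'"
proof -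
  note aug' = aug[unfolded aug_def]
  have a: "a < n" using aug' by simp
  have ac: "vedge q a c" "c = i \<or> (\<exists>z<y. Q z = c)" using aug'[THEN conjunct2, THEN conjunct1] c by auto
  have intact: "MB (Q z) = MB0 (Q z)" if "z < y" for z
    using aug'[THEN conjunct2, THEN conjunct2, THEN conjunct1] that by blast
  have i: "MB i = 0" using aug' by simp
  have matched: "MB b \<noteq> 0 \<longleftrightarrow> MB0 b \<noteq> 0" if "b < n" for b
    using aug'[THEN conjunct2, THEN conjunct2, THEN conjunct2, THEN conjunct2, THEN conjunct1] that by blast
  note r = aug'[THEN conjunct2, THEN conjunct2, THEN conjunct2, THEN conjunct2, THEN conjunct2]
  have na: "MB b \<noteq> Suc a" if "b < n" for b using r[THEN conjunct1] that by blast
  have m1: "vedge q a' b \<and> MA a' = Suc b" if "b < n" "MB b = Suc a'" for b a'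
    using r[THEN conjunct2, THEN conjunct1] that by blast
  have m2: "b < n \<and> MB b = Suc a'" if "a' < n" "a' \<noteq> a" "MA a' = Suc b" for a' b
    using r[THEN conjunct2, THEN conjunct2] that by blast
  have cn: "c < n" using vedge_less[OF ac(1)] by simp
  have m1': "vedge q a' b \<and> MA' a' = Suc b" if "b < n" "MB' b = Suc a'" for b a'
    using that ac(1) m1[of b a'] na[of b] by (cases "b = c") (auto simp: MA'_def MB'_def)
  show "mtch q MA' MB' \<and> (\<forall>b<n. MB' b \<noteq> 0 \<longleftrightarrow> MB0 b \<noteq> 0 \<or> b = i)" if "MB c = 0"
  proof -
    have ci: "c = i"
    proof (rule ccontr)
      assume "c \<noteq> i"
      then obtain z where z: "z < y" "Q z = c" using ac(2) by blast
      then have "z < qt" using y by simp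
      then show False using bfsD(6)[OF bfs] intact[OF z(1)] z(2) that by fastforce
    qed
    have m2': "b < n \<and> MB' b = Suc a'" if "a' < n" "MA' a' = Suc b" for a' b
      using that cn m2[of a' b] i ci by (cases "a' = a") (auto simp: MA'_def MB'_def)
    have "mtch q MA' MB'" unfolding mtch_def using m1' m2' by blast
    moreover have "\<forall>b<n. MB' b \<noteq> 0 \<longleftrightarrow> MB0 b \<noteq> 0 \<or> b = i" using matched ci by (auto simp: MB'_def)
    ultimately show ?thesis by blast
  qed
  show "\<exists>z<y. aug q MB0 i vis Q a' z MA' MB'" if MBc: "MB c = Suc a'"
  proof -
    have ci: "c \<noteq> i" using MBc i by auto
    then obtain z where z: "z < y" "Q z = c" using ac(2) by blast
    have zq: "z < qt" using z(1) y by simp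
    have a': "a' < n" "vis a' \<noteq> 0" using bfsD(6)[OF bfs zq] intact[OF z(1)] z(2) MBc by auto
    obtain c' where c': "vis a' = Suc c'" using a'(2) not0_implies_Suc by blast
    have "MA0 a' = Suc c" using mtchD1[OF m0 cn] intact[OF z(1)] z(2) MBc by simp
    then obtain w where w: "w < qt" "Q w = c" "c' = i \<or> (\<exists>x<w. Q x = c')" and e': "vedge q a' c'"
      using bfsD(8)[OF bfs a'(1) c'] bfsD(9)[OF bfs a'(1) c'] by blast
    note inj = bfsD(4)[OF bfs]
    \<comment> \<open>The search invariant and the path name a position of \<open>c\<close> each. As
      the queue has no repetitions they agree, so the predecessor of \<open>a'\<close> stands before
      \<open>z\<close>.\<close>
    have "w = z" using inj w(1,2) z(2) zq by (auto dest: inj_onD)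
    have ne: "a' \<noteq> a" using na[OF cn] MBc by auto
    have "aug q MB0 i vis Q a' z MA' MB'" unfolding aug_def
    proof (intro conjI)
      show "\<exists>c. vis a' = Suc c \<and> vedge q a' c \<and> (c = i \<or> (\<exists>u<z. Q u = c))"
        using c' e' w(3) \<open>w = z\<close> by blast
      show "\<forall>u<z. MB' (Q u) = MB0 (Q u)"
      proof (intro allI impI)
        fix u assume u: "u < z"
        then have "Q u \<noteq> Q z" using inj zq by (fastforce dest: inj_onD)
        then show "MB' (Q u) = MB0 (Q u)" using intact[of u] u z by (simp add: MB'_def)
      qed
      show "\<forall>b<n. MB' b \<noteq> Suc a'"
      proof (intro allI impI notI)
        fix b assume b: "b < n" "MB' b = Suc a'"
        then have "b \<noteq> c" using ne by (auto simp: MB'_def)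
        then show False using b m1[of b a'] m1[OF cn MBc] by (auto simp: MB'_def)
      qed
      show "\<forall>b<n. MB' b \<noteq> 0 \<longleftrightarrow> MB0 b \<noteq> 0"
        using matched matched[OF cn] MBc by (auto simp: MB'_def)
      show "\<forall>b<n. \<forall>a'. MB' b = Suc a' \<longrightarrow> vedge q a' b \<and> MA' a' = Suc b" using m1' by blast
      show "\<forall>a''<n. a'' \<noteq> a' \<longrightarrow> (\<forall>b. MA' a'' = Suc b \<longrightarrow> b < n \<and> MB' b = Suc a'')"
      proof (intro allI impI)
        fix a'' b assume *: "a'' < n" "a'' \<noteq> a'" "MA' a'' = Suc b"
        show "b < n \<and> MB' b = Suc a''"
          using * m2[of a'' b] MBc cn by (cases "a'' = a") (auto simp: MA'_def MB'_def)
      qed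
    qed (use a' i ci in \<open>auto simp: MB'_def\<close>)
    then show ?thesis using z(1) by blast
  qed
qed

subsection \<open>Raising a level\<close>

definition blockers :: "(nat \<Rightarrow> nat) \<Rightarrow> nat \<Rightarrow> nat" where
  "blockers q e = card {x. x < m \<and> ag x = ag e \<and> blk q x e}"

definition tracks :: "(nat \<Rightarrow> nat) \<Rightarrow> (nat \<Rightarrow> nat) \<Rightarrow> bool" where
  "tracks q viol \<longleftrightarrow> (\<forall>e<m. viol e = cf e + blockers q e)"

lemma tracks_valid: "tracks q viol \<Longrightarrow> e < m \<Longrightarrow> viol e = 0 \<longleftrightarrow> valid q e"
  by (auto simp: tracks_def blockers_def valid_def)

text \<open>While the level of object \<open>b\<close> is raised, the pairs of \<open>b\<close> with edges below \<open>i\<close> are up to date.\<close>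

definition midblk :: "(nat \<Rightarrow> nat) \<Rightarrow> nat \<Rightarrow> nat \<Rightarrow> nat \<Rightarrow> nat \<Rightarrow> bool" where
  "midblk q b i x y \<longleftrightarrow>
     blk (if (ob x \<noteq> b \<longrightarrow> x < i) \<and> (ob y \<noteq> b \<longrightarrow> y < i) then q(b := Suc (q b)) else q) x y"

definition midtracks :: "(nat \<Rightarrow> nat) \<Rightarrow> nat \<Rightarrow> nat \<Rightarrow> (nat \<Rightarrow> nat) \<Rightarrow> bool" where
  "midtracks q b i viol \<longleftrightarrow> (\<forall>e<m. viol e = cf e + card {x. x < m \<and> ag x = ag e \<and> midblk q b i x e})"

lemma blk_upd_other: "ob x \<noteq> b \<Longrightarrow> ob y \<noteq> b \<Longrightarrow> blk (q(b := d)) x y \<longleftrightarrow> blk q x y"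
  by (simp add: blk_def)

lemma not_blk_self: "\<not> blk q x x"
  by (simp add: blk_def)

lemma midtracks_0: "tracks q viol \<Longrightarrow> midtracks q b 0 viol"
proof -
  \<comment> \<open>Pairs with both edges at \<open>b\<close> count as updated from the start. For
    one agent this is an edge paired with itself, which never blocks.\<close>
  have "midblk q b 0 x y \<longleftrightarrow> blk q x y" if "x < m" "y < m" "ag x = ag y" for x y
    using edge_inj[of x y] that not_blk_self by (auto simp: midblk_def)
  then have "{x. x < m \<and> ag x = ag e \<and> midblk q b 0 x e} = {x. x < m \<and> ag x = ag e \<and> blk q x e}"
    if "e < m" for e using that by blast
  then show "tracks q viol \<Longrightarrow> midtracks q b 0 viol"
    by (simp add: tracks_def midtracks_def blockers_def)
qed

lemma midtracks_m: "midtracks q b m viol \<Longrightarrow> tracks (q(b := Suc (q b))) viol"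
proof -
  have "{x. x < m \<and> ag x = ag e \<and> midblk q b m x e} =
      {x. x < m \<and> ag x = ag e \<and> blk (q(b := Suc (q b))) x e}" if "e < m" for e
    using that by (auto simp: midblk_def)
  then show "midtracks q b m viol \<Longrightarrow> tracks (q(b := Suc (q b))) viol"
    by (simp add: tracks_def midtracks_def blockers_def)
qed

lemma midblk_Suc:
  assumes "x < m" "y < m" "ag x = ag y"
    and "\<not> (x = e \<and> ob e \<noteq> b \<and> ob y = b)" "\<not> (y = e \<and> ob e \<noteq> b \<and> ob x = b)"
  shows "midblk q b (Suc e) x y \<longleftrightarrow> midblk q b e x y"
  using assms edge_inj[of x y] not_blk_self blk_upd_other[of x b y q]
  by (auto simp: midblk_def less_Suc_eq)

lemma midtracks_skip:
  assumes mid: "midtracks q b e viol" and e: "e < m" "b < n" and skip: "ob e = b \<or> eix (mn (ag e) + b) = 0"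
  shows "midtracks q b (Suc e) viol"
proof -
  have none: "ob x \<noteq> b" if "x < m" "ag x = ag e" "ob e \<noteq> b" for x
    using eix(1)[of x] that skip by auto
  have "midblk q b (Suc e) x y \<longleftrightarrow> midblk q b e x y" if "x < m" "y < m" "ag x = ag y" for x y
    using that none[of x] none[of y] by (intro midblk_Suc) auto
  then have "{x. x < m \<and> ag x = ag y \<and> midblk q b (Suc e) x y} =
      {x. x < m \<and> ag x = ag y \<and> midblk q b e x y}" if "y < m" for y using that by blast
  then show ?thesis using mid by (simp add: midtracks_def)
qed

text \<open>Agent \<open>ag e\<close> has just one edge \<open>x\<close> to \<open>b\<close>, so
  only the two ordered pairs of \<open>e\<close> and \<open>x\<close> are affected. The indicator
  \<open>s\<close> says that \<open>x\<close> starts to block \<open>e\<close>, and \<open>u\<close>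
  that \<open>e\<close> stops blocking \<open>x\<close>.\<close>

lemma midtracks_step:
  assumes mid: "midtracks q b e viol" and e: "e < m" "b < n" "ob e \<noteq> b"
    and x: "eix (mn (ag e) + b) = Suc x"
    and s: "s = of_bool (q b + vt (ag e) b (ob e) = q (ob e) + lam e + vt (ag e) (ob e) b)"
    and u: "u = of_bool (q (ob e) + vt (ag e) (ob e) b = Suc (q b + lam x + vt (ag e) b (ob e)))"
  shows "midtracks q b (Suc e) (viol(e := viol e + s, x := viol x - u))"
proof -
  have x: "x < m" "ag x = ag e" "ob x = b" using eix(2)[of "ag e" b x] x e ag by auto
  have ne: "x \<noteq> e" using x e by auto
  let ?q = "q(b := Suc (q b))"
  let ?S = "\<lambda>i y. {z. z < m \<and> ag z = ag y \<and> midblk q b i z y}"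
  have fin: "finite (?S i y)" for i y by simp
  have only: "z = x" if "z < m" "ag z = ag e" "ob z = b" for z using edge_inj[of z x] that x by auto
  have other: "?S (Suc e) y = ?S e y" if "y < m" "y \<noteq> e" "y \<noteq> x" for y
  proof -
    have "midblk q b (Suc e) z y \<longleftrightarrow> midblk q b e z y" if "z < m" "ag z = ag y" for z
      using that \<open>y < m\<close> \<open>y \<noteq> e\<close> \<open>y \<noteq> x\<close> only[of y] by (intro midblk_Suc) auto
    then show ?thesis by blast
  qed
  have atx: "?S e x - {e} = ?S (Suc e) x - {e}"
  proof -
    have "midblk q b (Suc e) z x \<longleftrightarrow> midblk q b e z x" if "z < m" "ag z = ag x" "z \<noteq> e" for z
      using that x ne by (intro midblk_Suc) auto
    then show ?thesis by blast
  qed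
  have ate: "?S e e - {x} = ?S (Suc e) e - {x}"
  proof -
    have "midblk q b (Suc e) z e \<longleftrightarrow> midblk q b e z e" if "z < m" "ag z = ag e" "z \<noteq> x" for z
      using that only[of z] e ne by (intro midblk_Suc) auto
    then show ?thesis by blast
  qed
  have mx: "midblk q b e x e \<longleftrightarrow> blk q x e" "midblk q b (Suc e) x e \<longleftrightarrow> blk ?q x e"
    "midblk q b e e x \<longleftrightarrow> blk q e x" "midblk q b (Suc e) e x \<longleftrightarrow> blk ?q e x"
    using e x by (auto simp: midblk_def)
  \<comment> \<open>A level rises by one, so a strict inequality changes its truth exactly at the
    boundary value; hence the equations in \<open>s\<close> and \<open>u\<close>.\<close>
  have b: "blk q x e \<Longrightarrow> blk ?q x e" "blk ?q x e \<and> \<not> blk q x e \<longleftrightarrow> s = 1"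
    "blk ?q e x \<Longrightarrow> blk q e x" "blk q e x \<and> \<not> blk ?q e x \<longleftrightarrow> u = 1"
    using e x by (auto simp: blk_def s u)
  have S01: "s = 0 \<or> s = 1" "u = 0 \<or> u = 1" by (auto simp: s u)
  have ce: "card (?S (Suc e) e) = card (?S e e) + s"
  proof -
    have "x \<in> ?S e e \<longleftrightarrow> blk q x e" "x \<in> ?S (Suc e) e \<longleftrightarrow> blk ?q x e" using mx x by auto
    moreover have "card (?S i e) = card (?S i e - {x}) + of_bool (x \<in> ?S i e)" for i
      using card.remove[OF fin[where i = i and y = e], of x] by auto
    ultimately show ?thesis unfolding ate[symmetric] using b(1,2) S01(1) ate by auto
  qed
  have cx: "card (?S (Suc e) x) + u = card (?S e x)"
  proof -
    have "e \<in> ?S e x \<longleftrightarrow> blk q e x" "e \<in> ?S (Suc e) x \<longleftrightarrow> blk ?q e x" using mx x e by auto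
    moreover have "card (?S i x) = card (?S i x - {e}) + of_bool (e \<in> ?S i x)" for i
      using card.remove[OF fin[where i = i and y = x], of e] by auto
    ultimately show ?thesis using b(3,4) S01(2) atx by auto
  qed
  show ?thesis unfolding midtracks_def
  proof (intro allI impI)
    fix y assume y: "y < m"
    have "viol y = cf y + card (?S e y)" using mid y by (simp add: midtracks_def)
    then show "(viol(e := viol e + s, x := viol x - u)) y = cf y + card (?S (Suc e) y)"
      using ce cx other[OF y] ne by (cases "y = x"; cases "y = e") auto
  qed
qed

end

section \<open>The program\<close>

text \<open>
  Registers: 0 answer, 1 \<open>n\<close>, 2 \<open>m\<close>, 3 number of comparisons, 4 \<open>K\<close>, 5 whether to go on, 6 an object that
  must be raised (plus 1), 7 object \<open>i\<close>, 8 current object, 9 edge or pointer, 10 agent, 13 and 14 ends of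
  the queue, 15 agent to be matched (plus 1); all others are temporary.

  Arrays: 0 \<open>hb\<close>, 1 \<open>nb\<close>, 2 \<open>vtab\<close>, 3 \<open>eix\<close>, 4 \<open>mn\<close>, 5 \<open>mn2\<close>, 6 guessed edges, 7 \<open>lam\<close>,
  8 numbers of conflicts and blockers, 9 levels, 10 prices, 11 labels, 12 pointers of the bidders,
  13 and 14 partners of agents and objects, 15 \<open>vis\<close>, 16 queue, 17 \<open>ag\<close>, 18 \<open>ob\<close>.
\<close>

abbreviation inc :: "nat \<Rightarrow> hc" where "inc x \<equiv> Asg x (Pl (Vr x) (Cn 1))"
abbreviation nop :: hc where "nop \<equiv> Asg 21 (Cn 0)"
abbreviation dif :: "ex \<Rightarrow> ex \<Rightarrow> ex" where "dif e f \<equiv> Pl (Mi e f) (Mi f e)"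
abbreviation upto :: "nat \<Rightarrow> ex \<Rightarrow> hc \<Rightarrow> hc" where
  "upto x e c \<equiv> Asg x (Cn 0) ;; Wh (Mi e (Vr x)) (c ;; inc x)"

definition auction_init :: hc where
  "auction_init = upto 7 (Vr 1) (Sto 10 (Vr 7) (Cn 0) ;; Sto 11 (Vr 7) (Cn 0) ;;
     Sto 12 (Vr 7) (Rd 0 (Vr 7)) ;; Sto 13 (Vr 7) (Cn 0) ;; Sto 14 (Vr 7) (Cn 0))"

text \<open>A sum serves as a disjunction: it is zero iff the edge is valid and the price does not
  exceed the label, so the second branch is the bid.\<close>

definition auction_step :: hc where
  "auction_step = Br (Rd 12 (Vr 8))
     (Asg 9 (Mi (Rd 12 (Vr 8)) (Cn 1)) ;; Asg 10 (Rd 17 (Vr 9)) ;; Sto 12 (Vr 8) (Rd 1 (Vr 9)) ;;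
      Br (Pl (Rd 8 (Vr 9)) (Mi (Rd 10 (Vr 10)) (Rd 11 (Vr 8))))
        nop
        (Asg 11 (Rd 13 (Vr 10)) ;; Sto 13 (Vr 10) (Pl (Vr 8) (Cn 1)) ;;
         Sto 14 (Vr 8) (Pl (Vr 10) (Cn 1)) ;; Sto 10 (Vr 10) (Pl (Rd 10 (Vr 10)) (Cn 1)) ;;
         Br (Vr 11)
           (Asg 8 (Mi (Vr 11) (Cn 1)) ;; Sto 14 (Vr 8) (Cn 0))
           (inc 7 ;; Asg 8 (Vr 7))))
     (Sto 11 (Vr 8) (Pl (Rd 11 (Vr 8)) (Cn 1)) ;; Sto 12 (Vr 8) (Rd 0 (Vr 8)) ;;
      Br (Mi (Rd 11 (Vr 8)) (Vr 4)) (inc 7 ;; Asg 8 (Vr 7)) nop)"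

definition auction :: hc where
  "auction = auction_init ;; Asg 7 (Cn 0) ;; Asg 8 (Cn 0) ;; Wh (Mi (Vr 1) (Vr 7)) auction_step"

definition search_init :: hc where
  "search_init = upto 10 (Vr 1) (Sto 15 (Vr 10) (Cn 0))"

definition search_step :: hc where
  "search_step = Br (Vr 9)
     (Asg 12 (Mi (Vr 9) (Cn 1)) ;; Asg 10 (Rd 17 (Vr 12)) ;; Asg 9 (Rd 1 (Vr 12)) ;;
      Br (Pl (Rd 8 (Vr 12)) (Rd 15 (Vr 10)))
        nop
        (Sto 15 (Vr 10) (Pl (Vr 8) (Cn 1)) ;;
         Br (Rd 13 (Vr 10))
           (Sto 16 (Vr 14) (Mi (Rd 13 (Vr 10)) (Cn 1)) ;; inc 14)
           (Asg 15 (Pl (Vr 10) (Cn 1)))))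
     (Asg 8 (Rd 16 (Vr 13)) ;; inc 13 ;; Asg 9 (Rd 0 (Vr 8)))"

definition search_path :: hc where
  "search_path = search_init ;; Asg 8 (Vr 7) ;; Asg 9 (Rd 0 (Vr 7)) ;; Asg 13 (Cn 0) ;; Asg 14 (Cn 0) ;;
     Asg 15 (Cn 0) ;; Wh (Pl (Vr 9) (Mi (Vr 14) (Vr 13))) search_step"

text \<open>Register 15 takes over the old entry of the object. In the shifted encoding this is the
  agent to continue with, or 0 at the root, which ends the loop.\<close>

definition augment :: hc where
  "augment = Wh (Vr 15) (Asg 10 (Mi (Vr 15) (Cn 1)) ;; Asg 8 (Mi (Rd 15 (Vr 10)) (Cn 1)) ;;
     Asg 15 (Rd 14 (Vr 8)) ;; Sto 14 (Vr 8) (Pl (Vr 10) (Cn 1)) ;; Sto 13 (Vr 10) (Pl (Vr 8) (Cn 1)))"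

definition match_all :: hc where
  "match_all = Asg 6 (Cn 0) ;; Asg 7 (Cn 0) ;; Wh (Mi (Vr 1) (Vr 7))
     (Br (Rd 14 (Vr 7)) (inc 7)
        (search_path ;; Br (Vr 15) (augment ;; inc 7) (Asg 6 (Pl (Vr 7) (Cn 1)) ;; Asg 7 (Vr 1))))"

text \<open>The agent's edge to the raised object is looked up in \<open>eix\<close> rather than
  searched for, so updating all counters takes only linear time in the number of edges.
  \<open>dif\<close> is zero exactly on equal values.\<close>

definition raise_step :: hc where
  "raise_step = Asg 10 (Rd 17 (Vr 9)) ;; Asg 11 (Rd 18 (Vr 9)) ;;
     Asg 12 (Rd 3 (Pl (Rd 4 (Vr 10)) (Vr 8))) ;;
     Br (Vr 12)
       (Br (dif (Vr 11) (Vr 8))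
          (Asg 12 (Mi (Vr 12) (Cn 1)) ;;
           Asg 19 (Rd 2 (Pl (Pl (Rd 5 (Vr 10)) (Rd 4 (Vr 8))) (Vr 11))) ;;
           Asg 18 (Rd 2 (Pl (Pl (Rd 5 (Vr 10)) (Rd 4 (Vr 11))) (Vr 8))) ;;
           Br (dif (Pl (Rd 9 (Vr 8)) (Vr 19)) (Pl (Pl (Rd 9 (Vr 11)) (Rd 7 (Vr 9))) (Vr 18)))
             nop (Sto 8 (Vr 9) (Pl (Rd 8 (Vr 9)) (Cn 1))) ;;
           Br (dif (Pl (Rd 9 (Vr 11)) (Vr 18)) (Pl (Pl (Pl (Rd 9 (Vr 8)) (Rd 7 (Vr 12))) (Vr 19)) (Cn 1)))
             nop (Sto 8 (Vr 12) (Mi (Rd 8 (Vr 12)) (Cn 1))))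
          nop)
       nop"

definition raise :: hc where
  "raise = Asg 8 (Mi (Vr 6) (Cn 1)) ;; upto 9 (Vr 2) raise_step ;; Sto 9 (Vr 8) (Pl (Rd 9 (Vr 8)) (Cn 1))"

text \<open>A level that reaches \<open>n\<close> ends the attempt: solutions may be assumed to have
  levels below \<open>n\<close>, and the current levels never exceed theirs.\<close>

definition solve :: hc where
  "solve = Asg 5 (Cn 1) ;; Wh (Vr 5) (auction ;; match_all ;;
     Br (Vr 6) (raise ;; Br (Mi (Vr 1) (Rd 9 (Vr 8))) nop (Asg 5 (Cn 0)))
       (Asg 0 (Cn 1) ;; Asg 5 (Cn 0)))"

text \<open>Per iteration, the test and the increment add 2 to the cost \<open>C\<close> of the
  body; the last 2 pay for initialization and the failing test.\<close>

lemma wp_upto: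
  assumes init: "J 0 (v(x := 0)) A" and x: "x \<notin> mv c" and T: "t + (C + 2) * N + 2 \<le> T"
    and N: "\<And>v' A'. same_off (insert x (mv c)) v' v \<Longrightarrow> same_off (ma c) A' A \<Longrightarrow> ev xs e v' A' = N"
    and step: "\<And>i v' A' t'. i < N \<Longrightarrow> v' x = i \<Longrightarrow> J i v' A' \<Longrightarrow> same_off (insert x (mv c)) v' v \<Longrightarrow>
        same_off (ma c) A' A \<Longrightarrow> wp xs c (\<lambda>v'' A'' u. J (Suc i) (v''(x := Suc i)) A'' \<and> u \<le> t' + C) v' A' t'"
    and exit: "\<And>v' A'. J N v' A' \<Longrightarrow> v' x = N \<Longrightarrow> same_off (insert x (mv c)) v' v \<Longrightarrow>
        same_off (ma c) A' A \<Longrightarrow> Q v' A'"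
  shows "wp xs (upto x e c) (\<lambda>v' A' t'. Q v' A' \<and> t' \<le> T) v A t"
proof -
  let ?I = "\<lambda>v' A' t'. v' x \<le> N \<and> J (v' x) v' A' \<and> t' + (C + 2) * (N - v' x) \<le> t + (C + 2) * N + 1"
  have "wp xs (Wh (Mi e (Vr x)) (c ;; inc x)) (\<lambda>v' A' t'. Q v' A' \<and> t' \<le> T) (v(x := 0)) A (Suc t)"
  proof (rule wp_Wh[where I = ?I and T = "t + (C + 2) * N + 1"])
    show "?I (v(x := 0)) A (Suc t)" using init by simp
  next
    fix v' A' t' assume I: "?I v' A' t'" and o: "same_off (mv (c ;; inc x)) v' (v(x := 0))"
      "same_off (ma (c ;; inc x)) A' A"
    have o': "same_off (insert x (mv c)) v' v" "same_off (ma c) A' A"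
      using o by (auto simp: same_off_def)
    note N' = N[OF o']
    show "wp xs (c ;; inc x) ?I v' A' (Suc t')" if "0 < ev xs (Mi e (Vr x)) v' A'"
    proof -
      have lt: "v' x < N" using that N' by simp
      have "wp xs c (wp xs (inc x) ?I) v' A' (Suc t')"
      proof (rule wp_call[OF step[OF lt refl _ o']])
        fix v'' A'' u
        assume *: "J (Suc (v' x)) (v''(x := Suc (v' x))) A'' \<and> u \<le> Suc t' + C" and "same_off (mv c) v'' v'"
        then have "v'' x = v' x" using x by (simp add: same_off_def)
        moreover have "(C + 2) * (N - v' x) = (C + 2) + (C + 2) * (N - Suc (v' x))"
          using lt by (metis Suc_diff_Suc mult_Suc_right)
        moreover have "t' + (C + 2) * (N - v' x) \<le> t + (C + 2) * N + 1" using I by blast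
        ultimately have "v'' x = v' x" "Suc u + (C + 2) * (N - Suc (v' x)) \<le> t + (C + 2) * N + 1"
          using * by linarith+
        then show "wp xs (inc x) ?I v'' A'' u" using * lt by simp
      qed (use I in blast)
      then show ?thesis by (simp only: wp_Sq)
    qed
    show "Q v' A' \<and> Suc t' \<le> T" if "ev xs (Mi e (Vr x)) v' A' = 0"
    proof -
      have "v' x = N" using that N' I by simp
      then show ?thesis using exit[OF _ _ o'] I T by auto
    qed
  qed auto
  then show ?thesis by simp
qed

context search
begin

section \<open>Correctness and cost of a round\<close>

definition static :: "env \<Rightarrow> arrs \<Rightarrow> bool" where
  "static v A \<longleftrightarrow> v 1 = n \<and> v 2 = m \<and> v 4 = K \<and> A 0 = hb \<and> A 1 = nb \<and> A 2 = vtab \<and> A 3 = eix \<and>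
     A 4 = mn \<and> A 5 = mn2 \<and> A 17 = ag \<and> A 18 = ob \<and> (\<forall>e<m. A 7 e = lam e)"

lemma staticD:
  assumes "static v A"
  shows "v (Suc 0) = n" "v 2 = m" "v 4 = K" "A 0 = hb" "A (Suc 0) = nb" "A 2 = vtab" "A 3 = eix"
    "A 4 = mn" "A 5 = mn2" "A 17 = ag" "A 18 = ob" "e < m \<Longrightarrow> A 7 e = lam e"
  using assms by (simp_all add: static_def)

lemma static_same_off:
  assumes "static v A" "same_off S v' v" "same_off T A' A" "{1, 2, 4} \<inter> S = {}"
    "{0, 1, 2, 3, 4, 5, 7, 17, 18} \<inter> T = {}"
  shows "static v' A'"
proof -
  have "v' x = v x" if "x \<in> {1, 2, 4}" for x using assms(2,4) that by (auto simp: same_off_def)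
  moreover have "A' j = A j" if "j \<in> {0, 1, 2, 3, 4, 5, 7, 17, 18}" for j
    using assms(3,5) that unfolding same_off_def by blast
  ultimately show ?thesis using assms(1) by (simp add: static_def)
qed

lemma wp_auction_init:
  assumes s: "static v A"
  shows "wp xs auction_init (\<lambda>v' A' t'. (\<forall>b<n. A' 10 b = 0 \<and> A' 11 b = 0 \<and> A' 12 b = hb b \<and>
      A' 13 b = 0 \<and> A' 14 b = 0) \<and> t' \<le> t + 7 * n + 2) v A t"
  unfolding auction_init_def
  by (rule wp_upto[where N = n and C = 5 and J = "\<lambda>i v A. \<forall>b<i. A 10 b = 0 \<and> A 11 b = 0 \<and>
        A 12 b = hb b \<and> A 13 b = 0 \<and> A 14 b = 0"])
    (use s in \<open>auto simp: static_def same_off_def less_Suc_eq\<close>)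

lemma wp_auction:
  assumes s: "static v A" and viol: "\<And>e. e < m \<Longrightarrow> A 8 e = 0 \<longleftrightarrow> valid q e"
  shows "wp xs auction (\<lambda>v' A' t'. auc q n n (A' 10) (A' 11) (A' 12) (A' 13) (A' 14) \<and>
    t' \<le> t + 7 * n + 5 + 13 * ((K + 2) * (m + n))) v A t"
proof -
  \<comment> \<open>The longest iteration, an eviction, takes 13 steps including the loop
    test.\<close>
  let ?C = "13 * ((K + 2) * (m + n))"
  have loop: "wp xs (Wh (Mi (Vr 1) (Vr 7)) auction_step) (\<lambda>v' A' t'.
      auc q n n (A' 10) (A' 11) (A' 12) (A' 13) (A' 14) \<and> t' \<le> t + 7 * n + 5 + ?C) v0 A0 t0"
    if s0: "static v0 A0" and viol0: "A0 8 = A 8" and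
      auc0: "auc q (v0 7) (v0 8) (A0 10) (A0 11) (A0 12) (A0 13) (A0 14)"
      and t0: "t0 + 13 * pot (A0 11) (A0 12) \<le> t + 7 * n + 4 + ?C" for v0 A0 t0
  proof (rule wp_Wh[where T = "t + 7 * n + 4 + ?C" and I = "\<lambda>v' A' t'.
      auc q (v' 7) (v' 8) (A' 10) (A' 11) (A' 12) (A' 13) (A' 14) \<and>
      t' + 13 * pot (A' 11) (A' 12) \<le> t + 7 * n + 4 + ?C"])
    fix v' A' t'
    assume I: "auc q (v' 7) (v' 8) (A' 10) (A' 11) (A' 12) (A' 13) (A' 14) \<and>
      t' + 13 * pot (A' 11) (A' 12) \<le> t + 7 * n + 4 + ?C"
      and o: "same_off (mv auction_step) v' v0" "same_off (ma auction_step) A' A0"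
    have s': "static v' A'" using static_same_off[OF s0 o] by (simp add: auction_step_def)
    note d = staticD[OF s']
    have viol': "A' 8 e = 0 \<longleftrightarrow> valid q e" if "e < m" for e
      using same_offD[OF o(2), of 8] viol[OF that] viol0 by (simp add: auction_step_def)
    show "wp xs auction_step (\<lambda>v' A' t'. auc q (v' 7) (v' 8) (A' 10) (A' 11) (A' 12) (A' 13) (A' 14) \<and>
      t' + 13 * pot (A' 11) (A' 12) \<le> t + 7 * n + 4 + ?C) v' A' (Suc t')"
      if "0 < ev xs (Mi (Vr 1) (Vr 7)) v' A'"
    proof -
      have auc: "auc q (v' 7) (v' 8) (A' 10) (A' 11) (A' 12) (A' 13) (A' 14)"
        and t': "t' + 13 * pot (A' 11) (A' 12) \<le> t + 7 * n + 4 + ?C" using I by auto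
      have i: "v' 7 < n" using that d by simp
      note cur = auc_cur[OF auc i]
      show ?thesis
      proof (cases "A' 12 (v' 8)")
        case 0
        note p = pot_relabel[of "v' 8" "A' 12" "A' 11", OF cur(2) 0 cur(4)]
        show ?thesis
        proof (cases "A' 11 (v' 8) < K")
          case True
          then show ?thesis using auc_relabel(1)[OF auc i 0 True] 0 p t' d
            by (simp add: auction_step_def)
        next
          case False
          then have K: "A' 11 (v' 8) = K" using cur(4) by simp
          show ?thesis using auc_relabel(2)[OF auc i 0 K] 0 p t' d K
            by (simp add: auction_step_def)
        qed
      next
        case (Suc e)
        have e: "e < m" using cur(5) Suc by (simp add: linked_def)
        note p = pot_scan[of "v' 8" "A' 12" e "A' 11", OF cur(2) Suc cur(5)]
        show ?thesis
        proof (cases "valid q e \<and> A' 10 (ag e) \<le> A' 11 (v' 8)")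
          case False
          then have "0 < A' 8 e + (A' 10 (ag e) - A' 11 (v' 8))" using viol'[OF e] by auto
          then show ?thesis using auc_skip[OF auc i Suc False] Suc p t' d
            by (auto simp: auction_step_def)
        next
          case True
          have a8: "A' 8 e = 0" using viol'[OF e] True by simp
          show ?thesis
          proof (cases "A' 13 (ag e)")
            case 0
            then show ?thesis using auc_take(1)[OF auc i Suc _ _ 0] True a8 Suc p t' d
              by (simp add: auction_step_def)
          next
            case (Suc b')
            then show ?thesis
              using auc_take(2)[OF auc i \<open>A' 12 (v' 8) = Suc e\<close> _ _ Suc] True a8
                \<open>A' 12 (v' 8) = Suc e\<close> p t' d
              by (simp add: auction_step_def)
          qed
        qed
      qed
    qed
    show "auc q n n (A' 10) (A' 11) (A' 12) (A' 13) (A' 14) \<and> Suc t' \<le> t + 7 * n + 5 + ?C"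
      if "ev xs (Mi (Vr 1) (Vr 7)) v' A' = 0"
    proof -
      have "v' 7 = n" "v' 8 = n" using I that d by (auto simp: auc_def)
      then show ?thesis using I by auto
    qed
  qed (use auc0 t0 in auto)
  show ?thesis unfolding auction_def wp_Sq wp_Asg
  proof (rule wp_call[OF wp_auction_init[OF s]])
    fix v' A' t'
    assume *: "(\<forall>b<n. A' 10 b = 0 \<and> A' 11 b = 0 \<and> A' 12 b = hb b \<and> A' 13 b = 0 \<and> A' 14 b = 0) \<and>
      t' \<le> t + 7 * n + 2"
      and o: "same_off (mv auction_init) v' v" "same_off (ma auction_init) A' A"
    have s': "static v' A'" using static_same_off[OF s o] by (simp add: auction_init_def)
    have "A' 8 = A 8" using same_offD[OF o(2), of 8] by (simp add: auction_init_def)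
    moreover have "auc q 0 0 (A' 10) (A' 11) (A' 12) (A' 13) (A' 14)" using * by (intro auc_init) auto
    moreover have "pot (A' 11) (A' 12) = pot (\<lambda>_. 0) hb" using * by (intro pot_cong) auto
    then have "13 * pot (A' 11) (A' 12) \<le> ?C" using pot_init by simp
    ultimately show "wp xs (Wh (Mi (Vr 1) (Vr 7)) auction_step) (\<lambda>v' A' t'.
      auc q n n (A' 10) (A' 11) (A' 12) (A' 13) (A' 14) \<and> t' \<le> t + 7 * n + 5 + ?C)
      (v'(7 := ev xs (Cn 0) v' A', 8 := ev xs (Cn 0) (v'(7 := ev xs (Cn 0) v' A')) A')) A' (Suc (Suc t'))"
      using s' * by (intro loop) (auto simp: static_def)
  qed
qed

end

context search
begin

lemma wp_search_init:
  assumes s: "static v A"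
  shows "wp xs search_init (\<lambda>v' A' t'. (\<forall>a<n. A' 15 a = 0) \<and> t' \<le> t + 3 * n + 2) v A t"
  unfolding search_init_def
  by (rule wp_upto[where N = n and C = 1 and J = "\<lambda>i v A. \<forall>a<i. A 15 a = 0"])
    (use s in \<open>auto simp: static_def same_off_def less_Suc_eq\<close>)

lemma wp_search_path:
  assumes s: "static v A" and viol: "\<And>e. e < m \<Longrightarrow> A 8 e = 0 \<longleftrightarrow> valid q e"
    and m: "mtch q (A 13) (A 14)" and i: "v 7 < n" "A 14 (v 7) = 0"
  shows "wp xs search_path (\<lambda>v' A' t'. (\<exists>b. bfs q (A 13) (A 14) (v 7) b 0 (A' 15) (A' 16) (v' 14) (v' 14) (v' 15)) \<and>
    t' \<le> t + 3 * n + 8 + 10 * (m + n)) v A t"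
proof -
  \<comment> \<open>The longest iteration, queueing the partner of a new agent, takes 10 steps
    including the loop test.\<close>
  let ?C = "10 * (m + n)" and ?i = "v 7"
  let ?I = "\<lambda>v' A' t'. bfs q (A 13) (A 14) ?i (v' 8) (v' 9) (A' 15) (A' 16) (v' 13) (v' 14) (v' 15) \<and>
      t' + 10 * bpot ?i (v' 8) (v' 9) (A' 16) (v' 13) \<le> t + 3 * n + 7 + ?C"
  have loop: "wp xs (Wh (Pl (Vr 9) (Mi (Vr 14) (Vr 13))) search_step) (\<lambda>v' A' t'.
      (\<exists>b. bfs q (A 13) (A 14) ?i b 0 (A' 15) (A' 16) (v' 14) (v' 14) (v' 15)) \<and>
      t' \<le> t + 3 * n + 8 + ?C) v0 A0 t0"
    if s0: "static v0 A0" and A0: "A0 8 = A 8" "A0 13 = A 13" and I0: "?I v0 A0 t0" for v0 A0 t0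
  proof (rule wp_Wh[where T = "t + 3 * n + 7 + ?C" and I = ?I])
    fix v' A' t'
    assume I: "?I v' A' t'"
      and o: "same_off (mv search_step) v' v0" "same_off (ma search_step) A' A0"
    have s': "static v' A'" using static_same_off[OF s0 o] by (simp add: search_step_def)
    note d = staticD[OF s']
    have A13: "A' 13 = A 13" using same_offD[OF o(2), of 13] A0 by (simp add: search_step_def)
    have viol': "A' 8 e = 0 \<longleftrightarrow> valid q e" if "e < m" for e
      using same_offD[OF o(2), of 8] viol[OF that] A0 by (simp add: search_step_def)
    have bfs: "bfs q (A 13) (A 14) ?i (v' 8) (v' 9) (A' 15) (A' 16) (v' 13) (v' 14) (v' 15)"
      and t': "t' + 10 * bpot ?i (v' 8) (v' 9) (A' 16) (v' 13) \<le> t + 3 * n + 7 + ?C" using I by auto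
    note lim = bfsD(1)[OF bfs]
    show "wp xs search_step ?I v' A' (Suc t')" if c: "0 < ev xs (Pl (Vr 9) (Mi (Vr 14) (Vr 13))) v' A'"
    proof (cases "v' 9")
      case 0
      then have q: "v' 13 < v' 14" using c by simp
      note bfs' = bfs[unfolded 0]
      show ?thesis using bfs_dequeue[OF bfs' i(2) q] 0 t' d by (simp add: search_step_def)
    next
      case (Suc e)
      note bfs' = bfs[unfolded Suc]
      have lnk: "linked (v' 8) (Suc e)" by (rule bfsD(3)[OF bfs'])
      then have e: "e < m" by (simp add: linked_def)
      note p = bpot_scan[OF lnk, of ?i "A' 16" "v' 13"]
      show ?thesis
      proof (cases "valid q e \<and> A' 15 (ag e) = 0")
        case False
        then have "\<not> (A' 8 e = 0 \<and> A' 15 (ag e) = 0)" using viol'[OF e] by simp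
        moreover have "bfs q (A 13) (A 14) ?i (v' 8) (nb e) (A' 15) (A' 16) (v' 13) (v' 14) (v' 15)"
          using False by (intro bfs_skip[OF bfs']) auto
        ultimately show ?thesis using Suc t' d p by (auto simp: search_step_def)
      next
        case True
        then have a8: "A' 8 e = 0" using viol'[OF e] by simp
        show ?thesis
        proof (cases "A 13 (ag e)")
          case 0
          then show ?thesis using bfs_visit_free[OF bfs' _ _ 0] True a8 Suc t' d p A13
            by (simp add: search_step_def)
        next
          case (Suc b)
          have "bpot ?i (v' 8) (nb e) ((A' 16)(v' 14 := b)) (v' 13) = bpot ?i (v' 8) (nb e) (A' 16) (v' 13)"
            using lim by (intro bpot_cong) auto
          then show ?thesis
            using bfs_visit_matched[OF bfs' m _ _ Suc] True a8 Suc \<open>v' 9 = Suc e\<close> t' d p A13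
            by (simp add: search_step_def)
        qed
      qed
    qed
    show "(\<exists>b. bfs q (A 13) (A 14) ?i b 0 (A' 15) (A' 16) (v' 14) (v' 14) (v' 15)) \<and>
        Suc t' \<le> t + 3 * n + 8 + ?C" if "ev xs (Pl (Vr 9) (Mi (Vr 14) (Vr 13))) v' A' = 0"
    proof -
      have "v' 9 = 0" "v' 13 = v' 14" using that lim by auto
      then show ?thesis using bfs t' by auto
    qed
  qed (use I0 in auto)
  have "wp xs search_init (wp xs (Asg 8 (Vr 7) ;; Asg 9 (Rd 0 (Vr 7)) ;; Asg 13 (Cn 0) ;; Asg 14 (Cn 0) ;;
     Asg 15 (Cn 0) ;; Wh (Pl (Vr 9) (Mi (Vr 14) (Vr 13))) search_step) (\<lambda>v' A' t'.
      (\<exists>b. bfs q (A 13) (A 14) ?i b 0 (A' 15) (A' 16) (v' 14) (v' 14) (v' 15)) \<and>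
      t' \<le> t + 3 * n + 8 + ?C)) v A t"
  proof (rule wp_call[OF wp_search_init[OF s]])
    fix v' A' t'
    assume *: "(\<forall>a<n. A' 15 a = 0) \<and> t' \<le> t + 3 * n + 2"
      and o: "same_off (mv search_init) v' v" "same_off (ma search_init) A' A"
    have s': "static v' A'" using static_same_off[OF s o] by (simp add: search_init_def)
    note d = staticD[OF s']
    have 7: "v' 7 = v 7" "A' 8 = A 8" "A' 13 = A 13" using same_offD[OF o(1), of 7] same_offD[OF o(2)]
      by (simp_all add: search_init_def)
    have "bfs q (A 13) (A 14) ?i ?i (hb ?i) (A' 15) (A' 16) 0 0 0" using * i by (intro bfs_init) auto
    moreover have "10 * bpot ?i ?i (hb ?i) (A' 16) 0 \<le> ?C"
      using bpot_init[OF i(1), of "A' 16"] by simp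
    ultimately show "wp xs (Asg 8 (Vr 7) ;; Asg 9 (Rd 0 (Vr 7)) ;; Asg 13 (Cn 0) ;; Asg 14 (Cn 0) ;;
     Asg 15 (Cn 0) ;; Wh (Pl (Vr 9) (Mi (Vr 14) (Vr 13))) search_step) (\<lambda>v' A' t'.
      (\<exists>b. bfs q (A 13) (A 14) ?i b 0 (A' 15) (A' 16) (v' 14) (v' 14) (v' 15)) \<and>
      t' \<le> t + 3 * n + 8 + ?C) v' A' t'"
      unfolding wp_Sq wp_Asg using * d 7 s' by (intro loop) (simp_all add: static_def)
  qed
  then show ?thesis by (simp add: search_path_def)
qed

text \<open>Each step of the path takes 6 steps of time, and the queue position, at most
  \<open>n\<close>, strictly decreases. The remaining 7 pay for the step that ends at the root and
  the failing test.\<close>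

lemma wp_augment:
  assumes s: "static v A" and bfs: "bfs q (A 13) (A 14) i b 0 (A 15) (A 16) qt qt (v 15)"
    and m: "mtch q (A 13) (A 14)" and i: "A 14 i = 0" and found: "v 15 \<noteq> 0"
  shows "wp xs augment (\<lambda>v' A' t'. mtch q (A' 13) (A' 14) \<and> (\<forall>b<n. A' 14 b \<noteq> 0 \<longleftrightarrow> A 14 b \<noteq> 0 \<or> b = i) \<and>
    t' \<le> t + 6 * n + 7) v A t"
  unfolding augment_def
proof (rule wp_Wh[where T = "t + 6 * n + 6" and I = "\<lambda>v' A' t'.
    (v' 15 = 0 \<longrightarrow> mtch q (A' 13) (A' 14) \<and> (\<forall>b<n. A' 14 b \<noteq> 0 \<longleftrightarrow> A 14 b \<noteq> 0 \<or> b = i)) \<and>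
    (\<forall>a. v' 15 = Suc a \<longrightarrow> (\<exists>y\<le>qt. aug q (A 14) i (A 15) (A 16) a y (A' 13) (A' 14) \<and>
      t' + 6 * y \<le> t + 6 * n)) \<and> t' \<le> t + 6 * n + 6"])
  let ?step = "Asg 10 (Mi (Vr 15) (Cn 1)) ;; Asg 8 (Mi (Rd 15 (Vr 10)) (Cn 1)) ;;
     Asg 15 (Rd 14 (Vr 8)) ;; Sto 14 (Vr 8) (Pl (Vr 10) (Cn 1)) ;; Sto 13 (Vr 10) (Pl (Vr 8) (Cn 1))"
  let ?I = "\<lambda>v' A' t'.
    (v' 15 = 0 \<longrightarrow> mtch q (A' 13) (A' 14) \<and> (\<forall>b<n. A' 14 b \<noteq> 0 \<longleftrightarrow> A 14 b \<noteq> 0 \<or> b = i)) \<and>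
    (\<forall>a. v' 15 = Suc a \<longrightarrow> (\<exists>y\<le>qt. aug q (A 14) i (A 15) (A 16) a y (A' 13) (A' 14) \<and>
      t' + 6 * y \<le> t + 6 * n)) \<and> t' \<le> t + 6 * n + 6"
  obtain a where a: "v 15 = Suc a" using found not0_implies_Suc by blast
  have qt: "qt \<le> n" by (rule bfs_qt_le[OF bfs])
  show "?I v A t" using a aug_init[OF bfs[unfolded a] m i] qt by auto
  fix v' A' t'
  assume I: "?I v' A' t'" and o: "same_off (mv ?step) v' v" "same_off (ma ?step) A' A"
  have A15: "A' 15 = A 15" using same_offD[OF o(2), of 15] by simp
  show "wp xs ?step ?I v' A' (Suc t')" if c: "0 < ev xs (Vr 15) v' A'"
  proof -
    obtain a where a: "v' 15 = Suc a" using c gr0_implies_Suc by auto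
    then obtain y where y: "y \<le> qt" "aug q (A 14) i (A 15) (A 16) a y (A' 13) (A' 14)"
      "t' + 6 * y \<le> t + 6 * n" using I by blast
    obtain c where c: "A 15 a = Suc c" using y(2) unfolding aug_def by blast
    show ?thesis
    proof (cases "A' 14 c")
      case 0
      then show ?thesis using aug_step(1)[OF y(2) bfs m y(1) c 0] a c A15 y(3) by simp
    next
      case (Suc a')
      then obtain z where "z < y" "aug q (A 14) i (A 15) (A 16) a' z ((A' 13)(a := Suc c)) ((A' 14)(c := Suc a))"
        using aug_step(2)[OF y(2) bfs m y(1) c Suc] by blast
      then have "z \<le> qt \<and> aug q (A 14) i (A 15) (A 16) a' z ((A' 13)(a := Suc c)) ((A' 14)(c := Suc a)) \<and>
          Suc (Suc (Suc (Suc (Suc (Suc t'))))) + 6 * z \<le> t + 6 * n" using y(1,3) by simp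
      then show ?thesis using a c A15 y(3) Suc by auto
    qed
  qed
  show "mtch q (A' 13) (A' 14) \<and> (\<forall>b<n. A' 14 b \<noteq> 0 \<longleftrightarrow> A 14 b \<noteq> 0 \<or> b = i) \<and> Suc t' \<le> t + 6 * n + 7"
    if "ev xs (Vr 15) v' A' = 0" using I that by simp
qed auto

definition search_cost :: nat where "search_cost = 10 * (m + n) + 10 * n + 30"

lemma wp_match_all:
  assumes s: "static v A" and viol: "\<And>e. e < m \<Longrightarrow> A 8 e = 0 \<longleftrightarrow> valid q e"
    and m: "mtch q (A 13) (A 14)"
    and max: "\<And>MA MB. mtch q MA MB \<Longrightarrow> cardm MB \<le> cardm (A 14) + K"
  shows "wp xs match_all (\<lambda>v' A' t'. (v' 6 = 0 \<longrightarrow> (\<exists>g. perfect q g)) \<and>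
    (\<forall>b. v' 6 = Suc b \<longrightarrow> b < n \<and> (\<forall>q' g. perfect q' g \<and> (\<forall>b<n. q b \<le> q' b) \<longrightarrow> q b < q' b)) \<and>
    t' \<le> t + 3 + 4 * n + search_cost * (K + 1)) v A t"
proof -
  let ?T = "t + 2 + 4 * n + search_cost * (K + 1)"
  let ?raise = "\<lambda>b. b < n \<and> (\<forall>q' g. perfect q' g \<and> (\<forall>b<n. q b \<le> q' b) \<longrightarrow> q b < q' b)"
  \<comment> \<open>Successful searches are paid from the gap between the matching and its maximum,
    which the auction has left at most \<open>K\<close>. One more \<open>search_cost\<close> is
    reserved for a failing search, which ends the loop.\<close>
  let ?I = "\<lambda>v' A' t'. mtch q (A' 13) (A' 14) \<and> v' 7 \<le> n \<and>
    (v' 6 = 0 \<longrightarrow> (\<forall>b<v' 7. A' 14 b \<noteq> 0)) \<and> (\<forall>b. v' 6 = Suc b \<longrightarrow> v' 7 = n \<and> ?raise b) \<and>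
    t' + 4 * (n - v' 7) + search_cost * (cardm (A 14) + K - cardm (A' 14)) +
      (if v' 6 = 0 then search_cost else 0) \<le> ?T"
  let ?step = "Br (Rd 14 (Vr 7)) (inc 7)
        (search_path ;; Br (Vr 15) (augment ;; inc 7) (Asg 6 (Pl (Vr 7) (Cn 1)) ;; Asg 7 (Vr 1)))"
  have "wp xs (Wh (Mi (Vr 1) (Vr 7)) ?step) (\<lambda>v' A' t'. (v' 6 = 0 \<longrightarrow> (\<exists>g. perfect q g)) \<and>
    (\<forall>b. v' 6 = Suc b \<longrightarrow> ?raise b) \<and> t' \<le> t + 3 + 4 * n + search_cost * (K + 1)) (v(6 := 0, 7 := 0)) A (Suc (Suc t))"
  proof (rule wp_Wh[where I = ?I and T = ?T])
    show "?I (v(6 := 0, 7 := 0)) A (Suc (Suc t))" using m by (simp add: algebra_simps)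
  next
    fix v' A' t'
    assume I: "?I v' A' t'" and o: "same_off (mv ?step) v' (v(6 := 0, 7 := 0))" "same_off (ma ?step) A' A"
    have "static (v(6 := 0, 7 := 0)) A" using s by (simp add: static_def)
    then have s': "static v' A'"
      by (rule static_same_off[OF _ o]) (simp_all add: search_path_def search_init_def search_step_def augment_def)
    note d = staticD[OF s']
    have viol': "A' 8 e = 0 \<longleftrightarrow> valid q e" if "e < m" for e
      using same_offD[OF o(2), of 8] viol[OF that]
      by (simp add: search_path_def search_init_def search_step_def augment_def)
    have m': "mtch q (A' 13) (A' 14)" and 7: "v' 7 \<le> n"
      and t': "t' + 4 * (n - v' 7) + search_cost * (cardm (A 14) + K - cardm (A' 14)) +
        (if v' 6 = 0 then search_cost else 0) \<le> ?T" using I by auto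
    show "wp xs ?step ?I v' A' (Suc t')" if c: "0 < ev xs (Mi (Vr 1) (Vr 7)) v' A'"
    proof -
      have i: "v' 7 < n" using c d by simp
      have 6: "v' 6 = 0" using I i by (cases "v' 6") auto
      have before: "\<forall>b<v' 7. A' 14 b \<noteq> 0" using I 6 by simp
      show ?thesis
      proof (cases "A' 14 (v' 7) = 0")
        case False
        then show ?thesis using i 6 before m' t' by (auto simp: less_Suc_eq)
      next
        case free: True
        have "wp xs search_path (wp xs (Br (Vr 15) (augment ;; inc 7) (Asg 6 (Pl (Vr 7) (Cn 1)) ;; Asg 7 (Vr 1))) ?I)
            v' A' (Suc (Suc t'))"
        proof (rule wp_call[OF wp_search_path[OF s' viol' m' i free]])
          fix v1 A1 t1
          assume *: "(\<exists>b. bfs q (A' 13) (A' 14) (v' 7) b 0 (A1 15) (A1 16) (v1 14) (v1 14) (v1 15)) \<and>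
              t1 \<le> Suc (Suc t') + 3 * n + 8 + 10 * (m + n)"
            and o1: "same_off (mv search_path) v1 v'" "same_off (ma search_path) A1 A'"
          obtain b where bfs: "bfs q (A' 13) (A' 14) (v' 7) b 0 (A1 15) (A1 16) (v1 14) (v1 14) (v1 15)"
            using * by blast
          have s1: "static v1 A1"
            by (rule static_same_off[OF s' o1]) (simp_all add: search_path_def search_init_def search_step_def)
          note d1 = staticD[OF s1]
          have e1: "v1 7 = v' 7" "v1 6 = v' 6" "A1 13 = A' 13" "A1 14 = A' 14"
            using same_offD[OF o1(1)] same_offD[OF o1(2)]
            by (simp_all add: search_path_def search_init_def search_step_def)
          show "wp xs (Br (Vr 15) (augment ;; inc 7) (Asg 6 (Pl (Vr 7) (Cn 1)) ;; Asg 7 (Vr 1))) ?I v1 A1 t1"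
          proof (cases "v1 15 = 0")
            case True
            have "?raise (v' 7)" using bfs_fail[OF bfs[unfolded True] m' i free] i by blast
            moreover have "Suc (Suc (Suc t1)) \<le> Suc (Suc t') + search_cost"
              using * by (simp add: search_cost_def)
            ultimately show ?thesis using True e1 d1 6 m' t' i by simp
          next
            case False
            have "wp xs augment (wp xs (inc 7) ?I) v1 A1 (Suc t1)"
            proof (rule wp_call[OF wp_augment[OF s1 _ _ _ False]])
              show "bfs q (A1 13) (A1 14) (v' 7) b 0 (A1 15) (A1 16) (v1 14) (v1 14) (v1 15)"
                using bfs e1 by simp
              show "mtch q (A1 13) (A1 14)" "A1 14 (v' 7) = 0" using m' free e1 by simp_all
              fix v2 :: env and A2 :: arrs and t2
              assume 2: "mtch q (A2 13) (A2 14) \<and> (\<forall>b<n. A2 14 b \<noteq> 0 \<longleftrightarrow> A1 14 b \<noteq> 0 \<or> b = v' 7) \<and>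
                  t2 \<le> Suc t1 + 6 * n + 7"
                and o2: "same_off (mv augment) v2 v1"
              have e2: "v2 7 = v' 7" "v2 6 = 0" using same_offD[OF o2] e1 6 by (simp_all add: augment_def)
              have "{b. b < n \<and> A2 14 b \<noteq> 0} = insert (v' 7) {b. b < n \<and> A' 14 b \<noteq> 0}"
                using 2 e1 i by auto
              then have card: "cardm (A2 14) = Suc (cardm (A' 14))" using free by (simp add: cardm_def)
              moreover have "cardm (A2 14) \<le> cardm (A 14) + K" using max 2 by blast
              ultimately have "search_cost * (cardm (A 14) + K - cardm (A' 14)) =
                  search_cost + search_cost * (cardm (A 14) + K - cardm (A2 14))"
                by (metis Suc_diff_le diff_Suc_Suc mult_Suc_right)
              moreover have "Suc t2 \<le> Suc (Suc t') + search_cost" using 2 * by (simp add: search_cost_def)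
              moreover have "\<forall>b<Suc (v' 7). A2 14 b \<noteq> 0" using before 2 e1 i by (auto simp: less_Suc_eq)
              ultimately show "wp xs (inc 7) ?I v2 A2 t2" using e2 2 t' i 6 by auto
            qed
            then show ?thesis using False by simp
          qed
        qed
        then show ?thesis using free by simp
      qed
    qed
    show "(v' 6 = 0 \<longrightarrow> (\<exists>g. perfect q g)) \<and> (\<forall>b. v' 6 = Suc b \<longrightarrow> ?raise b) \<and>
        Suc t' \<le> t + 3 + 4 * n + search_cost * (K + 1)" if "ev xs (Mi (Vr 1) (Vr 7)) v' A' = 0"
    proof (intro conjI)
      have "v' 7 = n" using that 7 d by simp
      then show "v' 6 = 0 \<longrightarrow> (\<exists>g. perfect q g)" using perfect_if_all_matched[OF m'] I by blast
    qed (use I in auto)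
  qed auto
  then show ?thesis by (simp add: match_all_def)
qed

lemma wp_raise:
  assumes s: "static v A" and viol: "tracks (A 9) (A 8)" and b: "v 6 = Suc b" "b < n"
  shows "wp xs raise (\<lambda>v' A' t'. A' 9 = (A 9)(b := Suc (A 9 b)) \<and> tracks (A' 9) (A' 8) \<and> v' 8 = b \<and>
    t' \<le> t + 14 * m + 4) v A t"
proof -
  have "wp xs (upto 9 (Vr 2) raise_step) (\<lambda>v' A' t'. (A' 9 = A 9 \<and> v' 8 = b \<and> midtracks (A 9) b m (A' 8)) \<and>
      t' \<le> t + 14 * m + 3) (v(8 := b)) A (Suc t)"
  proof (rule wp_upto[where N = m and C = 12 and J = "\<lambda>i v A'. midtracks (A 9) b i (A' 8)"])
    fix v' A' assume o: "same_off (insert 9 (mv raise_step)) v' (v(8 := b))" "same_off (ma raise_step) A' A"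
    have "static (v(8 := b)) A" using s by (simp add: static_def)
    then have s': "static v' A'" by (rule static_same_off[OF _ o]) (simp_all add: raise_step_def)
    note d = staticD[OF s']
    have 8: "v' 8 = b" "A' 9 = A 9" using same_offD[OF o(1), of 8] same_offD[OF o(2), of 9]
      by (simp_all add: raise_step_def)
    show "ev xs (Vr 2) v' A' = m" using d by simp
    show "A' 9 = A 9 \<and> v' 8 = b \<and> midtracks (A 9) b m (A' 8)" if "midtracks (A 9) b m (A' 8)" using that 8 by simp
    show "wp xs raise_step (\<lambda>v'' A'' u. midtracks (A 9) b (Suc i) (A'' 8) \<and> u \<le> t' + 12) v' A' t'"
      if e: "i < m" and vi: "v' 9 = i" and mid: "midtracks (A 9) b i (A' 8)" for i t'
    proof -
      have l: "A' 7 i = lam i" using d(12) e .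
      have an: "ag i < n" "ob i < n" using ag ob e by auto
      have V: "vtab (mn2 (ag i) + mn b + ob i) = vt (ag i) b (ob i)"
        "vtab (mn2 (ag i) + mn (ob i) + b) = vt (ag i) (ob i) b"
        using vtab an b(2) by auto
      show ?thesis
      proof (cases "ob i = b \<or> eix (mn (ag i) + b) = 0")
        case True
        then show ?thesis using midtracks_skip[OF mid e b(2) True] d(1-11) 8 e vi
          by (auto simp: raise_step_def)
      next
        case False
        then obtain x where x: "eix (mn (ag i) + b) = Suc x" using not0_implies_Suc by blast
        have ob: "ob i \<noteq> b" using False by simp
        have xm: "x < m" "x \<noteq> i" using eix(2)[OF an(1) b(2) x] ob by auto
        have lx: "A' 7 x = lam x" using d(12) xm(1) .
        let ?e = "i"
        obtain l1 r1 l2 r2 where gen: "A 9 b + vt (ag ?e) b (ob ?e) = l1"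
          "A 9 (ob ?e) + lam ?e + vt (ag ?e) (ob ?e) b = r1" "A 9 (ob ?e) + vt (ag ?e) (ob ?e) b = l2"
          "A 9 b + lam x + vt (ag ?e) b (ob ?e) = r2" by blast
        note m = midtracks_step[OF mid e b(2) ob x refl refl, unfolded gen]
        have "midtracks (A 9) b (Suc ?e) (if l1 = r1
            then (if l2 = Suc r2 then (A' 8)(?e := Suc (A' 8 ?e), x := A' 8 x - Suc 0) else (A' 8)(?e := Suc (A' 8 ?e)))
            else (if l2 = Suc r2 then (A' 8)(x := A' 8 x - Suc 0) else A' 8))"
          using m xm(2) by (auto simp: fun_upd_idem)
        then show ?thesis using x ob l lx xm d(1-11) 8 e vi V gen
          by (simp add: raise_step_def) (auto split: if_splits)
      qed
    qed
  qed (use midtracks_0[OF viol] in \<open>simp_all add: raise_step_def\<close>)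
  then have "wp xs (upto 9 (Vr 2) raise_step) (wp xs (Sto 9 (Vr 8) (Pl (Rd 9 (Vr 8)) (Cn 1)))
      (\<lambda>v' A' t'. A' 9 = (A 9)(b := Suc (A 9 b)) \<and> tracks (A' 9) (A' 8) \<and> v' 8 = b \<and>
        t' \<le> t + 14 * m + 4)) (v(8 := b)) A (Suc t)"
    by (rule wp_call) (use midtracks_m in auto)
  then show ?thesis unfolding raise_def using b(1) by simp
qed

definition round_cost :: nat where
  "round_cost = 13 * ((K + 2) * (m + n)) + search_cost * (K + 1) + 14 * m + 11 * n + 20"

lemma wp_solve:
  assumes s: "static v A" and viol: "tracks (A 9) (A 8)" and 0: "\<And>b. b < n \<Longrightarrow> A 9 b = 0"
  shows "wp xs solve (\<lambda>v' A' t'. v' 0 = (if \<exists>q g. perfect q g \<and> (\<forall>b<n. q b < n) then 1 else v 0) \<and>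
    t' \<le> t + 2 + round_cost * (n * n + 1)) v A t"
proof -
  define goal where "goal = (if \<exists>q g. perfect q g \<and> (\<forall>b<n. q b < n) then 1 else v 0)"
  let ?T = "t + 1 + round_cost * (n * n + 1)"
  \<comment> \<open>The sum of the distances of the levels to \<open>n\<close> starts at
    \<open>n * n\<close> and pays for the rounds that raise a level and go on. The extra
    \<open>round_cost\<close> is for the final round.\<close>
  let ?I = "\<lambda>v' A' t'. (v' 5 \<noteq> 0 \<longrightarrow> tracks (A' 9) (A' 8) \<and> (\<forall>b<n. A' 9 b < n) \<and> v' 0 = v 0 \<and>
      (\<forall>q g. perfect q g \<and> (\<forall>b<n. q b < n) \<longrightarrow> (\<forall>b<n. A' 9 b \<le> q b)) \<and>
      t' + round_cost * (\<Sum>b<n. n - A' 9 b) + round_cost \<le> ?T) \<and> (v' 5 = 0 \<longrightarrow> v' 0 = goal) \<and> t' \<le> ?T"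
  let ?tail = "Br (Vr 6) (raise ;; Br (Mi (Vr 1) (Rd 9 (Vr 8))) nop (Asg 5 (Cn 0)))
       (Asg 0 (Cn 1) ;; Asg 5 (Cn 0))"
  let ?step = "auction ;; match_all ;; ?tail"
  note defs = auction_def auction_init_def auction_step_def match_all_def search_path_def search_init_def
    search_step_def augment_def raise_def raise_step_def
  have "wp xs (Wh (Vr 5) ?step) (\<lambda>v' A' t'. v' 0 = goal \<and> t' \<le> ?T + 1) (v(5 := 1)) A (Suc t)"
  proof (rule wp_Wh[where I = ?I and T = ?T])
    have "(\<Sum>b<n. n - A 9 b) = n * n" using 0 by simp
    then show "?I (v(5 := 1)) A (Suc t)" using viol 0 n by (simp add: algebra_simps)
  next
    fix v' A' t'
    assume I: "?I v' A' t'" and o: "same_off (mv ?step) v' (v(5 := 1))" "same_off (ma ?step) A' A"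
    have "static (v(5 := 1)) A" using s by (simp add: static_def)
    then have s': "static v' A'" by (rule static_same_off[OF _ o]) (simp_all add: defs)
    show "wp xs ?step ?I v' A' (Suc t')" if "0 < ev xs (Vr 5) v' A'"
    proof -
      have 5: "v' 5 \<noteq> 0" using that by simp
      have tr: "tracks (A' 9) (A' 8)" and lt: "\<And>b. b < n \<Longrightarrow> A' 9 b < n" and v0: "v' 0 = v 0"
        and below: "\<And>q g b. perfect q g \<Longrightarrow> (\<And>b. b < n \<Longrightarrow> q b < n) \<Longrightarrow> b < n \<Longrightarrow> A' 9 b \<le> q b"
        and t': "t' + round_cost * (\<Sum>b<n. n - A' 9 b) + round_cost \<le> ?T"
        using I 5 by blast+
      have "wp xs auction (wp xs match_all (wp xs ?tail ?I)) v' A' (Suc t')"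
      proof (rule wp_call[OF wp_auction[OF s' tracks_valid[OF tr]]])
        fix v1 A1 t1
        assume 1: "auc (A' 9) n n (A1 10) (A1 11) (A1 12) (A1 13) (A1 14) \<and>
            t1 \<le> Suc t' + 7 * n + 5 + 13 * ((K + 2) * (m + n))"
          and o1: "same_off (mv auction) v1 v'" "same_off (ma auction) A1 A'"
        have s1: "static v1 A1" by (rule static_same_off[OF s' o1]) (simp_all add: defs)
        have e1: "A1 8 = A' 8" "A1 9 = A' 9" "v1 0 = v' 0" "v1 5 = v' 5"
          using same_offD[OF o1(1)] same_offD[OF o1(2)] by (simp_all add: defs)
        have m1: "mtch (A' 9) (A1 13) (A1 14)" using 1 by (simp add: auc_def)
        have max: "cardm MB \<le> cardm (A1 14) + K" if "mtch (A' 9) MA MB" for MA MB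
          using auc_final 1 that by blast
        have viol1: "A1 8 e = 0 \<longleftrightarrow> valid (A' 9) e" if "e < m" for e using tracks_valid[OF tr that] e1 by simp
        show "wp xs match_all (wp xs ?tail ?I) v1 A1 t1"
        proof (rule wp_call[OF wp_match_all[OF s1 viol1 m1 max]])
          fix v2 A2 t2
          assume 2: "(v2 6 = 0 \<longrightarrow> (\<exists>g. perfect (A' 9) g)) \<and>
            (\<forall>b. v2 6 = Suc b \<longrightarrow> b < n \<and>
              (\<forall>q' g. perfect q' g \<and> (\<forall>b<n. A' 9 b \<le> q' b) \<longrightarrow> A' 9 b < q' b)) \<and>
            t2 \<le> t1 + 3 + 4 * n + search_cost * (K + 1)"
            and o2: "same_off (mv match_all) v2 v1" "same_off (ma match_all) A2 A1"
          have s2: "static v2 A2" by (rule static_same_off[OF s1 o2]) (simp_all add: defs)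
          have e2: "A2 8 = A' 8" "A2 9 = A' 9" "v2 0 = v 0" "v2 5 = v' 5"
            using same_offD[OF o2(1)] same_offD[OF o2(2)] e1 v0 by (simp_all add: defs)
          have t2: "t2 + 14 * m + 11 \<le> t' + round_cost" using 1 2 by (simp add: round_cost_def)
          show "wp xs ?tail ?I v2 A2 t2"
          proof (cases "v2 6")
            case 0
            then obtain g where "perfect (A' 9) g" using 2 by blast
            then have "goal = 1" using lt unfolding goal_def by auto
            then show ?thesis using 0 t2 t' by simp
          next
            case (Suc b)
            then have b: "b < n" and raise: "\<And>q' g. perfect q' g \<Longrightarrow> (\<forall>b<n. A' 9 b \<le> q' b) \<Longrightarrow> A' 9 b < q' b"
              using 2 by blast+
            have tr2: "tracks (A2 9) (A2 8)" using tr e2 by simp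
            have "wp xs raise (wp xs (Br (Mi (Vr 1) (Rd 9 (Vr 8))) nop (Asg 5 (Cn 0))) ?I) v2 A2 (Suc t2)"
            proof (rule wp_call[OF wp_raise[OF s2 tr2 Suc b]])
              fix v3 A3 t3
              assume 3: "A3 9 = (A2 9)(b := Suc (A2 9 b)) \<and> tracks (A3 9) (A3 8) \<and> v3 8 = b \<and>
                  t3 \<le> Suc t2 + 14 * m + 4"
                and o3: "same_off (mv raise) v3 v2" "same_off (ma raise) A3 A2"
              have s3: "static v3 A3" by (rule static_same_off[OF s2 o3]) (simp_all add: defs)
              note d3 = staticD[OF s3]
              have e3: "A3 9 = (A' 9)(b := Suc (A' 9 b))" "v3 0 = v 0" "v3 5 = v' 5"
                using same_offD[OF o3(1)] 3 e2 by (simp_all add: defs)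
              have tr3: "tracks (A3 9) (A3 8)" and v8: "v3 8 = b" using 3 by blast+
              have le: "A3 9 c \<le> q c" if "perfect q g" "\<And>b. b < n \<Longrightarrow> q b < n" "c < n" for q g c
                using raise[OF that(1)] below[OF that(1,2)] that(3) unfolding e3(1) by (simp add: Suc_le_eq)
              have t3: "t3 + 5 \<le> t' + round_cost" using 3 t2 by linarith
              show "wp xs (Br (Mi (Vr 1) (Rd 9 (Vr 8))) nop (Asg 5 (Cn 0))) ?I v3 A3 t3"
              proof (cases "Suc (A' 9 b) < n")
                case True
                have "(\<Sum>c<n. n - A3 9 c) < (\<Sum>c<n. n - A' 9 c)"
                  unfolding e3(1) using b True by (intro sum_strict_mono_ex1) auto
                then have "Suc (\<Sum>c<n. n - A3 9 c) \<le> (\<Sum>c<n. n - A' 9 c)" by simp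
                then have "round_cost * Suc (\<Sum>c<n. n - A3 9 c) \<le> round_cost * (\<Sum>c<n. n - A' 9 c)"
                  by (rule mult_le_mono2)
                then have T: "t3 + 5 + round_cost * (\<Sum>c<n. n - A3 9 c) + round_cost \<le> ?T"
                  using t' t3 by simp
                have "\<forall>c<n. A3 9 c < n" using lt True unfolding e3(1) by simp
                moreover have "0 < n - A3 9 b" using True unfolding e3(1) by simp
                moreover have "\<forall>q g. perfect q g \<and> (\<forall>b<n. q b < n) \<longrightarrow> (\<forall>b<n. A3 9 b \<le> q b)"
                  using le by blast
                ultimately show ?thesis using tr3 v8 d3(1-11) e3(2,3) 5 T by simp
              next
                case False
                \<comment> \<open>The raised level is still a lower bound for every solution, yet it
                  is no longer below \<open>n\<close>.\<close>
                have "\<not> (\<exists>q g. perfect q g \<and> (\<forall>b<n. q b < n))"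
                proof
                  assume "\<exists>q g. perfect q g \<and> (\<forall>b<n. q b < n)"
                  then obtain q g where q: "perfect q g" "\<And>b. b < n \<Longrightarrow> q b < n" by blast
                  have "Suc (A' 9 b) \<le> q b" using le[OF q b] unfolding e3(1) by simp
                  then show False using q(2)[OF b] False by simp
                qed
                then have goal: "goal = v 0" unfolding goal_def by (rule if_not_P)
                have "n - A3 9 b = 0" using False unfolding e3(1) by simp
                then show ?thesis using v8 d3(1-11) e3(2,3) goal t3 t' by simp
              qed
            qed
            then show ?thesis using Suc by simp
          qed
        qed
      qed
      then show ?thesis by (simp only: wp_Sq)
    qed
    show "v' 0 = goal \<and> Suc t' \<le> ?T + 1" if "ev xs (Vr 5) v' A' = 0" using I that by simp
  qed auto
  then show ?thesis by (simp add: solve_def goal_def)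
qed

end

section \<open>All guesses\<close>

definition init_levels :: hc where
  "init_levels = upto 7 (Vr 1) (Sto 9 (Vr 7) (Cn 0))"

definition clear_load :: hc where
  "clear_load = upto 9 (Vr 2) (Sto 7 (Vr 9) (Cn 0))"

definition count_load :: "nat \<Rightarrow> hc" where
  "count_load k = upto 17 (Cn k) (Sto 7 (Rd 6 (Vr 17)) (Pl (Rd 7 (Rd 6 (Vr 17))) (Cn 1)))"

definition count_conflicts :: "nat \<Rightarrow> hc" where
  "count_conflicts k = upto 17 (Cn k) (Asg 12 (Rd 6 (Vr 17)) ;;
     Br (dif (Rd 17 (Vr 12)) (Vr 10)) nop (Br (dif (Vr 12) (Vr 9)) (inc 16) nop))"

definition count_blockers :: hc where
  "count_blockers = upto 12 (Vr 2) (Br (dif (Rd 17 (Vr 12)) (Vr 10)) nop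
     (Asg 18 (Rd 18 (Vr 12)) ;;
      Asg 19 (Rd 2 (Pl (Pl (Rd 5 (Vr 10)) (Rd 4 (Vr 18))) (Vr 11))) ;;
      Asg 20 (Rd 2 (Pl (Pl (Rd 5 (Vr 10)) (Rd 4 (Vr 11))) (Vr 18))) ;;
      Br (Mi (Vr 19) (Pl (Rd 7 (Vr 9)) (Vr 20))) (inc 16) nop))"

text \<open>Counting from scratch takes time \<open>O(m + k)\<close> per edge. This is affordable
  once per guess, because \<open>m\<close> is at most \<open>n * n\<close>.\<close>

definition init_viol :: "nat \<Rightarrow> hc" where
  "init_viol k = upto 9 (Vr 2) (Asg 16 (Cn 0) ;; Asg 10 (Rd 17 (Vr 9)) ;; Asg 11 (Rd 18 (Vr 9)) ;;
     count_conflicts k ;; count_blockers ;; Sto 8 (Vr 9) (Vr 16))"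

definition try_guess :: "nat \<Rightarrow> hc" where
  "try_guess k = init_levels ;; clear_load ;; count_load k ;; init_viol k ;; solve"

text \<open>The recursion unfolds to \<open>k\<close> nested loops when the program is constructed,
  so the program depends on \<open>k\<close> only.\<close>

primrec guesses :: "nat \<Rightarrow> nat \<Rightarrow> hc" where
  "guesses k 0 = try_guess k"
| "guesses k (Suc d) = Sto 6 (Cn d) (Cn 0) ;;
     Wh (Mi (Vr 2) (Rd 6 (Cn d))) (guesses k d ;; Sto 6 (Cn d) (Pl (Rd 6 (Cn d)) (Cn 1)))"

lemma load_Suc: "load (Suc k) G e = load k G e + of_bool (G k = e)"
proof -
  have "{j. j < Suc k \<and> G j = e} = (if G k = e then insert k {j. j < k \<and> G j = e} else {j. j < k \<and> G j = e})"
    by (auto simp: less_Suc_eq)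
  then show ?thesis by (simp add: load_def)
qed

lemma conflict_Suc: "conflict ag (Suc k) G e = conflict ag k G e + of_bool (ag (G k) = ag e \<and> G k \<noteq> e)"
proof -
  have "{j. j < Suc k \<and> ag (G j) = ag e \<and> G j \<noteq> e} = (if ag (G k) = ag e \<and> G k \<noteq> e
      then insert k {j. j < k \<and> ag (G j) = ag e \<and> G j \<noteq> e} else {j. j < k \<and> ag (G j) = ag e \<and> G j \<noteq> e})"
    by (auto simp: less_Suc_eq)
  then show ?thesis by (simp add: conflict_def)
qed

lemma load_cong: "(\<And>j. j < k \<Longrightarrow> G j = G' j) \<Longrightarrow> load k G = load k G'"
  by (auto simp: load_def fun_eq_iff intro!: arg_cong[where f = card])

lemma conflict_cong: "(\<And>j. j < k \<Longrightarrow> G j = G' j) \<Longrightarrow> conflict ag k G = conflict ag k G'"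
  by (auto simp: conflict_def fun_eq_iff intro!: arg_cong[where f = card])

definition guess_cost :: "nat \<Rightarrow> nat \<Rightarrow> nat \<Rightarrow> nat \<Rightarrow> nat" where
  "guess_cost n m K k = 3 * n + 3 * m + 3 * k + (8 * m + 6 * k + 10) * m +
     (13 * ((K + 2) * (m + n)) + (10 * (m + n) + 10 * n + 30) * (K + 1) + 14 * m + 11 * n + 20) * (n * n + 1) + 10"

context tables
begin

definition tabled :: "env \<Rightarrow> arrs \<Rightarrow> bool" where
  "tabled v A \<longleftrightarrow> v 1 = n \<and> v 2 = m \<and> v 4 = K \<and> A 0 = hb \<and> A 1 = nb \<and> A 2 = vtab \<and> A 3 = eix \<and>
     A 4 = mn \<and> A 5 = mn2 \<and> A 17 = ag \<and> A 18 = ob"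

lemma tabledD:
  assumes "tabled v A"
  shows "v (Suc 0) = n" "v 2 = m" "v 4 = K" "A 0 = hb" "A (Suc 0) = nb" "A 2 = vtab" "A 3 = eix"
    "A 4 = mn" "A 5 = mn2" "A 17 = ag" "A 18 = ob"
  using assms by (simp_all add: tabled_def)

lemma tabled_same_off:
  assumes "tabled v A" "same_off S v' v" "same_off T A' A" "{1, 2, 4} \<inter> S = {}"
    "{0, 1, 2, 3, 4, 5, 17, 18} \<inter> T = {}"
  shows "tabled v' A'"
proof -
  have "v' x = v x" if "x \<in> {1, 2, 4}" for x using assms(2,4) that by (auto simp: same_off_def)
  moreover have "A' j = A j" if "j \<in> {0, 1, 2, 3, 4, 5, 17, 18}" for j
    using assms(3,5) that unfolding same_off_def by blast
  ultimately show ?thesis using assms(1) by (simp add: tabled_def)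
qed

lemma wp_init_levels:
  assumes s: "tabled v A"
  shows "wp xs init_levels (\<lambda>v' A' t'. (\<forall>b<n. A' 9 b = 0) \<and> t' \<le> t + 3 * n + 2) v A t"
  unfolding init_levels_def
  by (rule wp_upto[where N = n and C = 1 and J = "\<lambda>i v A. \<forall>b<i. A 9 b = 0"])
    (use s in \<open>auto simp: tabled_def same_off_def less_Suc_eq\<close>)

lemma wp_clear_load:
  assumes s: "tabled v A"
  shows "wp xs clear_load (\<lambda>v' A' t'. (\<forall>e<m. A' 7 e = 0) \<and> t' \<le> t + 3 * m + 2) v A t"
  unfolding clear_load_def
  by (rule wp_upto[where N = m and C = 1 and J = "\<lambda>i v A. \<forall>e<i. A 7 e = 0"])
    (use s in \<open>auto simp: tabled_def same_off_def less_Suc_eq\<close>)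

lemma wp_count_load:
  assumes 0: "\<And>e. e < m \<Longrightarrow> A 7 e = 0"
  shows "wp xs (count_load k) (\<lambda>v' A' t'. (\<forall>e<m. A' 7 e = load k (A 6) e) \<and> t' \<le> t + 3 * k + 2) v A t"
  unfolding count_load_def
  by (rule wp_upto[where N = k and C = 1 and J = "\<lambda>i v A'. \<forall>e<m. A' 7 e = load i (A 6) e"])
    (use 0 in \<open>auto simp: load_def[of 0] load_Suc same_off_def\<close>)

lemma wp_count_conflicts:
  assumes s: "tabled v A" and e: "v 9 = e" "v 10 = ag e" "v 16 = 0"
  shows "wp xs (count_conflicts k) (\<lambda>v' A' t'. v' 16 = conflict ag k (A 6) e \<and> t' \<le> t + 6 * k + 2) v A t"
  unfolding count_conflicts_def
proof (rule wp_upto[where N = k and C = 4 and J = "\<lambda>i v A'. v 16 = conflict ag i (A 6) e"])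
  let ?c = "Asg 12 (Rd 6 (Vr 17)) ;;
     Br (dif (Rd 17 (Vr 12)) (Vr 10)) nop (Br (dif (Vr 12) (Vr 9)) (inc 16) nop)"
  fix v' A' i t'
  assume i: "v' 17 = i" "v' 16 = conflict ag i (A 6) e"
    and o: "same_off (insert 17 (mv ?c)) v' v" "same_off (ma ?c) A' A"
  have "tabled v' A'" by (rule tabled_same_off[OF s o]) simp_all
  note d = tabledD[OF this]
  have "A' 6 = A 6" "v' 9 = e" "v' 10 = ag e" using same_offD[OF o(1)] same_offD[OF o(2)] e by simp_all
  then show "wp xs ?c (\<lambda>v'' A'' u. (v''(17 := Suc i)) 16 = conflict ag (Suc i) (A 6) e \<and> u \<le> t' + 4) v' A' t'"
    using i d by (auto simp: conflict_Suc)
qed (use e in \<open>simp_all add: conflict_def\<close>)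

text \<open>This is \<open>blk\<close> for levels that are all 0.\<close>

definition conflicted :: "nat \<Rightarrow> (nat \<Rightarrow> nat) \<Rightarrow> nat \<Rightarrow> nat \<Rightarrow> bool" where
  "conflicted k G x e \<longleftrightarrow> load k G e + vt (ag e) (ob e) (ob x) < vt (ag e) (ob x) (ob e)"

lemma wp_count_blockers:
  assumes s: "tabled v A" and e: "v 9 = e" "v 10 = ag e" "v 11 = ob e" "e < m"
    and l: "A 7 e = load k G e"
  shows "wp xs count_blockers (\<lambda>v' A' t'. v' 16 = v 16 + card {x. x < m \<and> ag x = ag e \<and> conflicted k G x e} \<and>
    t' \<le> t + 8 * m + 2) v A t"
  unfolding count_blockers_def
proof (rule wp_upto[where N = m and C = 6 and
      J = "\<lambda>i v' A'. v' 16 = v 16 + card {x. x < i \<and> ag x = ag e \<and> conflicted k G x e}"])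
  let ?c = "Br (dif (Rd 17 (Vr 12)) (Vr 10)) nop
     (Asg 18 (Rd 18 (Vr 12)) ;;
      Asg 19 (Rd 2 (Pl (Pl (Rd 5 (Vr 10)) (Rd 4 (Vr 18))) (Vr 11))) ;;
      Asg 20 (Rd 2 (Pl (Pl (Rd 5 (Vr 10)) (Rd 4 (Vr 11))) (Vr 18))) ;;
      Br (Mi (Vr 19) (Pl (Rd 7 (Vr 9)) (Vr 20))) (inc 16) nop)"
  fix v' A' x t'
  assume x: "x < m" "v' 12 = x" and J: "v' 16 = v 16 + card {y. y < x \<and> ag y = ag e \<and> conflicted k G y e}"
    and o: "same_off (insert 12 (mv ?c)) v' v" "same_off (ma ?c) A' A"
  have "tabled v' A'" by (rule tabled_same_off[OF s o]) simp_all
  note d = tabledD[OF this]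
  have same: "A' 7 e = load k G e" "v' 9 = e" "v' 10 = ag e" "v' 11 = ob e"
    using same_offD[OF o(1)] same_offD[OF o(2)] e l by simp_all
  have V: "vtab (mn2 (ag e) + mn (ob x) + ob e) = vt (ag e) (ob x) (ob e)"
    "vtab (mn2 (ag e) + mn (ob e) + ob x) = vt (ag e) (ob e) (ob x)"
    using vtab ag ob e(4) x by auto
  have S: "{y. y < Suc x \<and> ag y = ag e \<and> conflicted k G y e} = (if ag x = ag e \<and> conflicted k G x e
      then insert x {y. y < x \<and> ag y = ag e \<and> conflicted k G y e}
      else {y. y < x \<and> ag y = ag e \<and> conflicted k G y e})" by (auto simp: less_Suc_eq)
  show "wp xs ?c (\<lambda>v'' A'' u. (v''(12 := Suc x)) 16 = v 16 + card {y. y < Suc x \<and> ag y = ag e \<and>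
      conflicted k G y e} \<and> u \<le> t' + 6) v' A' t'"
  proof (cases "ag x = ag e")
    case False
    then show ?thesis using J same d x S by simp
  next
    case True
    have "conflicted k G x e \<longleftrightarrow> load k G e + vt (ag e) (ob e) (ob x) < vt (ag e) (ob x) (ob e)"
      by (simp add: conflicted_def)
    then show ?thesis using J same d x S V True by simp
  qed
next
  fix v' A' assume "same_off (insert 12 (mv (Br (dif (Rd 17 (Vr 12)) (Vr 10)) nop
     (Asg 18 (Rd 18 (Vr 12)) ;;
      Asg 19 (Rd 2 (Pl (Pl (Rd 5 (Vr 10)) (Rd 4 (Vr 18))) (Vr 11))) ;;
      Asg 20 (Rd 2 (Pl (Pl (Rd 5 (Vr 10)) (Rd 4 (Vr 11))) (Vr 18))) ;;
      Br (Mi (Vr 19) (Pl (Rd 7 (Vr 9)) (Vr 20))) (inc 16) nop)))) v' v"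
  from same_offD[OF this, of 2] show "ev xs (Vr 2) v' A' = m" using tabledD(2)[OF s] by simp
qed simp_all

lemma wp_init_viol:
  assumes s: "tabled v A" and l: "\<And>e. e < m \<Longrightarrow> A 7 e = load k (A 6) e"
  shows "wp xs (init_viol k) (\<lambda>v' A' t'. (\<forall>e<m. A' 8 e = conflict ag k (A 6) e +
      card {x. x < m \<and> ag x = ag e \<and> conflicted k (A 6) x e}) \<and> t' \<le> t + (8 * m + 6 * k + 10) * m + 2) v A t"
  unfolding init_viol_def
proof (rule wp_upto[where N = m and C = "8 * m + 6 * k + 8" and J = "\<lambda>i v A'. \<forall>e<i. A' 8 e =
    conflict ag k (A 6) e + card {x. x < m \<and> ag x = ag e \<and> conflicted k (A 6) x e}"])
  let ?V = "\<lambda>e. conflict ag k (A 6) e + card {x. x < m \<and> ag x = ag e \<and> conflicted k (A 6) x e}"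
  let ?c = "Asg 16 (Cn 0) ;; Asg 10 (Rd 17 (Vr 9)) ;; Asg 11 (Rd 18 (Vr 9)) ;;
     count_conflicts k ;; count_blockers ;; Sto 8 (Vr 9) (Vr 16)"
  note defs = count_conflicts_def count_blockers_def
  show "9 \<notin> mv ?c" by (simp add: defs)
  fix v' A' assume o: "same_off (insert 9 (mv ?c)) v' v" "same_off (ma ?c) A' A"
  have s': "tabled v' A'" by (rule tabled_same_off[OF s o]) (simp_all add: defs)
  note d = tabledD[OF s']
  show "ev xs (Vr 2) v' A' = m" using d by simp
  have same: "A' 6 = A 6" "A' 7 = A 7" using same_offD[OF o(2)] by (simp_all add: defs)
  show "wp xs ?c (\<lambda>v'' A'' u. (\<forall>x<Suc e. A'' 8 x = ?V x) \<and> u \<le> t' + (8 * m + 6 * k + 8)) v' A' t'"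
    (is "wp _ _ ?Q _ _ _") if e: "e < m" "v' 9 = e" and J: "\<forall>x<e. A' 8 x = ?V x" for e t'
  proof -
    let ?v = "v'(16 := 0, 10 := ag e, 11 := ob e)"
    have s1: "tabled ?v A'" using s' by (simp add: tabled_def)
    have "wp xs (count_conflicts k) (wp xs count_blockers (wp xs (Sto 8 (Vr 9) (Vr 16)) ?Q)) ?v A' (Suc (Suc (Suc t')))"
    proof (rule wp_call[OF wp_count_conflicts[OF s1, of e]])
      fix v1 A1 t1
      assume 1: "v1 16 = conflict ag k (A' 6) e \<and> t1 \<le> Suc (Suc (Suc t')) + 6 * k + 2"
        and o1: "same_off (mv (count_conflicts k)) v1 ?v" "same_off (ma (count_conflicts k)) A1 A'"
      have s2: "tabled v1 A1" by (rule tabled_same_off[OF s1 o1]) (simp_all add: defs)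
      have same1: "A1 = A'" "v1 9 = e" "v1 10 = ag e" "v1 11 = ob e"
        using same_offD[OF o1(1)] same_offD[OF o1(2)] e(2) by (simp_all add: defs fun_eq_iff)
      show "wp xs count_blockers (wp xs (Sto 8 (Vr 9) (Vr 16)) ?Q) v1 A1 t1"
      proof (rule wp_call[OF wp_count_blockers[OF s2 same1(2,3,4) e(1), of k "A 6"]])
        show "A1 7 e = load k (A 6) e" using l[OF e(1)] same same1 by simp
        fix v2 A2 t2
        assume 2: "v2 16 = v1 16 + card {x. x < m \<and> ag x = ag e \<and> conflicted k (A 6) x e} \<and> t2 \<le> t1 + 8 * m + 2"
          and o2: "same_off (mv count_blockers) v2 v1" "same_off (ma count_blockers) A2 A1"
        have "A2 = A'" "v2 9 = e"
          using same_offD[OF o2(1)] same_offD[OF o2(2)] same1 by (simp_all add: defs fun_eq_iff)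
        then show "wp xs (Sto 8 (Vr 9) (Vr 16)) ?Q v2 A2 t2" using 1 2 J same by (auto simp: less_Suc_eq)
      qed
    qed (use e in simp_all)
    then show ?thesis using d e by simp
  qed
qed auto

definition good :: "nat \<Rightarrow> (nat \<Rightarrow> nat) \<Rightarrow> bool" where
  "good k G \<longleftrightarrow> (\<exists>q g. guess.perfect n m ag ob vt (load k G) (conflict ag k G) q g \<and> (\<forall>b<n. q b < n))"

lemma wp_try_guess:
  assumes s: "tabled v A"
  shows "wp xs (try_guess k) (\<lambda>v' A' t'. v' 0 = (if good k (A 6) then 1 else v 0) \<and> t' \<le> t + guess_cost n m K k) v A t"
proof -
  interpret guess n m ag ob vt "load k (A 6)" "conflict ag k (A 6)" by (rule guess_load)
  interpret search n m ag ob vt "load k (A 6)" "conflict ag k (A 6)" hb nb mn mn2 vtab eix K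
    by unfold_locales
  let ?Q = "\<lambda>v' A' t'. v' 0 = (if good k (A 6) then 1 else v 0) \<and> t' \<le> t + guess_cost n m K k"
  note defs = init_levels_def clear_load_def count_load_def init_viol_def count_conflicts_def count_blockers_def
  have "wp xs init_levels (wp xs clear_load (wp xs (count_load k) (wp xs (init_viol k) (wp xs solve ?Q)))) v A t"
  proof (rule wp_call[OF wp_init_levels[OF s]])
    fix v1 A1 t1 assume 1: "(\<forall>b<n. A1 9 b = 0) \<and> t1 \<le> t + 3 * n + 2"
      and o1: "same_off (mv init_levels) v1 v" "same_off (ma init_levels) A1 A"
    have s1: "tabled v1 A1" by (rule tabled_same_off[OF s o1]) (simp_all add: defs)
    have e1: "A1 6 = A 6" "v1 0 = v 0" using same_offD[OF o1(1)] same_offD[OF o1(2)] by (simp_all add: defs)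
    show "wp xs clear_load (wp xs (count_load k) (wp xs (init_viol k) (wp xs solve ?Q))) v1 A1 t1"
    proof (rule wp_call[OF wp_clear_load[OF s1]])
      fix v2 A2 t2 assume 2: "(\<forall>e<m. A2 7 e = 0) \<and> t2 \<le> t1 + 3 * m + 2"
        and o2: "same_off (mv clear_load) v2 v1" "same_off (ma clear_load) A2 A1"
      have s2: "tabled v2 A2" by (rule tabled_same_off[OF s1 o2]) (simp_all add: defs)
      have e2: "A2 6 = A 6" "v2 0 = v 0" "A2 9 = A1 9"
        using same_offD[OF o2(1)] same_offD[OF o2(2)] e1 by (simp_all add: defs)
      have z2: "A2 7 e = 0" if "e < m" for e using 2 that by blast
      show "wp xs (count_load k) (wp xs (init_viol k) (wp xs solve ?Q)) v2 A2 t2"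
      proof (rule wp_call[OF wp_count_load[of A2, OF z2]])
        fix v3 A3 t3 assume 3: "(\<forall>e<m. A3 7 e = load k (A2 6) e) \<and> t3 \<le> t2 + 3 * k + 2"
          and o3: "same_off (mv (count_load k)) v3 v2" "same_off (ma (count_load k)) A3 A2"
        have s3: "tabled v3 A3" by (rule tabled_same_off[OF s2 o3]) (simp_all add: defs)
        have e3: "A3 6 = A 6" "v3 0 = v 0" "A3 9 = A1 9"
          using same_offD[OF o3(1)] same_offD[OF o3(2)] e2 by (simp_all add: defs)
        have l3: "A3 7 e = load k (A3 6) e" if "e < m" for e using 3 e2 e3 that by simp
        show "wp xs (init_viol k) (wp xs solve ?Q) v3 A3 t3"
        proof (rule wp_call[OF wp_init_viol[of v3 A3 k, OF s3 l3]])
          fix v4 A4 t4 assume 4: "(\<forall>e<m. A4 8 e = conflict ag k (A3 6) e +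
              card {x. x < m \<and> ag x = ag e \<and> conflicted k (A3 6) x e}) \<and> t4 \<le> t3 + (8 * m + 6 * k + 10) * m + 2"
            and o4: "same_off (mv (init_viol k)) v4 v3" "same_off (ma (init_viol k)) A4 A3"
          have s4: "tabled v4 A4" by (rule tabled_same_off[OF s3 o4]) (simp_all add: defs)
          have e4: "v4 0 = v 0" "A4 9 = A1 9" "A4 7 = A3 7"
            using same_offD[OF o4(1)] same_offD[OF o4(2)] e3 by (simp_all add: defs)
          have st: "static v4 A4" using s4 l3 e3 e4 by (simp add: static_def tabled_def)
          have z: "A4 9 b = 0" if "b < n" for b using 1 e4 that by simp
          have "{x. x < m \<and> ag x = ag e \<and> conflicted k (A 6) x e} = {x. x < m \<and> ag x = ag e \<and> blk (A4 9) x e}"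
            if "e < m" for e using z ob that by (auto simp: conflicted_def blk_def)
          then have tr: "tracks (A4 9) (A4 8)" using 4 e3 by (simp add: tracks_def blockers_def)
          show "wp xs solve ?Q v4 A4 t4"
          proof (rule wp_call[OF wp_solve[of v4 A4, OF st tr z]])
            fix v5 A5 t5
            assume 5: "v5 0 = (if \<exists>q g. perfect q g \<and> (\<forall>b<n. q b < n) then 1 else v4 0) \<and>
                t5 \<le> t4 + 2 + round_cost * (n * n + 1)"
            have "v5 0 = (if good k (A 6) then 1 else v 0)" 
              using 5 unfolding e4(1) good_def by blast
            moreover have "t5 \<le> t + guess_cost n m K k"
              using 1 2 3 4 5 unfolding guess_cost_def round_cost_def search_cost_def by linarith
            ultimately show "?Q v5 A5 t5" by blast
          qed
        qed
      qed
    qed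
  qed
  then show ?thesis by (simp only: try_guess_def wp_Sq)
qed

lemma mv_guesses: "mv (guesses k d) \<inter> {1, 2, 4} = {}"
  by (induction d) (simp_all add: try_guess_def init_levels_def clear_load_def count_load_def init_viol_def
      count_conflicts_def count_blockers_def solve_def auction_def auction_init_def auction_step_def
      match_all_def search_path_def search_init_def search_step_def augment_def raise_def raise_step_def)

lemma ma_guesses: "ma (guesses k d) \<inter> {0, 1, 2, 3, 4, 5, 17, 18} = {}"
  by (induction d) (simp_all add: try_guess_def init_levels_def clear_load_def count_load_def init_viol_def
      count_conflicts_def count_blockers_def solve_def auction_def auction_init_def auction_step_def
      match_all_def search_path_def search_init_def search_step_def augment_def raise_def raise_step_def)

lemma ma_try_guess: "6 \<notin> ma (try_guess k)"
  by (simp add: try_guess_def init_levels_def clear_load_def count_load_def init_viol_def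
      count_conflicts_def count_blockers_def solve_def auction_def auction_init_def auction_step_def
      match_all_def search_path_def search_init_def search_step_def augment_def raise_def raise_step_def)

text \<open>Cells from \<open>d\<close> on belong to the outer loops and stay as they are. Register
  0 is only ever set to 1, so its final value is the disjunction over all guesses tried.\<close>

lemma wp_guesses:
  assumes "tabled v A"
  shows "wp xs (guesses k d) (\<lambda>v' A' t'. v' 0 = (if \<exists>G. (\<forall>j<d. G j < m) \<and> (\<forall>j\<ge>d. G j = A 6 j) \<and> good k G
      then 1 else v 0) \<and> (\<forall>j\<ge>d. A' 6 j = A 6 j) \<and> t' \<le> t + (guess_cost n m K k + 4 * d) * m ^ d) v A t"
  using assms
proof (induction d arbitrary: v A t)
  case 0
  have eq: "(\<exists>G. (\<forall>j. G j = A 6 j) \<and> good k G) \<longleftrightarrow> good k (A 6)" for A :: arrs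
    by (metis ext)
  have "wp xs (try_guess k) (\<lambda>v' A' t'. v' 0 = (if \<exists>G. (\<forall>j<0. G j < m) \<and> (\<forall>j\<ge>0. G j = A 6 j) \<and> good k G
      then 1 else v 0) \<and> (\<forall>j\<ge>0. A' 6 j = A 6 j) \<and> t' \<le> t + (guess_cost n m K k + 4 * 0) * m ^ 0) v A t"
    by (rule wp_call[OF wp_try_guess[OF 0(1)]]) (drule same_offD[OF _ ma_try_guess], simp add: eq)
  then show ?case by (simp only: guesses.simps)
next
  case (Suc d)
  let ?B = "(guess_cost n m K k + 4 * d) * m ^ d"
  define goal where "goal i = (if \<exists>G. (\<forall>j<d. G j < m) \<and> G d < i \<and> (\<forall>j\<ge>Suc d. G j = A 6 j) \<and> good k G
      then 1 else v 0)" for i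
  let ?I = "\<lambda>v' A' t'. A' 6 d \<le> m \<and> (\<forall>j\<ge>Suc d. A' 6 j = A 6 j) \<and> v' 0 = goal (A' 6 d) \<and>
      t' + (?B + 2) * (m - A' 6 d) \<le> t + 1 + (?B + 2) * m"
  let ?c = "guesses k d ;; Sto 6 (Cn d) (Pl (Rd 6 (Cn d)) (Cn 1))"
  let ?A = "A(6 := (A 6)(d := 0))"
  have "wp xs (Wh (Mi (Vr 2) (Rd 6 (Cn d))) ?c) (\<lambda>v' A' t'. v' 0 = goal m \<and> (\<forall>j\<ge>Suc d. A' 6 j = A 6 j) \<and>
      t' \<le> t + 2 + (?B + 2) * m) v ?A (Suc t)"
  proof (rule wp_Wh[where I = ?I and T = "t + 1 + (?B + 2) * m"])
    show "?I v ?A (Suc t)" by (simp add: goal_def)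
  next
    fix v' A' t' assume I: "?I v' A' t'" and o: "same_off (mv ?c) v' v" "same_off (ma ?c) A' ?A"
    have "tabled v ?A" using Suc.prems by (simp add: tabled_def)
    then have s': "tabled v' A'"
      by (rule tabled_same_off[OF _ o]) (use mv_guesses[of k d] ma_guesses[of k d] in auto)
    note d = tabledD[OF s']
    show "wp xs ?c ?I v' A' (Suc t')" if "0 < ev xs (Mi (Vr 2) (Rd 6 (Cn d))) v' A'"
    proof -
      let ?i = "A' 6 d"
      have i: "?i < m" using that d by simp
      have "wp xs (guesses k d) (wp xs (Sto 6 (Cn d) (Pl (Rd 6 (Cn d)) (Cn 1))) ?I) v' A' (Suc t')"
      proof (rule wp_call[OF Suc.IH[OF s']])
        fix v1 :: env and A1 :: arrs and t1
        assume 1: "v1 0 = (if \<exists>G. (\<forall>j<d. G j < m) \<and> (\<forall>j\<ge>d. G j = A' 6 j) \<and> good k G then 1 else v' 0) \<and>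
          (\<forall>j\<ge>d. A1 6 j = A' 6 j) \<and> t1 \<le> Suc t' + ?B"
        have split: "(\<forall>j\<ge>d. G j = A' 6 j) \<longleftrightarrow> G d = ?i \<and> (\<forall>j\<ge>Suc d. G j = A 6 j)" for G
        proof -
          have "(\<forall>j\<ge>d. G j = A' 6 j) \<longleftrightarrow> G d = ?i \<and> (\<forall>j\<ge>Suc d. G j = A' 6 j)"
            by (auto simp: Suc_le_eq le_eq_less_or_eq[of d])
          then show ?thesis using I by simp
        qed
        have or: "x = (if p then 1 else y) \<Longrightarrow> y = (if r then 1 else z) \<Longrightarrow> x = (if p \<or> r then 1 else z)"
          for x y z :: nat and p r by simp
        have ex: "(\<exists>G. (\<forall>j<d. G j < m) \<and> G d < Suc ?i \<and> (\<forall>j\<ge>Suc d. G j = A 6 j) \<and> good k G) \<longleftrightarrow>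
            (\<exists>G. (\<forall>j<d. G j < m) \<and> (G d = ?i \<and> (\<forall>j\<ge>Suc d. G j = A 6 j)) \<and> good k G) \<or>
            (\<exists>G. (\<forall>j<d. G j < m) \<and> G d < ?i \<and> (\<forall>j\<ge>Suc d. G j = A 6 j) \<and> good k G)"
          unfolding less_Suc_eq by blast
        have "v' 0 = goal ?i" using I by blast
        then have "v1 0 = goal (Suc ?i)" unfolding goal_def ex
          by (rule or[OF 1[unfolded split, THEN conjunct1]])
        moreover have "Suc t1 + (?B + 2) * (m - Suc ?i) \<le> t + 1 + (?B + 2) * m"
        proof -
          have "(?B + 2) * (m - ?i) = (?B + 2) + (?B + 2) * (m - Suc ?i)"
            using i by (metis Suc_diff_Suc mult_Suc_right)
          then show ?thesis using 1 I by linarith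
        qed
        moreover have "\<forall>j\<ge>Suc d. A1 6 j = A 6 j"
        proof (intro allI impI)
          fix j assume "Suc d \<le> j"
          then have "A1 6 j = A' 6 j" "A' 6 j = A 6 j" using 1 I by simp_all
          then show "A1 6 j = A 6 j" by simp
        qed
        moreover have "A1 6 d = ?i" using 1 by blast
        ultimately show "wp xs (Sto 6 (Cn d) (Pl (Rd 6 (Cn d)) (Cn 1))) ?I v1 A1 t1" using i by simp
      qed
      then show ?thesis by (simp only: wp_Sq)
    qed
    show "v' 0 = goal m \<and> (\<forall>j\<ge>Suc d. A' 6 j = A 6 j) \<and> Suc t' \<le> t + 2 + (?B + 2) * m"
      if "ev xs (Mi (Vr 2) (Rd 6 (Cn d))) v' A' = 0"
    proof -
      have "A' 6 d = m" using that I d by simp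
      then show ?thesis using I by auto
    qed
  qed auto
  \<comment> \<open>The overhead of one loop is at most 4 per iteration as \<open>m\<close> is
    positive, hence at most 4 per innermost execution; \<open>d\<close> nested loops give
    \<open>4 * d\<close>.\<close>
  moreover have "t + 2 + (?B + 2) * m \<le> t + (guess_cost n m K k + 4 * Suc d) * m ^ Suc d"
  proof -
    have "1 \<le> m ^ d" "1 \<le> m" using n by simp_all
    then have "m * 1 \<le> m * m ^ d" by (intro mult_le_mono2)
    moreover have "2 + (?B + 2) * m \<le> ?B * m + 4 * m" using \<open>1 \<le> m\<close> by (simp add: algebra_simps)
    moreover have "(guess_cost n m K k + 4 * Suc d) * m ^ Suc d = ?B * m + 4 * (m * m ^ d)"
      by (simp add: algebra_simps)
    ultimately show ?thesis by linarith
  qed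
  moreover have "goal m = (if \<exists>G. (\<forall>j<Suc d. G j < m) \<and> (\<forall>j\<ge>Suc d. G j = A 6 j) \<and> good k G then 1 else v 0)"
  proof -
    have "(\<forall>j<Suc d. G j < m) \<longleftrightarrow> (\<forall>j<d. G j < m) \<and> G d < m" for G by (auto simp: less_Suc_eq)
    then show ?thesis unfolding goal_def by (simp only: conj_assoc)
  qed
  ultimately have "wp xs (Wh (Mi (Vr 2) (Rd 6 (Cn d))) ?c) (\<lambda>v' A' t'. v' 0 = (if \<exists>G. (\<forall>j<Suc d. G j < m) \<and>
      (\<forall>j\<ge>Suc d. G j = A 6 j) \<and> good k G then 1 else v 0) \<and> (\<forall>j\<ge>Suc d. A' 6 j = A 6 j) \<and>
      t' \<le> t + (guess_cost n m K k + 4 * Suc d) * m ^ Suc d) v ?A (Suc t)"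
    by (elim wp_call) (auto simp only: intro: order_trans)
  then show ?case by simp
qed

lemma wp_all_guesses:
  assumes "tabled v A" "v 0 = 0"
  shows "wp xs (guesses k k) (\<lambda>v' A' t'. v' 0 = (if \<exists>G. (\<forall>j<k. G j < m) \<and> good k G then 1 else 0) \<and>
    t' \<le> t + (guess_cost n m K k + 4 * k) * m ^ k) v A t"
proof (rule wp_call[OF wp_guesses[OF assms(1)]])
  have good: "good k G \<longleftrightarrow> good k (\<lambda>j. if j < k then G j else A 6 j)" for G
    using load_cong[of k G "\<lambda>j. if j < k then G j else A 6 j"]
      conflict_cong[of k G "\<lambda>j. if j < k then G j else A 6 j" ag] by (simp add: good_def)
  have "(\<exists>G. (\<forall>j<k. G j < m) \<and> (\<forall>j\<ge>k. G j = A 6 j) \<and> good k G) \<longleftrightarrow> (\<exists>G. (\<forall>j<k. G j < m) \<and> good k G)"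
  proof
    assume "\<exists>G. (\<forall>j<k. G j < m) \<and> good k G"
    then obtain G where "\<forall>j<k. G j < m" "good k (\<lambda>j. if j < k then G j else A 6 j)" using good by blast
    then show "\<exists>G. (\<forall>j<k. G j < m) \<and> (\<forall>j\<ge>k. G j = A 6 j) \<and> good k G"
      by (intro exI[of _ "\<lambda>j. if j < k then G j else A 6 j"]) simp
  qed blast
  then show "v' 0 = (if \<exists>G. (\<forall>j<k. G j < m) \<and> good k G then 1 else 0) \<and> t' \<le> t + (guess_cost n m K k + 4 * k) * m ^ k"
    if "v' 0 = (if \<exists>G. (\<forall>j<k. G j < m) \<and> (\<forall>j\<ge>k. G j = A 6 j) \<and> good k G then 1 else v 0) \<and>
      (\<forall>j\<ge>k. A' 6 j = A 6 j) \<and> t' \<le> t + (guess_cost n m K k + 4 * k) * m ^ k" for v' A' t'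
    using that assms(2) by simp
qed

end

section \<open>Reading the input\<close>

text \<open>The table extends one entry beyond the last agent: entry \<open>n\<close> is
  \<open>n * n\<close>, the increment of the table built by \<open>setup_mul2\<close>.\<close>

definition setup_mul :: hc where
  "setup_mul = upto 7 (Vr 1) (Sto 4 (Pl (Vr 7) (Cn 1)) (Pl (Rd 4 (Vr 7)) (Vr 1)))"

definition setup_mul2 :: hc where
  "setup_mul2 = upto 7 (Vr 1) (Sto 5 (Pl (Vr 7) (Cn 1)) (Pl (Rd 5 (Vr 7)) (Rd 4 (Vr 1))))"

definition edge_step :: hc where
  "edge_step = Asg 10 (In (Vr 18)) ;; Asg 11 (In (Pl (Vr 18) (Cn 1))) ;; Sto 17 (Vr 9) (Vr 10) ;;
     Sto 18 (Vr 9) (Vr 11) ;; Sto 3 (Pl (Rd 4 (Vr 10)) (Vr 11)) (Pl (Vr 9) (Cn 1)) ;;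
     Sto 1 (Vr 9) (Rd 0 (Vr 11)) ;; Sto 0 (Vr 11) (Pl (Vr 9) (Cn 1)) ;; Asg 18 (Pl (Vr 18) (Cn 2))"

definition setup_edges :: hc where
  "setup_edges = Asg 18 (Cn 2) ;; upto 9 (Vr 2) edge_step"

definition vote_step :: hc where
  "vote_step = Asg 10 (In (Vr 18)) ;; Asg 11 (In (Pl (Vr 18) (Cn 1))) ;; Asg 12 (In (Pl (Vr 18) (Cn 2))) ;;
     Sto 2 (Pl (Pl (Rd 5 (Vr 10)) (Rd 4 (Vr 11))) (Vr 12)) (Cn 1) ;; Asg 18 (Pl (Vr 18) (Cn 3))"

definition setup_votes :: hc where
  "setup_votes = Asg 3 (In (Vr 18)) ;; Asg 18 (Pl (Vr 18) (Cn 1)) ;; upto 9 (Vr 3) vote_step"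

text \<open>Register 19 holds the square of register 4, and the next square is obtained by adding
  twice the root plus 1.\<close>

definition setup_sqrt :: hc where
  "setup_sqrt = Wh (Mi (Pl (Vr 1) (Cn 1)) (Pl (Pl (Vr 19) (Pl (Vr 4) (Vr 4))) (Cn 1)))
     (Asg 19 (Pl (Pl (Vr 19) (Pl (Vr 4) (Vr 4))) (Cn 1)) ;; inc 4)"

text \<open>Without objects or without edges the time bound is 0, so such instances must be decided
  in constant time. The tests do this, and afterwards \<open>n\<close> is positive and at most
  \<open>m\<close>, which the cost estimates rely on.\<close>

definition main :: "nat \<Rightarrow> hc" where
  "main k = Asg 1 (In (Cn 0)) ;; Asg 2 (In (Cn 1)) ;;
     Br (Vr 1)
       (Br (Mi (Vr 1) (Vr 2)) nop
          (setup_mul ;; setup_mul2 ;; setup_edges ;; setup_votes ;; Asg 19 (Cn 0) ;; setup_sqrt ;; guesses k k))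
       (Asg 0 (Cn 1))"

lemmas program_defs = try_guess_def init_levels_def clear_load_def count_load_def init_viol_def
  count_conflicts_def count_blockers_def solve_def auction_def auction_init_def auction_step_def
  match_all_def search_path_def search_init_def search_step_def augment_def raise_def raise_step_def

lemma wfc_guesses: "wfc (guesses k d)"
  by (induction d) (simp_all add: program_defs)

lemma wfc_main: "wfc (main k)"
  using wfc_guesses by (simp add: main_def setup_mul_def setup_mul2_def setup_edges_def edge_step_def
      setup_votes_def vote_step_def setup_sqrt_def)

section \<open>Layout of the input\<close>

lemma length_concat_pairs: "length (concat (map (\<lambda>(a, b). [a, b]) es)) = 2 * length es"
  by (induction es) auto

lemma length_concat_triples: "length (concat (map (\<lambda>(a, b, c). [a, b, c]) ps)) = 3 * length ps"
  by (induction ps) auto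

lemma nth_concat_pairs:
  "i < length es \<Longrightarrow> concat (map (\<lambda>(a, b). [a, b]) es) ! (2 * i) = fst (es ! i) \<and>
     concat (map (\<lambda>(a, b). [a, b]) es) ! Suc (2 * i) = snd (es ! i)"
proof (induction es arbitrary: i)
  case (Cons x es)
  then show ?case by (cases i) (auto simp: case_prod_beta)
qed simp

lemma nth_concat_triples:
  "i < length ps \<Longrightarrow> concat (map (\<lambda>(a, b, c). [a, b, c]) ps) ! (3 * i) = fst (ps ! i) \<and>
     concat (map (\<lambda>(a, b, c). [a, b, c]) ps) ! Suc (3 * i) = fst (snd (ps ! i)) \<and>
     concat (map (\<lambda>(a, b, c). [a, b, c]) ps) ! Suc (Suc (3 * i)) = snd (snd (ps ! i))"
proof (induction ps arbitrary: i)
  case (Cons x ps)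
  then show ?case by (cases i) (auto simp: case_prod_beta)
qed simp

lemma mult_add_inj: "b < n \<Longrightarrow> d < n \<Longrightarrow> a * n + b = c * n + d \<Longrightarrow> a = c \<and> b = (d::nat)"
  by (metis add.commute add_left_cancel div_mult_self3 mod_less mod_mult_self2 mult.commute mult_cancel_left
      not_less_zero)

locale encoded =
  fixes n :: nat and E :: "(nat \<times> nat) set" and P :: "(nat, nat) prefs" and es ps xs
  assumes bip: "bipartite_graph {..<n} {..<n} E" and pref: "preference_system {..<n} E P"
    and es: "distinct es" "set es = E"
    and ps: "distinct ps" "set ps = {(a, b, c). a < n \<and> (b, c) \<in> P a}"
    and xs: "xs = [n, length es] @ concat (map (\<lambda>(a, b). [a, b]) es) @
      [length ps] @ concat (map (\<lambda>(a, b, c). [a, b, c]) ps)"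
begin

abbreviation m :: nat where "m \<equiv> length es"
abbreviation p :: nat where "p \<equiv> length ps"

definition ag :: "nat \<Rightarrow> nat" where "ag e = (if e < m then fst (es ! e) else 0)"
definition ob :: "nat \<Rightarrow> nat" where "ob e = (if e < m then snd (es ! e) else 0)"
definition vt :: "nat \<Rightarrow> nat \<Rightarrow> nat \<Rightarrow> nat" where "vt a b c = of_bool ((b, c) \<in> P a)"

lemma edge_less: "(a, b) \<in> E \<Longrightarrow> a < n \<and> b < n"
  using bip by (auto simp: bipartite_graph_def)

lemma vote_edges: "a < n \<Longrightarrow> (b, c) \<in> P a \<Longrightarrow> (a, b) \<in> E \<and> (a, c) \<in> E"
  using pref by (fastforce simp: preference_system_def strict_partial_order_on_def neighbours_def)

lemma ps_less:
  assumes "(a, b, c) \<in> set ps"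
  shows "a < n" "b < n" "c < n" "(a, b) \<in> E"
proof -
  have *: "a < n" "(b, c) \<in> P a" using assms unfolding ps(2) by auto
  then show "a < n" "(a, b) \<in> E" "b < n" "c < n"
    using vote_edges[OF *] edge_less[of a b] edge_less[of a c] by auto
qed

lemma es_nth: "e < m \<Longrightarrow> es ! e = (ag e, ob e)"
  by (simp add: ag_def ob_def)

lemma es_less: "e < m \<Longrightarrow> ag e < n \<and> ob e < n"
  using edge_less[of "ag e" "ob e"] es(2) es_nth[of e] nth_mem[of e es] by simp

sublocale market n m ag ob vt
proof
  fix e e' assume "e < m" "e' < m" "ag e = ag e'" "ob e = ob e'"
  then show "e = e'" using es(1) es_nth by (metis nth_eq_iff_index_eq)
qed (use es_less in \<open>auto simp: vt_def\<close>)

lemma E_eq: "E = {(ag e, ob e) | e. e < m}"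
proof -
  have "set es = {(ag e, ob e) | e. e < m}" unfolding set_conv_nth using es_nth by metis
  then show ?thesis using es(2) by simp
qed

lemma card_E: "card E = m"
  using es distinct_card by metis

lemma m_le: "m \<le> n * n"
proof -
  have "E \<subseteq> {..<n} \<times> {..<n}" using edge_less by auto
  then have "card E \<le> card ({..<n} \<times> {..<n})" by (intro card_mono) auto
  then show ?thesis by (simp add: card_E)
qed

text \<open>Preferences relate neighbours only, so a comparison is given by an edge and the worse
  object. Hence reading all comparisons is cheap enough.\<close>

lemma p_le: "p \<le> m * n"
proof -
  let ?f = "\<lambda>(a, b, c). ((a, b), c)"
  have "?f x \<in> E \<times> {..<n}" if "x \<in> set ps" for x
  proof -
    obtain a b c where x: "x = (a, b, c)" by (cases x) auto
    then show ?thesis using that ps_less[of a b c] by simp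
  qed
  then have "?f ` set ps \<subseteq> E \<times> {..<n}" by blast
  moreover have "finite E" using es(2) by auto
  ultimately have "card (?f ` set ps) \<le> card (E \<times> {..<n})" by (intro card_mono) auto
  moreover have "inj_on ?f (set ps)" by (rule inj_onI) (auto split: prod.splits)
  then have "card (?f ` set ps) = p" by (simp add: card_image distinct_card[OF ps(1)])
  ultimately show ?thesis by (simp add: card_E card_cartesian_product)
qed

lemma length_xs: "length xs = 3 + 2 * m + 3 * p"
  by (simp add: xs length_concat_pairs length_concat_triples)

lemma xs_header: "xs ! 0 = n" "xs ! 1 = m" "xs ! (2 + 2 * m) = p"
proof -
  show "xs ! 0 = n" "xs ! 1 = m" by (simp_all add: xs)
  let ?L = "[n, m] @ concat (map (\<lambda>(a, b). [a, b]) es)"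
  have "length ?L = 2 + 2 * m" by (simp add: length_concat_pairs)
  moreover have "xs = ?L @ p # concat (map (\<lambda>(a, b, c). [a, b, c]) ps)" by (simp add: xs)
  ultimately show "xs ! (2 + 2 * m) = p" by (metis nth_append_length)
qed

lemma mem_edge:
  assumes "e < m"
  shows "mem xs A (2 + 2 * e) = ag e" "mem xs A (Suc (2 + 2 * e)) = ob e"
proof -
  have "2 * e < 2 * m" "Suc (2 * e) < 2 * m" using assms by simp_all
  then have "xs ! (2 + 2 * e) = ag e" "xs ! (Suc (2 + 2 * e)) = ob e"
    using nth_concat_pairs[OF assms] es_nth[OF assms]
    by (simp_all add: xs nth_append length_concat_pairs)
  then show "mem xs A (2 + 2 * e) = ag e" "mem xs A (Suc (2 + 2 * e)) = ob e"
    using assms length_xs by (simp_all add: mem_def)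
qed

lemma mem_vote:
  assumes "i < p"
  shows "mem xs A (3 + 2 * m + 3 * i) = fst (ps ! i)"
    "mem xs A (Suc (3 + 2 * m + 3 * i)) = fst (snd (ps ! i))"
    "mem xs A (Suc (Suc (3 + 2 * m + 3 * i))) = snd (snd (ps ! i))"
proof -
  have xs': "xs = ([n, length es] @ concat (map (\<lambda>(a, b). [a, b]) es) @ [length ps]) @
      concat (map (\<lambda>(a, b, c). [a, b, c]) ps)" by (simp add: xs)
  have len: "length ([n, length es] @ concat (map (\<lambda>(a, b). [a, b]) es) @ [length ps]) = 3 + 2 * m"
    by (simp add: length_concat_pairs)
  have "xs ! (3 + 2 * m + j) = concat (map (\<lambda>(a, b, c). [a, b, c]) ps) ! j" for j
    unfolding xs' len[symmetric] by (rule nth_append_length_plus)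
  from this[of "3 * i"] this[of "Suc (3 * i)"] this[of "Suc (Suc (3 * i))"]
  have "xs ! (3 + 2 * m + 3 * i) = fst (ps ! i)" "xs ! Suc (3 + 2 * m + 3 * i) = fst (snd (ps ! i))"
    "xs ! Suc (Suc (3 + 2 * m + 3 * i)) = snd (snd (ps ! i))"
    using nth_concat_triples[OF assms] by simp_all
  then show "mem xs A (3 + 2 * m + 3 * i) = fst (ps ! i)"
    "mem xs A (Suc (3 + 2 * m + 3 * i)) = fst (snd (ps ! i))"
    "mem xs A (Suc (Suc (3 + 2 * m + 3 * i))) = snd (snd (ps ! i))"
    using assms length_xs by (simp_all add: mem_def)
qed

section \<open>Building the tables\<close>

lemma wp_setup_mul:
  assumes "v 1 = n" "A 4 0 = 0"
  shows "wp xs setup_mul (\<lambda>v' A' t'. (\<forall>a\<le>n. A' 4 a = a * n) \<and> t' \<le> t + 3 * n + 2) v A t"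
  unfolding setup_mul_def
  by (rule wp_upto[where N = n and C = 1 and J = "\<lambda>i v A. \<forall>a\<le>i. A 4 a = a * n"])
    (use assms in \<open>auto simp: same_off_def le_Suc_eq\<close>)

lemma wp_setup_mul2:
  assumes "v 1 = n" "A 5 0 = 0" "A 4 n = n * n"
  shows "wp xs setup_mul2 (\<lambda>v' A' t'. (\<forall>a\<le>n. A' 5 a = a * (n * n)) \<and> t' \<le> t + 3 * n + 2) v A t"
  unfolding setup_mul2_def
  by (rule wp_upto[where N = n and C = 1 and J = "\<lambda>i v A. \<forall>a\<le>i. A 5 a = a * (n * n)"])
    (use assms in \<open>auto simp: same_off_def le_Suc_eq\<close>)

definition edges_inv :: "nat \<Rightarrow> (nat \<Rightarrow> nat) \<Rightarrow> (nat \<Rightarrow> nat) \<Rightarrow> (nat \<Rightarrow> nat) \<Rightarrow> bool" where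
  "edges_inv i h g x \<longleftrightarrow>
     (\<forall>b. rest ob b (h b) = rest ob b i \<and> (\<forall>e. h b = Suc e \<longrightarrow> e < i \<and> ob e = b)) \<and>
     (\<forall>e<i. rest ob (ob e) (g e) = rest ob (ob e) e \<and> (\<forall>e'. g e = Suc e' \<longrightarrow> e' < i \<and> ob e' = ob e)) \<and>
     (\<forall>e<i. x (ag e * n + ob e) = Suc e) \<and> (\<forall>y e. x y = Suc e \<longrightarrow> e < i \<and> y = ag e * n + ob e)"

text \<open>Edge \<open>i\<close> is prepended to the list of its object, whose old head becomes its
  link; so the lists are descending.\<close>

lemma edges_inv_step:
  assumes I: "edges_inv i h g x" and i: "i < m"
  shows "edges_inv (Suc i) (h(ob i := Suc i)) (g(i := h (ob i))) (x(ag i * n + ob i := Suc i))"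
proof -
  have h: "rest ob b (h b) = rest ob b i" "h b = Suc e \<Longrightarrow> e < i \<and> ob e = b" for b e
    using I by (auto simp: edges_inv_def)
  have g: "rest ob (ob e) (g e) = rest ob (ob e) e" "g e = Suc e' \<Longrightarrow> e' < i \<and> ob e' = ob e" if "e < i" for e e'
    using I that by (auto simp: edges_inv_def)
  have x: "e < i \<Longrightarrow> x (ag e * n + ob e) = Suc e" "x y = Suc e \<Longrightarrow> e < i \<and> y = ag e * n + ob e" for e y
    using I by (auto simp: edges_inv_def)
  have new: "ag e * n + ob e \<noteq> ag i * n + ob i" if "e < i" for e
    using mult_add_inj[of "ob e" n "ob i" "ag e" "ag i"] es_less[of e] es_less[of i] that i edge_inj[of e i] by auto
  have rest: "rest ob b (Suc i) = rest ob b i" if "b \<noteq> ob i" for b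
    using that by (auto simp: rest_def less_Suc_eq)
  show ?thesis unfolding edges_inv_def
  proof (intro conjI allI impI)
    fix b show "rest ob b ((h(ob i := Suc i)) b) = rest ob b (Suc i)" using h(1) rest by simp
    fix e assume "(h(ob i := Suc i)) b = Suc e"
    then show "e < Suc i" "ob e = b" using h(2)[of b e] by (auto split: if_splits)
  next
    fix e assume e: "e < Suc i"
    then show "rest ob (ob e) ((g(i := h (ob i))) e) = rest ob (ob e) e"
      using g(1)[of e] h(1)[of "ob i"] by (cases "e = i") auto
    show "(x(ag i * n + ob i := Suc i)) (ag e * n + ob e) = Suc e"
      using e x(1)[of e] new[of e] by (cases "e = i") auto
    fix e' assume "(g(i := h (ob i))) e = Suc e'"
    then show "e' < Suc i" "ob e' = ob e" using e g(2)[of e e'] h(2)[of "ob i" e'] by (cases "e = i"; force)+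
  next
    fix y e assume "(x(ag i * n + ob i := Suc i)) y = Suc e"
    then show "e < Suc i" "y = ag e * n + ob e" using x(2)[of y e] by (auto split: if_splits)
  qed
qed

lemma wp_setup_edges:
  assumes v: "v 2 = m" and A: "\<And>a. a \<le> n \<Longrightarrow> A 4 a = a * n"
    and z: "A 0 = (\<lambda>_. 0)" "A 1 = (\<lambda>_. 0)" "A 3 = (\<lambda>_. 0)" "A 17 = (\<lambda>_. 0)" "A 18 = (\<lambda>_. 0)"
  shows "wp xs setup_edges (\<lambda>v' A' t'. edges_inv m (A' 0) (A' 1) (A' 3) \<and> A' 17 = ag \<and> A' 18 = ob \<and>
    v' 18 = 2 + 2 * m \<and> t' \<le> t + 10 * m + 3) v A t"
proof -
  let ?J = "\<lambda>i v' A'. v' 18 = 2 + 2 * i \<and> edges_inv i (A' 0) (A' 1) (A' 3) \<and>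
    A' 17 = (\<lambda>e. if e < i then ag e else 0) \<and> A' 18 = (\<lambda>e. if e < i then ob e else 0)"
  have "wp xs (upto 9 (Vr 2) edge_step) (\<lambda>v' A' t'. (edges_inv m (A' 0) (A' 1) (A' 3) \<and> A' 17 = ag \<and> A' 18 = ob \<and>
    v' 18 = 2 + 2 * m) \<and> t' \<le> t + 10 * m + 3) (v(18 := 2)) A (Suc t)"
  proof (rule wp_upto[where J = ?J and N = m and C = 8])
    have "edges_inv 0 (\<lambda>_. 0) (\<lambda>_. 0) (\<lambda>_. 0)" by (simp add: edges_inv_def)
    then show "?J 0 ((v(18 := 2))(9 := 0)) A" using z by simp
    show "9 \<notin> mv edge_step" by (simp add: edge_step_def)
  next
    fix v' A' assume o: "same_off (insert 9 (mv edge_step)) v' (v(18 := 2))" "same_off (ma edge_step) A' A"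
    have 2: "v' 2 = m" "A' 4 = A 4"
      using same_offD[OF o(1), of 2] same_offD[OF o(2), of 4] v by (simp_all add: edge_step_def)
    then show "ev xs (Vr 2) v' A' = m" by simp
    show "wp xs edge_step (\<lambda>v'' A'' u. ?J (Suc e) (v''(9 := Suc e)) A'' \<and> u \<le> t' + 8) v' A' t'"
      if e: "e < m" "v' 9 = e" and J: "?J e v' A'" for e t'
    proof -
      have "ag e \<le> n" using es_less[OF e(1)] by simp
      then have 4: "A' 4 (ag e) = ag e * n" using A 2 by simp
      have upd: "(\<lambda>x. if x < e then f x else 0)(e := f e) = (\<lambda>x. if x < Suc e then f x else (0::nat))" for f
        by (auto simp: less_Suc_eq)
      have "mem xs B (v' 18) = ag e" "mem xs B (Suc (v' 18)) = ob e" for B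
        using J mem_edge[OF e(1)] by simp_all
      then show ?thesis
        using J e 4 edges_inv_step[of e "A' 0" "A' 1" "A' 3", OF _ e(1)] upd[of ag] upd[of ob]
        by (simp add: edge_step_def)
    qed
  next
    fix v' A' assume "?J m v' A'"
    moreover have "(\<lambda>e. if e < m then ag e else 0) = ag" "(\<lambda>e. if e < m then ob e else 0) = ob"
      by (auto simp: ag_def ob_def)
    ultimately show "edges_inv m (A' 0) (A' 1) (A' 3) \<and> A' 17 = ag \<and> A' 18 = ob \<and> v' 18 = 2 + 2 * m" by auto
  qed auto
  then show ?thesis by (simp add: setup_edges_def)
qed

definition key :: "nat \<times> nat \<times> nat \<Rightarrow> nat" where
  "key x = fst x * (n * n) + fst (snd x) * n + snd (snd x)"

lemma key_inj:
  assumes "b < n" "c < n" "b' < n" "c' < n" "key (a, b, c) = key (a', b', c')"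
  shows "(a, b, c) = (a', b', c')"
proof -
  have "(a * n + b) * n + c = (a' * n + b') * n + c'" using assms(5) by (simp add: key_def algebra_simps)
  then have "a * n + b = a' * n + b'" "c = c'" using mult_add_inj assms(2,4) by blast+
  then show ?thesis using mult_add_inj[OF assms(1,3)] by blast
qed

lemma wp_setup_votes:
  assumes v: "v 18 = 2 + 2 * m" and z: "A 2 = (\<lambda>_. 0)"
    and A: "\<And>a. a \<le> n \<Longrightarrow> A 4 a = a * n" "\<And>a. a \<le> n \<Longrightarrow> A 5 a = a * (n * n)"
  shows "wp xs setup_votes (\<lambda>v' A' t'. A' 2 = (\<lambda>y. of_bool (\<exists>j<p. y = key (ps ! j))) \<and> t' \<le> t + 7 * p + 4) v A t"
proof -
  let ?J = "\<lambda>i v' A'. v' 18 = 3 + 2 * m + 3 * i \<and> A' 2 = (\<lambda>y. of_bool (\<exists>j<i. y = key (ps ! j)))"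
  have "wp xs (upto 9 (Vr 3) vote_step) (\<lambda>v' A' t'. A' 2 = (\<lambda>y. of_bool (\<exists>j<p. y = key (ps ! j))) \<and>
      t' \<le> t + 7 * p + 4) (v(3 := p, 18 := Suc (2 + 2 * m))) A (Suc (Suc t))"
  proof (rule wp_upto[where J = ?J and N = p and C = 5])
    show "?J 0 ((v(3 := p, 18 := Suc (2 + 2 * m)))(9 := 0)) A" using z by simp
    show "9 \<notin> mv vote_step" by (simp add: vote_step_def)
  next
    fix v' A' assume o: "same_off (insert 9 (mv vote_step)) v' (v(3 := p, 18 := Suc (2 + 2 * m)))"
      "same_off (ma vote_step) A' A"
    have 3: "v' 3 = p" "A' 4 = A 4" "A' 5 = A 5"
      using same_offD[OF o(1), of 3] same_offD[OF o(2)] by (simp_all add: vote_step_def)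
    then show "ev xs (Vr 3) v' A' = p" by simp
    show "wp xs vote_step (\<lambda>v'' A'' u. ?J (Suc i) (v''(9 := Suc i)) A'' \<and> u \<le> t' + 5) v' A' t'"
      if i: "i < p" "v' 9 = i" and J: "?J i v' A'" for i t'
    proof -
      obtain a b c where abc: "ps ! i = (a, b, c)" by (cases "ps ! i") auto
      then have "(a, b, c) \<in> set ps" using nth_mem[OF i(1)] by simp
      then have "a < n" "b < n" using ps_less by blast+
      then have 45: "A' 4 b = b * n" "A' 5 a = a * (n * n)" using A 3 by simp_all
      have "(\<lambda>y. of_bool (\<exists>j<i. y = key (ps ! j)))(key (ps ! i) := 1) =
          (\<lambda>y. of_bool (\<exists>j<Suc i. y = key (ps ! j)) :: nat)"
        by (auto simp: less_Suc_eq fun_eq_iff)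
      then have upd: "(\<lambda>y. of_bool (\<exists>j<i. y = key (ps ! j)))(a * (n * n) + b * n + c := Suc 0) =
          (\<lambda>y. of_bool (\<exists>j<Suc i. y = key (ps ! j)) :: nat)" by (simp add: abc key_def)
      have "mem xs B (v' 18) = a" "mem xs B (Suc (v' 18)) = b" "mem xs B (Suc (Suc (v' 18))) = c" for B
        using J mem_vote[OF i(1), of B] abc by simp_all
      then show ?thesis using J i 45 upd by (simp add: vote_step_def)
    qed
  qed auto
  moreover have "mem xs A (2 + 2 * m) = p" using xs_header(3) length_xs by (simp add: mem_def)
  ultimately show ?thesis using v by (simp add: setup_votes_def)
qed

lemma wp_setup_sqrt:
  assumes "v 1 = n" "v 4 = 0" "v 19 = 0"
  shows "wp xs setup_sqrt (\<lambda>v' A' t'. v' 4 * v' 4 \<le> n \<and> n < Suc (v' 4) * Suc (v' 4) \<and> t' \<le> t + 3 * n + 1) v A t"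
  unfolding setup_sqrt_def
proof (rule wp_Wh[where T = "t + 3 * n" and I = "\<lambda>v' A' t'. v' 19 = v' 4 * v' 4 \<and> v' 19 \<le> n \<and>
    t' + 3 * (n - v' 4) \<le> t + 3 * n"])
  let ?c = "Asg 19 (Pl (Pl (Vr 19) (Pl (Vr 4) (Vr 4))) (Cn 1)) ;; inc 4"
  let ?e = "Mi (Pl (Vr 1) (Cn 1)) (Pl (Pl (Vr 19) (Pl (Vr 4) (Vr 4))) (Cn 1))"
  let ?I = "\<lambda>v' A' t'. v' 19 = v' 4 * v' 4 \<and> v' 19 \<le> n \<and> t' + 3 * (n - v' 4) \<le> t + 3 * n"
  show "?I v A t" using assms by simp
  fix v' :: env and A' :: arrs and t' assume I: "?I v' A' t'" and o: "same_off (mv ?c) v' v"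
  have 1: "v' (Suc 0) = n" using same_offD[OF o, of 1] assms by simp
  show "wp xs ?c ?I v' A' (Suc t')" if "0 < ev xs ?e v' A'"
  proof -
    have le: "v' 4 * v' 4 + (v' 4 + v' 4) + 1 \<le> n" using that I 1 by simp
    then have "Suc (v' 4) \<le> n" by linarith
    then have "n - v' 4 = Suc (n - Suc (v' 4))" by simp
    then have "t' + 3 + 3 * (n - Suc (v' 4)) \<le> t + 3 * n" using I by simp
    then show ?thesis using I le by simp
  qed
  show "v' 4 * v' 4 \<le> n \<and> n < Suc (v' 4) * Suc (v' 4) \<and> Suc t' \<le> t + 3 * n + 1" if "ev xs ?e v' A' = 0"
    using that I 1 by auto
qed auto

lemma tables_setup:
  assumes inv: "edges_inv m hb nb eix" and A: "\<And>a. a \<le> n \<Longrightarrow> mn a = a * n" "\<And>a. a \<le> n \<Longrightarrow> mn2 a = a * (n * n)"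
    and vtab: "vtab = (\<lambda>y. of_bool (\<exists>j<p. y = key (ps ! j)))"
    and K: "K * K \<le> n" "n < Suc K * Suc K" and n: "0 < n" "n \<le> m"
  shows "tables n m ag ob vt hb nb mn mn2 vtab eix K"
proof unfold_locales
  fix b e assume "b < n"
  show "rest ob b (hb b) = rest ob b m" "hb b = Suc e \<Longrightarrow> e < m \<and> ob e = b"
    using inv by (auto simp: edges_inv_def)
next
  fix e e' assume e: "e < m"
  show "rest ob (ob e) (nb e) = rest ob (ob e) e" "nb e = Suc e' \<Longrightarrow> e' < m \<and> ob e' = ob e"
    using inv e by (auto simp: edges_inv_def)
  show "eix (mn (ag e) + ob e) = Suc e" using inv e A(1)[of "ag e"] es_less[OF e] by (simp add: edges_inv_def)
next
  fix a b e assume ab: "a < n" "b < n" "eix (mn a + b) = Suc e"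
  then have e: "e < m" "a * n + b = ag e * n + ob e" using inv A(1)[of a] by (auto simp: edges_inv_def)
  then show "e < m \<and> ag e = a \<and> ob e = b" using mult_add_inj[of b n "ob e" a "ag e"] es_less[of e] ab by auto
next
  fix a b c assume abc: "a < n" "b < n" "c < n"
  have "(\<exists>j<p. key (a, b, c) = key (ps ! j)) \<longleftrightarrow> (a, b, c) \<in> set ps"
  proof
    assume "\<exists>j<p. key (a, b, c) = key (ps ! j)"
    then obtain j where j: "j < p" "key (a, b, c) = key (ps ! j)" by blast
    obtain a' b' c' where p: "ps ! j = (a', b', c')" by (cases "ps ! j") auto
    then have "(a', b', c') \<in> set ps" using nth_mem[OF j(1)] by simp
    moreover from this have "b' < n" "c' < n" using ps_less by blast+
    ultimately show "(a, b, c) \<in> set ps" using key_inj[of b c b' c' a a'] abc j(2) p by simp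
  next
    assume "(a, b, c) \<in> set ps"
    then show "\<exists>j<p. key (a, b, c) = key (ps ! j)" by (metis in_set_conv_nth)
  qed
  then show "vtab (mn2 a + mn b + c) = vt a b c"
    using abc A(1)[of b] A(2)[of a] unfolding vtab vt_def ps(2) by (simp add: key_def)
qed (use K n in auto)

definition run_cost :: "nat \<Rightarrow> nat \<Rightarrow> nat" where
  "run_cost k K = 9 * n + 10 * m + 7 * p + 20 + (guess_cost n m K k + 4 * k) * m ^ k"

lemma problem_iff:
  assumes "0 < n"
  shows "k_unpopularity_margin_problem k {..<n} {..<n} E P \<longleftrightarrow> (\<exists>G. (\<forall>j<k. G j < m) \<and>
    (\<exists>q g. guess.perfect n m ag ob vt (load k G) (conflict ag k G) q g \<and> (\<forall>b<n. q b < n)))"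
proof -
  interpret margin_market n m ag ob vt E P
    by unfold_locales (use E_eq assms in \<open>simp_all add: vt_def\<close>)
  show ?thesis
  proof
    assume "k_unpopularity_margin_problem k {..<n} {..<n} E P"
    then show "\<exists>G. (\<forall>j<k. G j < m) \<and> (\<exists>q g. guess.perfect n m ag ob vt (load k G) (conflict ag k G) q g \<and> (\<forall>b<n. q b < n))"
      using perfect_if_margin_le by metis
  qed (use margin_le_if_perfect in blast)
qed

lemma no_assignment_if_few_edges:
  assumes "m < n"
  shows "\<not> k_unpopularity_margin_problem k {..<n} {..<n} E P"
proof
  assume "k_unpopularity_margin_problem k {..<n} {..<n} E P"
  then obtain M where M: "M \<subseteq> E" "Domain M = {..<n}"
    unfolding k_unpopularity_margin_problem_def assignment_def matching_def by blast
  have fin: "finite E" using es(2) by auto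
  have "card (fst ` M) \<le> card M" using M(1) fin by (intro card_image_le) (rule finite_subset)
  moreover have "card M \<le> card E" using M(1) fin by (rule card_mono[rotated])
  ultimately show False using M(2) assms by (simp add: Domain_fst card_E)
qed

lemma problem_if_empty:
  assumes "n = 0"
  shows "k_unpopularity_margin_problem k {..<n} {..<n} E P"
proof -
  have "assignment {..<n} {..<n} E {}" using assms by (simp add: assignment_def matching_def)
  moreover have "{Delta {..<n} P N {} | N. assignment {..<n} {..<n} E N} = {0}"
    using calculation assms by (auto simp: Delta_def phi_def)
  ultimately show ?thesis unfolding k_unpopularity_margin_problem_def unpopularity_margin_def by fastforce
qed

lemma wp_main:
  assumes K: "K * K \<le> n" "n < Suc K * Suc K"
  shows "wp xs (main k) (\<lambda>v A t. v 0 = (if k_unpopularity_margin_problem k {..<n} {..<n} E P then 1 else 0) \<and>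
    t \<le> (if 0 < n \<and> n \<le> m then run_cost k K else 5)) (\<lambda>_. 0) (\<lambda>_ _. 0) 0"
proof -
  have h: "mem xs A 0 = n" "mem xs A (Suc 0) = m" for A
    using xs_header length_xs by (simp_all add: mem_def)
  consider "n = 0" | "0 < n" "m < n" | "0 < n" "n \<le> m" by linarith
  then show ?thesis
  proof cases
    case 1
    then show ?thesis using problem_if_empty by (simp add: main_def h)
  next
    case 2
    then show ?thesis using no_assignment_if_few_edges by (simp add: main_def h)
  next
    case 3
    let ?Q = "\<lambda>v A t. v 0 = (if k_unpopularity_margin_problem k {..<n} {..<n} E P then 1 else 0) \<and> t \<le> run_cost k K"
    let ?v = "(\<lambda>_. 0)(1 := n, 2 := m) :: env"
    note defs = setup_mul_def setup_mul2_def setup_edges_def edge_step_def setup_votes_def vote_step_def setup_sqrt_def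
    have "wp xs setup_mul (wp xs setup_mul2 (wp xs setup_edges (wp xs setup_votes (wp xs (Asg 19 (Cn 0))
        (wp xs setup_sqrt (wp xs (guesses k k) ?Q)))))) ?v (\<lambda>_ _. 0) 4"
    proof (rule wp_call[OF wp_setup_mul], simp, simp)
      fix v1 A1 t1
      assume 1: "(\<forall>a\<le>n. A1 4 a = a * n) \<and> t1 \<le> 4 + 3 * n + 2"
        and o: "same_off (mv setup_mul) v1 ?v" "same_off (ma setup_mul) A1 (\<lambda>_ _. 0)"
      have f1: "v1 1 = n" "v1 2 = m" "v1 0 = 0" "v1 4 = 0" "\<And>j. j \<noteq> 4 \<Longrightarrow> A1 j = (\<lambda>_. 0)"
        using same_offD[OF o(1)] same_offD[OF o(2)] by (simp_all add: defs)
      show "wp xs setup_mul2 (wp xs setup_edges (wp xs setup_votes (wp xs (Asg 19 (Cn 0))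
        (wp xs setup_sqrt (wp xs (guesses k k) ?Q))))) v1 A1 t1"
      proof (rule wp_call[OF wp_setup_mul2[of v1 A1]])
        fix v2 A2 t2
        assume 2: "(\<forall>a\<le>n. A2 5 a = a * (n * n)) \<and> t2 \<le> t1 + 3 * n + 2"
          and o: "same_off (mv setup_mul2) v2 v1" "same_off (ma setup_mul2) A2 A1"
        have f2: "v2 1 = n" "v2 2 = m" "v2 0 = 0" "v2 4 = 0" "A2 4 = A1 4" "\<And>j. j \<noteq> 4 \<Longrightarrow> j \<noteq> 5 \<Longrightarrow> A2 j = (\<lambda>_. 0)"
          using same_offD[OF o(1)] same_offD[OF o(2)] f1 by (simp_all add: defs)
        have mn2: "A2 4 a = a * n" if "a \<le> n" for a using 1 f2(5) that by simp
        show "wp xs setup_edges (wp xs setup_votes (wp xs (Asg 19 (Cn 0))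
          (wp xs setup_sqrt (wp xs (guesses k k) ?Q)))) v2 A2 t2"
        proof (rule wp_call[OF wp_setup_edges[of v2 A2, OF f2(2) mn2]])
          fix v3 A3 t3
          assume 3: "edges_inv m (A3 0) (A3 1) (A3 3) \<and> A3 17 = ag \<and> A3 18 = ob \<and> v3 18 = 2 + 2 * m \<and>
              t3 \<le> t2 + 10 * m + 3"
            and o: "same_off (mv setup_edges) v3 v2" "same_off (ma setup_edges) A3 A2"
          have f3: "v3 1 = n" "v3 2 = m" "v3 0 = 0" "v3 4 = 0" "A3 4 = A2 4" "A3 5 = A2 5" "A3 2 = (\<lambda>_. 0)"
            using same_offD[OF o(1)] same_offD[OF o(2)] f2 by (simp_all add: defs)
          have mn3: "A3 4 a = a * n" "A3 5 a = a * (n * n)" if "a \<le> n" for a using 2 mn2 f3(5,6) that by simp_all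
          have v18: "v3 18 = 2 + 2 * m" using 3 by blast
          show "wp xs setup_votes (wp xs (Asg 19 (Cn 0)) (wp xs setup_sqrt (wp xs (guesses k k) ?Q))) v3 A3 t3"
          proof (rule wp_call[OF wp_setup_votes[of v3 A3, OF v18 f3(7) mn3]])
            fix v4 A4 t4
            assume 4: "A4 2 = (\<lambda>y. of_bool (\<exists>j<p. y = key (ps ! j))) \<and> t4 \<le> t3 + 7 * p + 4"
              and o: "same_off (mv setup_votes) v4 v3" "same_off (ma setup_votes) A4 A3"
            have f4: "v4 1 = n" "v4 2 = m" "v4 0 = 0" "v4 4 = 0"
              "A4 0 = A3 0" "A4 1 = A3 1" "A4 3 = A3 3" "A4 4 = A3 4" "A4 5 = A3 5" "A4 17 = A3 17" "A4 18 = A3 18"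
              using same_offD[OF o(1)] same_offD[OF o(2)] f3 by (simp_all add: defs)
            have "wp xs setup_sqrt (wp xs (guesses k k) ?Q) (v4(19 := 0)) A4 (Suc t4)"
            proof (rule wp_call[OF wp_setup_sqrt])
              fix v5 A5 t5
              assume 5: "v5 4 * v5 4 \<le> n \<and> n < Suc (v5 4) * Suc (v5 4) \<and> t5 \<le> Suc t4 + 3 * n + 1"
                and o: "same_off (mv setup_sqrt) v5 (v4(19 := 0))" "same_off (ma setup_sqrt) A5 A4"
              have f5: "v5 1 = n" "v5 2 = m" "v5 0 = 0" and A5: "A5 = A4"
                using same_offD[OF o(1)] same_offD[OF o(2)] f4 by (simp_all add: defs fun_eq_iff)
              have "v5 4 < Suc K" "K < Suc (v5 4)"
                using 5 K by (metis le_less_trans mult_le_mono not_le)+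
              then have K5: "v5 4 = K" by simp
              interpret tables n m ag ob vt "A4 0" "A4 1" "A4 4" "A4 5" "A4 2" "A4 3" K
                using 3 4 f4 mn3 K \<open>0 < n\<close> \<open>n \<le> m\<close> by (intro tables_setup) auto
              have tab: "tabled v5 A5" unfolding tabled_def A5 using f5 f4 3 K5 by simp
              show "wp xs (guesses k k) ?Q v5 A5 t5"
              proof (rule wp_call[OF wp_all_guesses[OF tab f5(3)]])
                fix v6 A6 t6
                assume 6: "v6 0 = (if \<exists>G. (\<forall>j<k. G j < m) \<and> good k G then 1 else 0) \<and>
                    t6 \<le> t5 + (guess_cost n m K k + 4 * k) * m ^ k"
                have "v6 0 = (if k_unpopularity_margin_problem k {..<n} {..<n} E P then 1 else 0)"
                  unfolding problem_iff[OF \<open>0 < n\<close>] using 6 unfolding good_def by blast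
                moreover have "t6 \<le> run_cost k K" unfolding run_cost_def using 1 2 3 4 5 6 by linarith
                ultimately show "?Q v6 A6 t6" by blast
              qed
            qed (use f4 in simp_all)
            then show "wp xs (Asg 19 (Cn 0)) (wp xs setup_sqrt (wp xs (guesses k k) ?Q)) v4 A4 t4" by simp
          qed
        qed (use f2 in simp_all)
      qed (use f1 1 in simp_all)
    qed
    then show ?thesis using 3 by (simp add: main_def h wp_Sq numeral_eq_Suc)
  qed
qed

end

section \<open>The running time\<close>

lemma sqrt_exists: "\<exists>K. K * K \<le> n \<and> n < Suc K * Suc (K::nat)"
proof (induction n)
  case (Suc n)
  then obtain K where K: "K * K \<le> n" "n < Suc K * Suc K" by blast
  show ?case
  proof (cases "Suc n < Suc K * Suc K")
    case True
    then show ?thesis using K by (intro exI[of _ K]) simp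
  next
    case False
    then show ?thesis using K by (intro exI[of _ "Suc K"]) simp
  qed
qed simp

text \<open>The rounds dominate. The initial counting is absorbed by \<open>m \<le> n * n\<close>,
  terms in \<open>n\<close> by \<open>n \<le> m\<close>, and constants by \<open>m\<close> being
  positive.\<close>

lemma guess_cost_le:
  assumes "0 < n" "n \<le> m" "m \<le> n * n"
  shows "guess_cost n m K k \<le> (360 + 9 * k) * (m * (n * n) * (K + 1))"
proof -
  let ?X = "m * (n * n) * (K + 1)"
  have N: "1 \<le> n * n" "1 \<le> m" using assms by simp_all
  have nn: "n * n + 1 \<le> 2 * (n * n)" using N by simp
  have X: "m * (n * n) \<le> ?X" "m \<le> m * (n * n)" using N by simp_all
  have "(K + 2) * (m + n) \<le> (2 * (K + 1)) * (2 * m)" using assms by (intro mult_le_mono) simp_all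
  also have "\<dots> = 4 * (m * (K + 1))" by (simp add: algebra_simps)
  finally have "13 * ((K + 2) * (m + n)) \<le> 13 * (4 * (m * (K + 1)))" by (rule mult_le_mono2)
  moreover have "(10 * (m + n) + 10 * n + 30) * (K + 1) \<le> (60 * m) * (K + 1)"
    using assms N by (intro mult_le_mono1) simp
  moreover have "14 * m + 11 * n + 20 \<le> 45 * m" using assms N by simp
  moreover have "m \<le> m * (K + 1)" by simp
  ultimately have "13 * ((K + 2) * (m + n)) + (10 * (m + n) + 10 * n + 30) * (K + 1) + 14 * m + 11 * n + 20 \<le>
      157 * (m * (K + 1))" by linarith
  then have "(13 * ((K + 2) * (m + n)) + (10 * (m + n) + 10 * n + 30) * (K + 1) + 14 * m + 11 * n + 20) * (n * n + 1) \<le>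
      157 * (m * (K + 1)) * (2 * (n * n))" using nn by (rule mult_le_mono)
  also have "\<dots> = 314 * ?X" by (simp add: algebra_simps)
  finally have 1: "(13 * ((K + 2) * (m + n)) + (10 * (m + n) + 10 * n + 30) * (K + 1) + 14 * m + 11 * n + 20) * (n * n + 1) \<le>
      314 * ?X" .
  have "(6 * k + 10) * 1 \<le> (6 * k + 10) * (n * n)" using N(1) by (rule mult_le_mono2)
  then have "8 * m + 6 * k + 10 \<le> 8 * (n * n) + (6 * k + 10) * (n * n)"
    using add_le_mono[OF mult_le_mono2[OF assms(3), of 8]] by (simp only: mult_1_right add.assoc)
  then have "(8 * m + 6 * k + 10) * m \<le> (8 * (n * n) + (6 * k + 10) * (n * n)) * m" by (rule mult_le_mono1)
  also have "\<dots> = (18 + 6 * k) * (m * (n * n))" by (simp add: algebra_simps)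
  also have "\<dots> \<le> (18 + 6 * k) * ?X" using X by (intro mult_le_mono2) simp
  finally have 2: "(8 * m + 6 * k + 10) * m \<le> (18 + 6 * k) * ?X" .
  have 3: "3 * n + 3 * m \<le> 6 * ?X" using assms X by linarith
  have "1 \<le> ?X" using N X by linarith
  then have 4: "10 \<le> 10 * ?X" "3 * k \<le> 3 * k * ?X" by simp_all
  have "guess_cost n m K k \<le> 6 * ?X + 3 * k * ?X + (18 + 6 * k) * ?X + 314 * ?X + 10 * ?X"
    unfolding guess_cost_def using 1 2 3 4 by linarith
  also have "\<dots> \<le> (360 + 9 * k) * ?X" by (simp add: algebra_simps)
  finally show ?thesis .
qed

text \<open>\<open>K + 1\<close> is at most twice the square root of \<open>n\<close>, which turns
  \<open>m * (n * n) * (K + 1) * m ^ k\<close> into the claimed bound with a factor 2.\<close>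

lemma (in encoded) run_cost_le:
  assumes n: "0 < n" "n \<le> m" and K: "K * K \<le> n"
  shows "real (run_cost k K) \<le> 2 * (410 + 13 * real k) * (real m ^ (k + 1) * real n powr (5 / 2))"
proof -
  let ?X = "m * (n * n) * (K + 1)"
  have N: "1 \<le> n * n" "1 \<le> m" "1 \<le> m ^ k" using n by simp_all
  have "m * n \<le> m * (n * n)" "m * (n * n) * 1 \<le> ?X" by (intro mult_le_mono2; simp)+
  then have X: "m * n \<le> ?X" by linarith
  have m: "m \<le> m * n" using n by simp
  have "p \<le> ?X" using p_le X by linarith
  then have "9 * n + 10 * m + 7 * p + 20 \<le> 46 * ?X" using n N X m by linarith
  also have "\<dots> \<le> 46 * ?X * m ^ k" using N(3) by simp
  finally have 1: "9 * n + 10 * m + 7 * p + 20 \<le> 46 * ?X * m ^ k" .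
  have "guess_cost n m K k + 4 * k \<le> (360 + 9 * k) * ?X + 4 * k * ?X"
  proof (rule add_le_mono[OF guess_cost_le[OF n m_le]])
    have "1 \<le> ?X" using N(2) X m by linarith
    then have "4 * k * 1 \<le> 4 * k * ?X" by (rule mult_le_mono2)
    then show "4 * k \<le> 4 * k * ?X" by (simp only: mult_1_right)
  qed
  also have "\<dots> = (360 + 13 * k) * ?X" by (simp add: algebra_simps)
  finally have "(guess_cost n m K k + 4 * k) * m ^ k \<le> (360 + 13 * k) * ?X * m ^ k" by (rule mult_le_mono1)
  then have "run_cost k K \<le> 46 * ?X * m ^ k + (360 + 13 * k) * ?X * m ^ k"
    unfolding run_cost_def using 1 by linarith
  also have "\<dots> \<le> (410 + 13 * k) * (?X * m ^ k)" by (simp add: algebra_simps)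
  finally have le: "real (run_cost k K) \<le> real ((410 + 13 * k) * (?X * m ^ k))" by (simp only: of_nat_le_iff)
  have "real K \<le> sqrt (real n)"
    using K by (intro real_le_rsqrt) (simp add: power2_eq_square flip: of_nat_mult)
  moreover have "1 \<le> sqrt (real n)" using n by simp
  ultimately have "real (K + 1) \<le> 2 * sqrt (real n)" unfolding of_nat_add of_nat_1 by linarith
  then have "real ?X * real m ^ k \<le> real m * (real n * real n) * (2 * sqrt (real n)) * real m ^ k"
    unfolding of_nat_mult by (intro mult_right_mono mult_left_mono) simp_all
  also have "\<dots> = 2 * (real m ^ (k + 1) * (real n * real n * sqrt (real n)))" by simp
  also have "real n * real n * sqrt (real n) = real n powr (5 / 2)"
  proof -
    have "real n powr (5 / 2) = real n powr (2 + 1 / 2)" by simp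
    also have "\<dots> = real n powr 2 * real n powr (1 / 2)" by (rule powr_add)
    finally show ?thesis using n by (simp add: powr_half_sqrt power2_eq_square)
  qed
  finally have "real (?X * m ^ k) \<le> 2 * (real m ^ (k + 1) * real n powr (5 / 2))" by simp
  then have "(410 + 13 * real k) * real (?X * m ^ k) \<le>
      (410 + 13 * real k) * (2 * (real m ^ (k + 1) * real n powr (5 / 2)))" by (intro mult_left_mono) simp_all
  then show ?thesis using le by (simp add: algebra_simps)
qed

theorem theorem2:
  fixes k :: nat
  shows "solvable_in_time_O encodes_margin_instance
           (\<lambda>(n, E, P). k_unpopularity_margin_problem k {..<n} {..<n} E P)
           (\<lambda>(n, E, P). real (card E) ^ (k + 1) * real n powr (5 / 2))"
  unfolding solvable_in_time_O_def
proof (intro exI allI impI)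
  fix I xs assume enc: "encodes_margin_instance I xs"
  obtain n E P where I: "I = (n, E, P)" by (cases I) auto
  obtain es ps where "encoded n E P es ps xs"
    using enc unfolding I by (auto simp: encoded_def)
  then interpret encoded n E P es ps xs .
  obtain K where K: "K * K \<le> n" "n < Suc K * Suc K" using sqrt_exists by blast
  let ?f = "real (card E) ^ (k + 1) * real n powr (5 / 2)"
  let ?T = "if 0 < n \<and> n \<le> m then run_cost k K else 5"
  \<comment> \<open>\<open>2011 = 11 + 400 * 5\<close> covers the trivial instances and the start-up
    time of the others; \<open>800 = 400 * 2\<close> is compilation overhead times the factor in
    \<open>run_cost_le\<close>.\<close>
  let ?C = "2011 + 800 * (410 + 13 * real k)"
  have C: "0 \<le> ?C" by simp
  have "real (11 + 400 * ?T) \<le> ?C * max 1 ?f"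
  proof (cases "0 < n \<and> n \<le> m")
    case True
    then have "real (run_cost k K) \<le> 2 * (410 + 13 * real k) * ?f"
      using run_cost_le[OF _ _ K(1)] by (simp add: card_E)
    also have "\<dots> \<le> 2 * (410 + 13 * real k) * max 1 ?f" by (intro mult_left_mono) simp_all
    finally have le: "real (run_cost k K) \<le> 2 * (410 + 13 * real k) * max 1 ?f" .
    have "11 + 400 * r \<le> ?C * F" if "r \<le> 2 * (410 + 13 * real k) * F" "1 \<le> F" for r F :: real
    proof -
      have "400 * r \<le> 400 * (2 * (410 + 13 * real k) * F)" using that(1) by simp
      also have "\<dots> = 800 * (410 + 13 * real k) * F" by simp
      finally have "11 + 400 * r \<le> 2011 * F + 800 * (410 + 13 * real k) * F" using that(2) by linarith
      then show ?thesis by (simp only: distrib_right)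
    qed
    from this[OF le] show ?thesis using True by simp
  next
    case False
    have "real (11 + 400 * ?T) = 2011" using False by (simp only: if_False)
    also have "2011 \<le> ?C * 1" by simp
    also have "?C * 1 \<le> ?C * max 1 ?f" using C by (intro mult_left_mono) simp_all
    finally show ?thesis .
  qed
  then have "decides_within (Seq prologue (cp (main k))) xs
      (k_unpopularity_margin_problem k {..<n} {..<n} E P) (?C * max 1 ?f)"
    by (rule decides_within_compile[OF length_xs xs_header(2,3) wfc_main wp_main[OF K]])
  then show "decides_within (Seq prologue (cp (main k))) xs
      ((\<lambda>(n, E, P). k_unpopularity_margin_problem k {..<n} {..<n} E P) I)
      (?C * max 1 ((\<lambda>(n, E, P). real (card E) ^ (k + 1) * real n powr (5 / 2)) I))"
    unfolding I by simp
qed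

end
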